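(* Let $X$ be a $\frac{d}{dm}\frac{d}{ds}$-diffusion on $[0,b)$ ($0<b\le\infty$) stopped at $0$, where the boundary $0$ is accessible (regular or exit), and let $\sigma$ be the spectral measure of $\frac{d}{dm}\frac{d}{ds}$. Assume that $$\int_0^\infty e^{-\lambda t}\,\sigma(d\lambda)<\infty\quad\text{for all }t>0.$$ Let $\nu$ be a probability measure on $(0,b)$ of the form $\nu=\eta\,dm$ for some $\eta\in L^2(dm)$, and let $f_\nu(t)=\int_0^b f_x(t)\,\nu(dx)$ ($t>0$), where $f_x$ is the density of the first hitting time $T_0$ of $0$ under $\mathbb{P}_x$. Then $f_\nu\in\mathrm{CM}$, i.e. $f_\nu$ is a difference of two completely monotone functions on $(0,\infty)$, and $$\frac{d\nu}{dm}(x)=\int_0^\infty\psi_{-\lambda}(x)\,(\mathcal{L}^{-1}f_\nu)(d\lambda)\qquad m\text{-a.e.}$$ Therefore the initial distribution $\nu$ can be reproduced from $f_\nu$.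
   Context: Setting. $s$ is a continuous strictly increasing scale function on $(0,b)$ and $dm$ is a speed measure on $(0,b)$ (a Radon measure with full support). That $0$ is accessible means $s(0):=s(0+)>-\infty$ and $\int_0^c(s(x)-s(0))\,dm(x)<\infty$ for some (every) $c\in(0,b)$. $X$ is the diffusion on $[0,b)$ with generator $\frac{d}{dm}\frac{d}{ds}$, stopped at $0$; if the boundary $b$ is regular, the Dirichlet (absorbing) boundary condition is imposed at $b$. For $\lambda\in\mathbb{R}$, $u=\psi_\lambda$ is the unique solution of $\frac{d}{dm}\frac{d}{ds}u=\lambda u$ on $(0,b)$, $u(0)=0$, $\frac{d}{ds}u(0)=1$. The spectral measure $\sigma$ is the measure on $[0,\infty)$ such that $\int_0^b f^2\,dm=\int_0^\infty\hat f(\lambda)^2\sigma(d\lambda)$ for all $f\in L^2(dm)$ vanishing on $[R,b)$ for some $R\in(0,b)$, where $\hat f(\lambda)=\int_0^bf(x)\psi_{-\lambda}(x)\,dm(x)$, and such that the transition density of $X$ with respect to $dm$ is $p(t,x,y)=\int_0^\infty e^{-\lambda t}\psi_{-\lambda}(x)\psi_{-\lambda}(y)\,\sigma(d\lambda)$. The map $f\mapsto\hat f$ extends to a unitary map $L^2(dm)\to L^2(\sigma)$ (the generalized Fourier transform), whose inverse extends $g\mapsto\check g$, $\check g(x)=\int_0^\infty g(\lambda)\psi_{-\lambda}(x)\,\sigma(d\lambda)$, defined for $g\in L^2(\sigma)$ vanishing on $[R,\infty)$ for some $R>0$. Under the assumed finiteness of the Laplace transform of $\sigma$, it is known that for every $x\in(0,b)$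 the law of $T_0$ under $\mathbb{P}_x$ has on $(0,\infty)$ the density $f_x(t)=\int_0^\infty e^{-\lambda t}\psi_{-\lambda}(x)\,\sigma(d\lambda)$ ($t>0$). A function $f:(0,\infty)\to\mathbb{R}$ is completely monotone if $(-1)^kf^{(k)}(t)\ge0$ for all $k\ge0$, $t>0$; $\mathrm{CM}:=\{f-g\mid f,g\text{ completely monotone}\}$. $\mathcal{M}$ is the set of (not necessarily finite) signed measures $\mu$ on the half-line $[0,\infty)$ with $\int_0^\infty e^{-\lambda t}|\mu|(d\lambda)<\infty$ for all $t>0$, where $|\mu|$ is the total variation measure. The Laplace transform $\mathcal{L}\mu(t)=\int_0^\infty e^{-\lambda t}\mu(d\lambda)$ is a bijection from $\mathcal{M}$ to $\mathrm{CM}$ (Bernstein's theorem), and $\mathcal{L}^{-1}:\mathrm{CM}\to\mathcal{M}$ is its inverse.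
   Formalization: The integral of ψ_{-λ}(x) against L^{-1}f_ν need not converge absolutely (e.g. Brownian motion, ν uniform on (0,1)); the formula is read as the L²(dm)-limit of the integrals over [0,R], and as literal equality for m-a.e. x where the integral converges absolutely. *)

theory Defs
  imports "HOL-Probability.Probability"
begin

section \<open>Scale function, speed measure and the operator $\frac{d}{dm}\frac{d}{ds}$\<close>

abbreviation interior_pts :: "ereal \<Rightarrow> real set"
  where "interior_pts b \<equiv> {x. 0 < x \<and> ereal x < b}"

definition scale_function :: "ereal \<Rightarrow> (real \<Rightarrow> real) \<Rightarrow> bool"
  where "scale_function b s \<longleftrightarrow>
    continuous_on (interior_pts b) s \<and> strict_mono_on (interior_pts b) s"

text \<open>A measure on $(0,b)$ is encoded as a Borel measure on the line that does not charge
  the complement of $(0,b)$.  Atoms are allowed, and the mass near \<open>0\<close> and near \<open>b\<close> may be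
  infinite.\<close>

definition speed_measure :: "ereal \<Rightarrow> real measure \<Rightarrow> bool"
  where "speed_measure b m \<longleftrightarrow>
    sets m = sets borel \<and> emeasure m (- interior_pts b) = 0 \<and>
    (\<forall>x y. 0 < x \<longrightarrow> x < y \<longrightarrow> ereal y < b \<longrightarrow> emeasure m {x..y} < \<infinity> \<and> 0 < emeasure m {x<..<y})"

text \<open>The first conjunct says that $s(0+)$ is finite and that the value \<open>s 0\<close>, which a scale
  function on $(0,b)$ leaves open, stands for it.\<close>

definition zero_accessible :: "ereal \<Rightarrow> (real \<Rightarrow> real) \<Rightarrow> real measure \<Rightarrow> bool"
  where "zero_accessible b s m \<longleftrightarrow>
    (s \<longlongrightarrow> s 0) (at_right 0) \<and>
    (\<exists>c. 0 < c \<and> ereal c < b \<and> (\<integral>\<^sup>+x\<in>{0<..c}. ennreal (s x - s 0) \<partial>m) < \<infinity>)"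

text \<open>$\frac{du}{ds}$ is the right derivative with respect to \<open>s\<close>; it is right-continuous and
  jumps at the atoms of \<open>m\<close>.\<close>

definition has_scale_deriv :: "(real \<Rightarrow> real) \<Rightarrow> (real \<Rightarrow> real) \<Rightarrow> real \<Rightarrow> real \<Rightarrow> bool"
  where "has_scale_deriv s u D x \<longleftrightarrow>
    ((\<lambda>y. (u y - u x) / (s y - s x)) \<longlongrightarrow> D) (at_right x)"

text \<open>$\frac{d}{dm}\frac{d}{ds}u = g$ on $(0,b)$: the derivative with respect to \<open>m\<close> is meant in
  the Radon--Nikodym sense, $d\bigl(\frac{du}{ds}\bigr) = g\,dm$.\<close>

definition dmds :: "ereal \<Rightarrow> (real \<Rightarrow> real) \<Rightarrow> real measure \<Rightarrow> (real \<Rightarrow> real) \<Rightarrow> (real \<Rightarrow> real) \<Rightarrow> bool"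
  where "dmds b s m u g \<longleftrightarrow>
    continuous_on (interior_pts b) u \<and>
    (\<exists>w. (\<forall>x\<in>interior_pts b. has_scale_deriv s u (w x) x) \<and>
         (\<forall>x y. 0 < x \<longrightarrow> x < y \<longrightarrow> ereal y < b \<longrightarrow>
            set_integrable m {x<..y} g \<and> w y - w x = (LINT z:{x<..y}|m. g z)))"

text \<open>\<open>u\<close> is the eigenfunction $\psi_l$.  It lives on $[0,b)$ and is set to \<open>0\<close> elsewhere, which
  makes it unique as a function on the line.\<close>

definition is_psi :: "ereal \<Rightarrow> (real \<Rightarrow> real) \<Rightarrow> real measure \<Rightarrow> real \<Rightarrow> (real \<Rightarrow> real) \<Rightarrow> bool"
  where "is_psi b s m l u \<longleftrightarrow>
    continuous_on {x. 0 \<le> x \<and> ereal x < b} u \<and> dmds b s m u (\<lambda>x. l * u x) \<and>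
    u 0 = 0 \<and> has_scale_deriv s u 1 0 \<and> (\<forall>x. x < 0 \<or> b \<le> ereal x \<longrightarrow> u x = 0)"

section \<open>The diffusion stopped at the origin\<close>

text \<open>The state space $[0,b)$ together with a cemetery is realised as the closed interval
  \<open>{0..b}\<close> of extended reals, the point \<open>b\<close> being the cemetery.  Paths are absorbed at \<open>0\<close>
  (stopping) and at \<open>b\<close> (killing, which is the Dirichlet condition when \<open>b\<close> is regular).
  Functions on $[0,b)$ are extended by \<open>0\<close> to the cemetery.\<close>

definition extend0 :: "ereal \<Rightarrow> (real \<Rightarrow> real) \<Rightarrow> ereal \<Rightarrow> real"
  where "extend0 b v y = (if 0 \<le> y \<and> y < b then v (real_of_ereal y) else 0)"

definition natural_filtration :: "'w measure \<Rightarrow> (real \<Rightarrow> 'w \<Rightarrow> ereal) \<Rightarrow> real \<Rightarrow> 'w measure"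
  where "natural_filtration M X t =
    sigma (space M) {X u -` B \<inter> space M | u B. 0 \<le> u \<and> u \<le> t \<and> B \<in> sets borel}"

definition strong_Markov ::
  "ereal \<Rightarrow> 'w measure \<Rightarrow> (real \<Rightarrow> 'w \<Rightarrow> ereal) \<Rightarrow> (ereal \<Rightarrow> 'w measure) \<Rightarrow> bool"
  where "strong_Markov b M X P \<longleftrightarrow>
    (\<forall>x\<in>{0..b}. \<forall>\<tau> A B t.
       stopping_time (natural_filtration M X) \<tau> \<longrightarrow> (\<forall>\<omega>\<in>space M. 0 \<le> \<tau> \<omega>) \<longrightarrow>
       A \<in> sets (filtration.pre_sigma (space M) (natural_filtration M X) \<tau>) \<longrightarrow>
       B \<in> sets borel \<longrightarrow> 0 \<le> t \<longrightarrow>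
       emeasure (P x) {\<omega>\<in>A. X (\<tau> \<omega> + t) \<omega> \<in> B} =
       (\<integral>\<^sup>+\<omega>\<in>A. emeasure (P (X (\<tau> \<omega>) \<omega>)) {\<omega>'\<in>space M. X t \<omega>' \<in> B} \<partial>P x))"

text \<open>Pairs \<open>(v, g)\<close> with \<open>v\<close> vanishing near \<open>b\<close> and $g = \frac{d}{dm}\frac{d}{ds}v$ bounded.
  There is no condition on \<open>v 0\<close>; instead \<open>g 0 = 0\<close>, because \<open>0\<close> is absorbing.\<close>

definition test_pair :: "ereal \<Rightarrow> (real \<Rightarrow> real) \<Rightarrow> real measure \<Rightarrow> (real \<Rightarrow> real) \<Rightarrow> (real \<Rightarrow> real) \<Rightarrow> bool"
  where "test_pair b s m v g \<longleftrightarrow>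
    continuous_on {x. 0 \<le> x \<and> ereal x < b} v \<and> (\<exists>R\<in>interior_pts b. \<forall>x\<ge>R. v x = 0) \<and>
    g \<in> borel_measurable borel \<and> bounded (range g) \<and> g 0 = 0 \<and> dmds b s m v g"

text \<open>That the generator is $\frac{d}{dm}\frac{d}{ds}$ is expressed by Dynkin's formula
  $\mathbb{E}_x v(X_t) = v(x) + \int_0^t \mathbb{E}_x g(X_r)\,dr$ for all test pairs.\<close>

definition has_generator ::
  "ereal \<Rightarrow> (real \<Rightarrow> real) \<Rightarrow> real measure \<Rightarrow> (real \<Rightarrow> 'w \<Rightarrow> ereal) \<Rightarrow> (ereal \<Rightarrow> 'w measure) \<Rightarrow> bool"
  where "has_generator b s m X P \<longleftrightarrow>
    (\<forall>v g x t. test_pair b s m v g \<longrightarrow> x \<in> interior_pts b \<longrightarrow> 0 \<le> t \<longrightarrow>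
       (\<integral>\<omega>. extend0 b v (X t \<omega>) \<partial>P (ereal x)) =
       v x + (LINT r:{0..t}|lborel. (\<integral>\<omega>. extend0 b g (X r \<omega>) \<partial>P (ereal x))))"

definition stopped_diffusion ::
  "ereal \<Rightarrow> (real \<Rightarrow> real) \<Rightarrow> real measure \<Rightarrow> 'w measure \<Rightarrow> (real \<Rightarrow> 'w \<Rightarrow> ereal) \<Rightarrow> (ereal \<Rightarrow> 'w measure) \<Rightarrow> bool"
  where "stopped_diffusion b s m M X P \<longleftrightarrow>
    (\<forall>t\<ge>0. X t \<in> borel_measurable M) \<and>
    (\<forall>\<omega>\<in>space M. continuous_on {0..} (\<lambda>t. X t \<omega>) \<and> (\<forall>t\<ge>0. X t \<omega> \<in> {0..b})) \<and>
    (\<forall>\<omega>\<in>space M. \<forall>t u. 0 \<le> t \<longrightarrow> t \<le> u \<longrightarrow> X t \<omega> \<in> {0, b} \<longrightarrow> X u \<omega> = X t \<omega>) \<and>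
    P \<in> restrict_space borel {0..b} \<rightarrow>\<^sub>M prob_algebra M \<and>
    (\<forall>x\<in>{0..b}. AE \<omega> in P x. X 0 \<omega> = x) \<and>
    strong_Markov b M X P \<and> has_generator b s m X P"

definition hitting_time0 :: "(real \<Rightarrow> 'w \<Rightarrow> ereal) \<Rightarrow> 'w \<Rightarrow> ereal"
  where "hitting_time0 X \<omega> = Inf (ereal ` {t. 0 \<le> t \<and> X t \<omega> = 0})"

text \<open>A density is only determined almost everywhere, whereas $f_\nu(t)$ is wanted for every
  \<open>t\<close>; requiring continuity in \<open>t\<close> selects the usual version.\<close>

definition is_hitting_density ::
  "ereal \<Rightarrow> 'w measure \<Rightarrow> (real \<Rightarrow> 'w \<Rightarrow> ereal) \<Rightarrow> (ereal \<Rightarrow> 'w measure) \<Rightarrow> (real \<Rightarrow> real \<Rightarrow> real) \<Rightarrow> bool"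
  where "is_hitting_density b M X P f \<longleftrightarrow>
    (\<forall>x\<in>interior_pts b.
       continuous_on {0<..} (f x) \<and> (\<forall>t>0. 0 \<le> f x t) \<and>
       (\<forall>A\<in>sets borel. A \<subseteq> {0<..} \<longrightarrow>
          emeasure (P (ereal x)) {\<omega>\<in>space M. hitting_time0 X \<omega> \<in> ereal ` A} =
          (\<integral>\<^sup>+t\<in>A. ennreal (f x t) \<partial>lborel)))"

definition mixed_density :: "ereal \<Rightarrow> (real \<Rightarrow> real \<Rightarrow> real) \<Rightarrow> real measure \<Rightarrow> real \<Rightarrow> real"
  where "mixed_density b f \<nu> t = (LINT x:interior_pts b|\<nu>. f x t)"

section \<open>The spectral measure\<close>

definition L2_fun :: "real measure \<Rightarrow> (real \<Rightarrow> real) \<Rightarrow> bool"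
  where "L2_fun m h \<longleftrightarrow> h \<in> borel_measurable m \<and> integrable m (\<lambda>x. (h x)\<^sup>2)"

definition spectral_transform :: "real measure \<Rightarrow> (real \<Rightarrow> real \<Rightarrow> real) \<Rightarrow> (real \<Rightarrow> real) \<Rightarrow> real \<Rightarrow> real"
  where "spectral_transform m \<psi> h l = (\<integral>x. h x * \<psi> (- l) x \<partial>m)"

definition spectral_kernel ::
  "(real \<Rightarrow> real \<Rightarrow> real) \<Rightarrow> real measure \<Rightarrow> real \<Rightarrow> real \<Rightarrow> real \<Rightarrow> real"
  where "spectral_kernel \<psi> \<sigma> t x y = (\<integral>l. exp (- l * t) * \<psi> (- l) x * \<psi> (- l) y \<partial>\<sigma>)"

text \<open>Parseval's identity alone need not determine \<open>\<sigma>\<close> when boundary conditions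
  at \<open>b\<close> can be chosen; the formula for the transition density of \<open>X\<close> does.\<close>

definition spectral_measure ::
  "ereal \<Rightarrow> real measure \<Rightarrow> (real \<Rightarrow> real \<Rightarrow> real) \<Rightarrow> 'w measure \<Rightarrow> (real \<Rightarrow> 'w \<Rightarrow> ereal) \<Rightarrow>
   (ereal \<Rightarrow> 'w measure) \<Rightarrow> real measure \<Rightarrow> bool"
  where "spectral_measure b m \<psi> M X P \<sigma> \<longleftrightarrow>
    sets \<sigma> = sets borel \<and> emeasure \<sigma> {..<0} = 0 \<and>
    (\<forall>h. L2_fun m h \<longrightarrow> (\<exists>R\<in>interior_pts b. \<forall>x\<ge>R. h x = 0) \<longrightarrow>
       (\<integral>\<^sup>+x. ennreal ((h x)\<^sup>2) \<partial>m) = (\<integral>\<^sup>+l. ennreal ((spectral_transform m \<psi> h l)\<^sup>2) \<partial>\<sigma>)) \<and>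
    (\<forall>t>0. \<forall>x\<in>interior_pts b. \<forall>y\<in>interior_pts b.
       integrable \<sigma> (\<lambda>l. exp (- l * t) * \<psi> (- l) x * \<psi> (- l) y) \<and>
       0 \<le> spectral_kernel \<psi> \<sigma> t x y) \<and>
    (\<forall>t>0. \<forall>x\<in>interior_pts b. \<forall>A\<in>sets borel. A \<subseteq> interior_pts b \<longrightarrow>
       emeasure (P (ereal x)) {\<omega>\<in>space M. X t \<omega> \<in> ereal ` A} =
       (\<integral>\<^sup>+y\<in>A. ennreal (spectral_kernel \<psi> \<sigma> t x y) \<partial>m))"

section \<open>Completely monotone functions and Laplace transforms of signed measures\<close>

definition completely_monotone :: "(real \<Rightarrow> real) \<Rightarrow> bool"
  where "completely_monotone f \<longleftrightarrow>
    (\<forall>k. \<forall>t>0. (deriv ^^ k) f differentiable at t \<and> 0 \<le> (- 1) ^ k * (deriv ^^ k) f t)"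

definition CM :: "(real \<Rightarrow> real) set"
  where "CM = {h. \<exists>f g. completely_monotone f \<and> completely_monotone g \<and> (\<forall>t>0. h t = f t - g t)}"

text \<open>A possibly infinite signed measure $\mu$ is represented by its Jordan decomposition
  $(\mu^+, \mu^-)$, a pair of mutually singular measures; hence $|\mu| = \mu^+ + \mu^-$ and the
  representation is unique.\<close>

type_synonym signed_meas = "real measure \<times> real measure"

definition laplace_measures :: "signed_meas set"
  where "laplace_measures = {(\<mu>p, \<mu>n).
    sets \<mu>p = sets borel \<and> sets \<mu>n = sets borel \<and>
    emeasure \<mu>p {..<0} = 0 \<and> emeasure \<mu>n {..<0} = 0 \<and>
    (\<exists>D\<in>sets borel. emeasure \<mu>p D = 0 \<and> emeasure \<mu>n (- D) = 0) \<and>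
    (\<forall>t>0. (\<integral>\<^sup>+l. ennreal (exp (- l * t)) \<partial>\<mu>p) + (\<integral>\<^sup>+l. ennreal (exp (- l * t)) \<partial>\<mu>n) < \<infinity>)}"

definition signed_integrable :: "signed_meas \<Rightarrow> (real \<Rightarrow> real) \<Rightarrow> bool"
  where "signed_integrable \<mu> h \<longleftrightarrow> integrable (fst \<mu>) h \<and> integrable (snd \<mu>) h"

definition signed_integral :: "signed_meas \<Rightarrow> (real \<Rightarrow> real) \<Rightarrow> real"
  where "signed_integral \<mu> h = integral\<^sup>L (fst \<mu>) h - integral\<^sup>L (snd \<mu>) h"

definition laplace :: "signed_meas \<Rightarrow> real \<Rightarrow> real"
  where "laplace \<mu> t = signed_integral \<mu> (\<lambda>l. exp (- l * t))"

definition inv_laplace :: "(real \<Rightarrow> real) \<Rightarrow> signed_meas"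
  where "inv_laplace h = (THE \<mu>. \<mu> \<in> laplace_measures \<and> (\<forall>t>0. laplace \<mu> t = h t))"

section \<open>Inversion formula\<close>

text \<open>$g(x) = \int_0^\infty \psi_{-\lambda}(x)\,\mu(d\lambda)$ \<open>m\<close>-a.e.  For Brownian motion the
  integral already fails to converge absolutely for suitable $\mu = \hat\eta\,\sigma$ with
  $\eta \in L^2(dm)$, so it has the meaning of the inverse generalized Fourier transform: the
  $L^2(dm)$-limit of the integrals over $[0,R]$ as $R \to \infty$.  In addition the formula is
  required to hold literally at almost every \<open>x\<close> at which the integral converges absolutely.\<close>

definition inversion_formula ::
  "real measure \<Rightarrow> (real \<Rightarrow> real \<Rightarrow> real) \<Rightarrow> signed_meas \<Rightarrow> (real \<Rightarrow> real) \<Rightarrow> bool"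
  where "inversion_formula m \<psi> \<mu> g \<longleftrightarrow>
    L2_fun m g \<and>
    (\<forall>R. L2_fun m (\<lambda>x. signed_integral \<mu> (\<lambda>l. indicator {0..R} l * \<psi> (- l) x))) \<and>
    ((\<lambda>R. \<integral>\<^sup>+x. ennreal ((g x - signed_integral \<mu> (\<lambda>l. indicator {0..R} l * \<psi> (- l) x))\<^sup>2) \<partial>m)
       \<longlongrightarrow> 0) at_top \<and>
    (AE x in m. signed_integrable \<mu> (\<lambda>l. \<psi> (- l) x) \<longrightarrow>
       g x = signed_integral \<mu> (\<lambda>l. \<psi> (- l) x))"

definition L2_initial_law :: "real measure \<Rightarrow> real measure \<Rightarrow> bool"
  where "L2_initial_law m \<nu> \<longleftrightarrow>
    prob_space \<nu> \<and>
    (\<exists>\<eta>. L2_fun m \<eta> \<and> (AE x in m. 0 \<le> \<eta> x) \<and> \<nu> = density m (\<lambda>x. ennreal (\<eta> x)))"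

end

theory Submission
  imports Defs
begin

text \<open>By Parseval's identity the generalized Fourier transform is an isometry from $L^2(dm)$ into
  $L^2(\sigma)$, and its adjoint is $G \mapsto \int G(\lambda)\psi_{-\lambda}(x)\,\sigma(d\lambda)$.
  The hitting density $f_x(t)$ turns out to be the adjoint of $e^{-\lambda t}$, so that $f_\nu$ is
  the Laplace transform of $\hat\eta\,\sigma$, and uniqueness of Laplace transforms of signed measures
  gives $\mathcal{L}^{-1}f_\nu = \hat\eta\,\sigma$.  The adjoint of an isometry is a left inverse,
  so applying it to $\hat\eta 1_{[0,R]}$ recovers $\eta$ as $R \to \infty$.

  The formula for $f_x$ comes from Dynkin's formula for functions $v$ with $v(0) = 1$
  whose image $g \ge 0$ under the generator is supported in a small interval near $0$ and satisfies
  $\int g\,(s - s(0))\,dm = 1$.  As the interval shrinks to $0$, $E_x v(X_t)$ tends to $P_x(T_0 \le t)$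
  and $\hat g$ tends to $1$, dominated thanks to the bound
  $|\psi_{-\lambda}(y)| \le (s(y)-s(0))\,e^{2|\lambda| a(y)}$ with
  $a(y) = \int_{(0,y]}(s-s(0))\,dm \to 0$ as $y \to 0$.\<close>

section \<open>The space $L^2$\<close>

text \<open>Two obstacles shape the argument. First, Parseval's identity is given only for functions
  vanishing near \<open>b\<close>, and neither the integral for the transform of a general L^2
  function nor the one for the adjoint of a general \<open>G\<close> need converge. So the transform
  \<open>H\<close> of \<eta> is an L^2 limit, the adjoint is used on \<open>admissible\<close>
  functions \<open>G\<close> (absolute convergence at every point), and the two are linked by
  duality. Admissible are \<open>exp (- l * t)\<close>, the products
  \<open>exp (- l * t) * \<psi> (- l) x\<close>, whose adjoint is the transition density, and the
  cutoffs of \<open>H\<close>. Recovery is quantitative: the squared distance from \<eta> to the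
  adjoint of the cutoff is at most the squared norm of the tail of \<open>H\<close>. Second,
  \<open>m\<close> may have atoms and du/ds is only a right derivative. The bound on the
  eigenfunctions therefore rests on a Gronwall inequality for measures and a mean value inequality
  for right derivatives. The growing factor in that bound is absorbed by
  \<open>exp (- l * r)\<close> only for times r > u > 0 and intervals with a(q) < u/4; hence
  Dynkin's formula is applied between two positive times.\<close>

lemma L2_fun_mult_integrable:
  assumes "L2_fun M f" and "L2_fun M g"
  shows "integrable M (\<lambda>x. f x * g x)"
proof (rule Bochner_Integration.integrable_bound)
  show "integrable M (\<lambda>x. (f x)\<^sup>2 + (g x)\<^sup>2)"
    using assms unfolding L2_fun_def by auto
  show "(\<lambda>x. f x * g x) \<in> borel_measurable M"
    using assms unfolding L2_fun_def by auto
  have "\<bar>a * c\<bar> \<le> a\<^sup>2 + c\<^sup>2" for a c :: real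
  proof -
    have "0 \<le> (\<bar>a\<bar> - \<bar>c\<bar>)\<^sup>2" by simp
    then have "2 * \<bar>a * c\<bar> \<le> a\<^sup>2 + c\<^sup>2" by (simp add: power2_diff abs_mult)
    then show ?thesis by (smt (verit) abs_ge_zero)
  qed
  then show "AE x in M. norm (f x * g x) \<le> norm ((f x)\<^sup>2 + (g x)\<^sup>2)" by auto
qed

lemma L2_fun_cmult: "L2_fun M f \<Longrightarrow> L2_fun M (\<lambda>x. c * f x)"
  unfolding L2_fun_def by (auto simp: power_mult_distrib)

lemma L2_fun_add:
  assumes "L2_fun M f" and "L2_fun M g"
  shows "L2_fun M (\<lambda>x. f x + g x)"
  unfolding L2_fun_def power2_sum
  using assms L2_fun_mult_integrable[OF assms] unfolding L2_fun_def
  by (auto simp: mult.assoc intro!: Bochner_Integration.integrable_add)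

lemma L2_fun_diff:
  assumes "L2_fun M f" and "L2_fun M g"
  shows "L2_fun M (\<lambda>x. f x - g x)"
  using L2_fun_add[OF assms(1) L2_fun_cmult[OF assms(2), of "-1"]] by simp

lemma L2_fun_bound:
  assumes "L2_fun M g" and [measurable]: "f \<in> borel_measurable M" and "AE x in M. \<bar>f x\<bar> \<le> \<bar>g x\<bar>"
  shows "L2_fun M f"
  unfolding L2_fun_def
proof
  show "integrable M (\<lambda>x. (f x)\<^sup>2)"
  proof (rule Bochner_Integration.integrable_bound)
    show "integrable M (\<lambda>x. (g x)\<^sup>2)" using assms(1) by (simp add: L2_fun_def)
    show "AE x in M. norm ((f x)\<^sup>2) \<le> norm ((g x)\<^sup>2)"
      using assms(3) by eventually_elim (simp add: abs_le_square_iff)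
  qed simp
qed fact

lemma L2_fun_indicator:
  assumes "L2_fun M f" and "A \<in> sets M"
  shows "L2_fun M (\<lambda>x. indicator A x * f x)"
proof (rule L2_fun_bound[OF assms(1)])
  show "(\<lambda>x. indicator A x * f x) \<in> borel_measurable M"
    using assms by (auto simp: L2_fun_def)
qed (auto simp: indicator_def)

lemma integral_sq_add_le:
  assumes "L2_fun M f" and "L2_fun M g"
  shows "(\<integral>x. (f x + g x)\<^sup>2 \<partial>M) \<le> 2 * (\<integral>x. (f x)\<^sup>2 \<partial>M) + 2 * (\<integral>x. (g x)\<^sup>2 \<partial>M)"
proof -
  have "(\<integral>x. (f x + g x)\<^sup>2 \<partial>M) \<le> (\<integral>x. 2 * (f x)\<^sup>2 + 2 * (g x)\<^sup>2 \<partial>M)"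
  proof (rule integral_mono)
    show "integrable M (\<lambda>x. (f x + g x)\<^sup>2)" using L2_fun_add[OF assms] by (simp add: L2_fun_def)
    show "integrable M (\<lambda>x. 2 * (f x)\<^sup>2 + 2 * (g x)\<^sup>2)" using assms by (auto simp: L2_fun_def)
    show "(f x + g x)\<^sup>2 \<le> 2 * (f x)\<^sup>2 + 2 * (g x)\<^sup>2" for x
      using zero_le_power2[of "f x - g x"] by (simp add: power2_sum power2_diff)
  qed
  then show ?thesis using assms by (simp add: L2_fun_def)
qed

text \<open>Minimise the nonnegative quadratic polynomial obtained by integrating
  \<open>(t * f x + g x)\<^sup>2\<close>: its minimum sits at \<open>- B / A\<close>, and for
  \<open>A = 0\<close> it is affine, which forces \<open>B = 0\<close>.\<close>

lemma Cauchy_Schwarz_integral: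
  assumes "L2_fun M f" and "L2_fun M g"
  shows "(\<integral>x. f x * g x \<partial>M)\<^sup>2 \<le> (\<integral>x. (f x)\<^sup>2 \<partial>M) * (\<integral>x. (g x)\<^sup>2 \<partial>M)"
proof -
  define A B C where "A = (\<integral>x. (f x)\<^sup>2 \<partial>M)" and "B = (\<integral>x. f x * g x \<partial>M)" and "C = (\<integral>x. (g x)\<^sup>2 \<partial>M)"
  have pos: "0 \<le> t\<^sup>2 * A + 2 * t * B + C" for t
  proof -
    have "0 \<le> (\<integral>x. (t * f x + g x)\<^sup>2 \<partial>M)" by simp
    also have "(\<integral>x. (t * f x + g x)\<^sup>2 \<partial>M) = (\<integral>x. t\<^sup>2 * (f x)\<^sup>2 + (2 * t) * (f x * g x) + (g x)\<^sup>2 \<partial>M)"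
      by (simp add: power2_sum power_mult_distrib algebra_simps)
    also have "\<dots> = t\<^sup>2 * A + 2 * t * B + C"
      using assms L2_fun_mult_integrable[OF assms] by (simp add: A_def B_def C_def L2_fun_def)
    finally show ?thesis .
  qed
  have A: "0 \<le> A" by (simp add: A_def)
  have "B\<^sup>2 \<le> A * C"
  proof (cases "A = 0")
    case True
    have "B = 0"
    proof (rule ccontr)
      assume "B \<noteq> 0"
      \<comment> \<open>At this argument the affine polynomial takes the value -1.\<close>
      then show False using pos[of "- (C + 1) / (2 * B)"] True by (simp add: field_simps)
    qed
    then show ?thesis using True by simp
  next
    case False
    have "0 \<le> A * ((- B / A)\<^sup>2 * A + 2 * (- B / A) * B + C)"
      using A pos[of "- B / A"] by (intro mult_nonneg_nonneg) auto
    also have "\<dots> = A * C - B\<^sup>2" using False by (simp add: field_simps power2_eq_square)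
    finally show ?thesis by simp
  qed
  then show ?thesis by (simp add: A_def B_def C_def)
qed

lemma L2_inner_tendsto:
  assumes "\<And>n. L2_fun M (f n)" and "L2_fun M h" and "L2_fun M g"
    and "((\<lambda>n. \<integral>x. (f n x - h x)\<^sup>2 \<partial>M) \<longlongrightarrow> 0) F"
  shows "((\<lambda>n. \<integral>x. f n x * g x \<partial>M) \<longlongrightarrow> (\<integral>x. h x * g x \<partial>M)) F"
proof -
  have "((\<lambda>n. sqrt ((\<integral>x. (f n x - h x)\<^sup>2 \<partial>M) * (\<integral>x. (g x)\<^sup>2 \<partial>M))) \<longlongrightarrow> sqrt (0 * (\<integral>x. (g x)\<^sup>2 \<partial>M))) F"
    by (intro tendsto_intros assms)
  then have lim0: "((\<lambda>n. sqrt ((\<integral>x. (f n x - h x)\<^sup>2 \<partial>M) * (\<integral>x. (g x)\<^sup>2 \<partial>M))) \<longlongrightarrow> 0) F"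
    by simp
  have "norm ((\<integral>x. f n x * g x \<partial>M) - (\<integral>x. h x * g x \<partial>M))
      \<le> sqrt ((\<integral>x. (f n x - h x)\<^sup>2 \<partial>M) * (\<integral>x. (g x)\<^sup>2 \<partial>M))" for n
  proof -
    have "(\<integral>x. f n x * g x \<partial>M) - (\<integral>x. h x * g x \<partial>M) = (\<integral>x. (f n x - h x) * g x \<partial>M)"
      using L2_fun_mult_integrable[OF assms(1)[of n] assms(3)] L2_fun_mult_integrable[OF assms(2,3)]
      by (simp add: left_diff_distrib)
    then show ?thesis
      using Cauchy_Schwarz_integral[OF L2_fun_diff[OF assms(1)[of n] assms(2)] assms(3)]
      by (metis real_sqrt_abs real_sqrt_le_iff real_norm_def)
  qed
  then have "((\<lambda>n. (\<integral>x. f n x * g x \<partial>M) - (\<integral>x. h x * g x \<partial>M)) \<longlongrightarrow> 0) F"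
    by (intro Lim_null_comparison[OF _ lim0]) auto
  then show ?thesis by (rule LIM_zero_cancel)
qed

lemma L2_norm_tendsto:
  assumes "\<And>n. L2_fun M (f n)" and "L2_fun M h"
    and "((\<lambda>n. \<integral>x. (f n x - h x)\<^sup>2 \<partial>M) \<longlongrightarrow> 0) F"
  shows "((\<lambda>n. \<integral>x. (f n x)\<^sup>2 \<partial>M) \<longlongrightarrow> (\<integral>x. (h x)\<^sup>2 \<partial>M)) F"
proof -
  have eq: "(\<integral>x. (f n x)\<^sup>2 \<partial>M)
      = (\<integral>x. (f n x - h x)\<^sup>2 \<partial>M) + 2 * (\<integral>x. f n x * h x \<partial>M) - (\<integral>x. (h x)\<^sup>2 \<partial>M)" for n
    using L2_fun_mult_integrable[OF assms(1,2), of n] assms(1)[of n] assms(2)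
    by (simp add: power2_diff L2_fun_def mult.assoc)
  have "((\<lambda>n. (\<integral>x. (f n x - h x)\<^sup>2 \<partial>M) + 2 * (\<integral>x. f n x * h x \<partial>M) - (\<integral>x. (h x)\<^sup>2 \<partial>M))
      \<longlongrightarrow> 0 + 2 * (\<integral>x. h x * h x \<partial>M) - (\<integral>x. (h x)\<^sup>2 \<partial>M)) F"
    by (intro tendsto_intros assms L2_inner_tendsto[OF assms(1,2,2,3)])
  moreover have "0 + 2 * (\<integral>x. h x * h x \<partial>M) - (\<integral>x. (h x)\<^sup>2 \<partial>M) = (\<integral>x. (h x)\<^sup>2 \<partial>M)"
    by (simp add: power2_eq_square)
  ultimately show ?thesis by (simp add: eq)
qed

text \<open>Needed wherever only pointwise convergence is known: for completeness of L^2, and later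
  to remove truncations from the adjoint without losing the norm bound.\<close>

lemma L2_Fatou:
  fixes f :: "nat \<Rightarrow> real \<Rightarrow> real"
  assumes "\<And>k. L2_fun M (f k)" and [measurable]: "h \<in> borel_measurable M"
    and lim: "AE x in M. (\<lambda>k. f k x) \<longlonglongrightarrow> h x"
    and bd: "\<forall>\<^sub>F k in sequentially. (\<integral>x. (f k x)\<^sup>2 \<partial>M) \<le> C"
  shows "L2_fun M h" and "(\<integral>x. (h x)\<^sup>2 \<partial>M) \<le> C"
proof -
  have meas[measurable]: "f k \<in> borel_measurable M" for k using assms(1) by (simp add: L2_fun_def)
  have C: "0 \<le> C"
    using bd by (metis (mono_tags, lifting) Bochner_Integration.integral_nonneg eventually_sequentially
        order_refl order_trans zero_le_power2)
  have "(\<integral>\<^sup>+x. ennreal ((h x)\<^sup>2) \<partial>M) = (\<integral>\<^sup>+x. liminf (\<lambda>k. ennreal ((f k x)\<^sup>2)) \<partial>M)"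
  proof (rule nn_integral_cong_AE)
    show "AE x in M. ennreal ((h x)\<^sup>2) = liminf (\<lambda>k. ennreal ((f k x)\<^sup>2))"
      using lim
    proof eventually_elim
      case (elim x)
      have "(\<lambda>k. ennreal ((f k x)\<^sup>2)) \<longlonglongrightarrow> ennreal ((h x)\<^sup>2)"
        by (intro tendsto_intros elim)
      then show ?case by (intro lim_imp_Liminf[symmetric]) auto
    qed
  qed
  also have "\<dots> \<le> liminf (\<lambda>k. \<integral>\<^sup>+x. ennreal ((f k x)\<^sup>2) \<partial>M)"
    by (rule nn_integral_liminf) simp
  also have "\<dots> \<le> ennreal C"
  proof (rule Liminf_le)
    show "\<forall>\<^sub>F k in sequentially. (\<integral>\<^sup>+x. ennreal ((f k x)\<^sup>2) \<partial>M) \<le> ennreal C"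
      using bd
    proof eventually_elim
      case (elim k)
      have "(\<integral>\<^sup>+x. ennreal ((f k x)\<^sup>2) \<partial>M) = ennreal (\<integral>x. (f k x)\<^sup>2 \<partial>M)"
        using assms(1) by (intro nn_integral_eq_integral) (auto simp: L2_fun_def)
      then show ?case using elim by (simp add: ennreal_leI)
    qed
  qed simp
  finally have le: "(\<integral>\<^sup>+x. ennreal ((h x)\<^sup>2) \<partial>M) \<le> ennreal C" .
  have int: "integrable M (\<lambda>x. (h x)\<^sup>2)"
    using le by (intro integrableI_bounded) (auto simp: less_top[symmetric] top_unique intro: le_less_trans)
  then show "L2_fun M h" by (simp add: L2_fun_def)
  show "(\<integral>x. (h x)\<^sup>2 \<partial>M) \<le> C"
    using le C by (simp add: nn_integral_eq_integral[OF int])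
qed

text \<open>A subsequence whose increments have squared norm at most 4^-k converges a.e., and
  Fatou's lemma makes its limit the L^2 limit of the whole sequence.\<close>

theorem Riesz_Fischer_L2:
  fixes f :: "nat \<Rightarrow> real \<Rightarrow> real"
  assumes L2: "\<And>k. L2_fun M (f k)"
    and Cauchy: "\<And>e. 0 < e \<Longrightarrow> \<exists>N. \<forall>i\<ge>N. \<forall>j\<ge>N. (\<integral>x. (f i x - f j x)\<^sup>2 \<partial>M) \<le> e"
  shows "\<exists>h. L2_fun M h \<and> (\<lambda>k. \<integral>x. (f k x - h x)\<^sup>2 \<partial>M) \<longlonglongrightarrow> 0"
proof -
  have meas[measurable]: "f k \<in> borel_measurable M" for k using L2 by (simp add: L2_fun_def)
  have "\<exists>N. \<forall>i\<ge>N. \<forall>j\<ge>N. (\<integral>x. (f i x - f j x)\<^sup>2 \<partial>M) \<le> (1/4)^k" for k :: nat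
    using Cauchy[of "(1/4)^k"] by simp
  then obtain N where N: "\<And>k i j. i \<ge> N k \<Longrightarrow> j \<ge> N k \<Longrightarrow> (\<integral>x. (f i x - f j x)\<^sup>2 \<partial>M) \<le> (1/4)^k"
    by metis
  \<comment> \<open>Summing the thresholds makes \<open>r\<close> monotone and at least
    \<open>N k\<close>; the extra \<open>k\<close> makes it tend to infinity.\<close>
  define r where "r k = (\<Sum>i\<le>k. N i) + k" for k
  have rN: "N k \<le> r k" for k
    using member_le_sum[of k "{..k}" N] by (simp add: r_def)
  have rS: "r k \<le> r (Suc k)" for k by (simp add: r_def)
  have r_ge: "k \<le> r k" for k by (simp add: r_def)
  define d where "d k x = f (r (Suc k)) x - f (r k) x" for k x
  have d_int: "integrable M (\<lambda>x. (d k x)\<^sup>2)" for k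
    using L2_fun_diff[OF L2 L2] by (simp add: d_def L2_fun_def)
  have d_meas[measurable]: "d k \<in> borel_measurable M" for k by (simp add: d_def[abs_def])
  have d_le: "(\<integral>x. (d k x)\<^sup>2 \<partial>M) \<le> (1/4)^k" for k
    using N[of k "r (Suc k)" "r k"] rN[of k] rS[of k] by (simp add: d_def)
  \<comment> \<open>The weight 2^k still leaves a summable series, and finiteness of the weighted
    sum at a point bounds the increments there by a geometric sequence. This replaces Minkowski's
    inequality.\<close>
  have "(\<integral>\<^sup>+x. (\<Sum>k. ennreal (2^k * (d k x)\<^sup>2)) \<partial>M) = (\<Sum>k. \<integral>\<^sup>+x. ennreal (2^k * (d k x)\<^sup>2) \<partial>M)"
    by (intro nn_integral_suminf) simp
  also have "\<dots> \<le> (\<Sum>k. ennreal ((1/2)^k))"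
  proof (rule suminf_le)
    fix k
    have "(\<integral>\<^sup>+x. ennreal (2^k * (d k x)\<^sup>2) \<partial>M) = ennreal (2^k * (\<integral>x. (d k x)\<^sup>2 \<partial>M))"
      using d_int[of k] by (subst nn_integral_eq_integral) auto
    also have "\<dots> \<le> ennreal (2^k * (1/4)^k)"
      by (intro ennreal_leI mult_left_mono d_le) simp
    also have "(2::real)^k * (1/4)^k = (1/2)^k" by (simp add: power_mult_distrib[symmetric])
    finally show "(\<integral>\<^sup>+x. ennreal (2^k * (d k x)\<^sup>2) \<partial>M) \<le> ennreal ((1/2)^k)" .
  qed auto
  also have "\<dots> = ennreal (\<Sum>k. (1/2)^k)"
    by (intro suminf_ennreal2) (auto intro: summable_geometric)
  finally have "(\<integral>\<^sup>+x. (\<Sum>k. ennreal (2^k * (d k x)\<^sup>2)) \<partial>M) \<noteq> \<infinity>"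
    by (auto simp: top_unique)
  then have "AE x in M. (\<Sum>k. ennreal (2^k * (d k x)\<^sup>2)) \<noteq> \<infinity>"
    by (intro nn_integral_noteq_infinite) auto
  then have conv: "AE x in M. convergent (\<lambda>k. f (r k) x)"
  proof eventually_elim
    case (elim x)
    have "summable (\<lambda>k. 2^k * (d k x)\<^sup>2)"
      using elim by (intro summable_suminf_not_top) auto
    then have "(\<lambda>k. 2^k * (d k x)\<^sup>2) \<longlonglongrightarrow> 0" by (rule summable_LIMSEQ_zero)
    then have "Bseq (\<lambda>k. 2^k * (d k x)\<^sup>2)" by (rule convergent_imp_Bseq[OF convergentI])
    then obtain K where K: "0 < K" "\<And>k. norm (2^k * (d k x)\<^sup>2) \<le> K" by (auto simp: Bseq_def)
    have bd: "norm (d k x) \<le> sqrt K * (1 / sqrt 2)^k" for k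
    proof -
      have "(d k x)\<^sup>2 \<le> K / 2^k" using K(2)[of k] by (simp add: field_simps)
      then have "sqrt ((d k x)\<^sup>2) \<le> sqrt (K / 2^k)" by (rule real_sqrt_le_mono)
      also have "sqrt (K / 2^k) = sqrt K * (1 / sqrt 2)^k"
        by (simp add: real_sqrt_divide real_sqrt_power power_divide)
      finally show ?thesis by (simp only: real_sqrt_abs real_norm_def)
    qed
    have "summable (\<lambda>k. d k x)"
    proof (rule summable_comparison_test'[where g = "\<lambda>k. sqrt K * (1 / sqrt 2)^k" and N = 0])
      show "summable (\<lambda>k. sqrt K * (1 / sqrt 2)^k)"
        by (intro summable_mult summable_geometric) simp
    qed (rule bd)
    then have "convergent (\<lambda>n. \<Sum>k<n. d k x)" by (simp add: summable_iff_convergent)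
    then have "convergent (\<lambda>n. f (r n) x - f (r 0) x)"
      by (simp add: d_def sum_lessThan_telescope[of "\<lambda>k. f (r k) x"])
    from convergent_add[OF this convergent_const[of "f (r 0) x"]] show ?case by simp
  qed
  define h where "h x = lim (\<lambda>k. f (r k) x)" for x
  have h_meas[measurable]: "h \<in> borel_measurable M" unfolding h_def by measurable
  have lim_h: "AE x in M. (\<lambda>k. f (r k) x) \<longlonglongrightarrow> h x"
    using conv by eventually_elim (simp add: h_def convergent_LIMSEQ_iff)
  have ev: "\<forall>\<^sub>F k in sequentially. r k \<ge> n" for n
    using r_ge by (auto simp: eventually_sequentially intro: le_trans)
  have Fatou: "L2_fun M (\<lambda>x. f i x - h x) \<and> (\<integral>x. (f i x - h x)\<^sup>2 \<partial>M) \<le> e"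
    if "\<And>j. j \<ge> n \<Longrightarrow> (\<integral>x. (f i x - f j x)\<^sup>2 \<partial>M) \<le> e" for i n e
  proof
    have a: "AE x in M. (\<lambda>k. f i x - f (r k) x) \<longlonglongrightarrow> f i x - h x"
      using lim_h by eventually_elim (intro tendsto_intros)
    have b: "\<forall>\<^sub>F k in sequentially. (\<integral>x. (f i x - f (r k) x)\<^sup>2 \<partial>M) \<le> e"
      using ev[of n] by eventually_elim (rule that)
    show "L2_fun M (\<lambda>x. f i x - h x)" "(\<integral>x. (f i x - h x)\<^sup>2 \<partial>M) \<le> e"
      by (rule L2_Fatou[OF L2_fun_diff[OF L2 L2] _ a b], measurable)+
  qed
  obtain n1 where n1: "\<And>i j. i \<ge> n1 \<Longrightarrow> j \<ge> n1 \<Longrightarrow> (\<integral>x. (f i x - f j x)\<^sup>2 \<partial>M) \<le> 1"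
    using Cauchy[of 1] by auto
  have "L2_fun M (\<lambda>x. f n1 x - h x)"
    using Fatou[of n1 n1 1] n1 by auto
  from L2_fun_diff[OF L2[of n1] this] have "L2_fun M h" by simp
  moreover have "(\<lambda>k. \<integral>x. (f k x - h x)\<^sup>2 \<partial>M) \<longlonglongrightarrow> 0"
  proof (rule LIMSEQ_I)
    fix e :: real assume "0 < e"
    then obtain N where "\<And>i j. i \<ge> N \<Longrightarrow> j \<ge> N \<Longrightarrow> (\<integral>x. (f i x - f j x)\<^sup>2 \<partial>M) \<le> e/2"
      using Cauchy[of "e/2"] by auto
    then have "(\<integral>x. (f i x - h x)\<^sup>2 \<partial>M) \<le> e/2" if "i \<ge> N" for i
      using Fatou[of N i "e/2"] that by auto
    moreover have "e/2 < e" using \<open>0 < e\<close> by simp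
    ultimately have "(\<integral>x. (f i x - h x)\<^sup>2 \<partial>M) < e" if "i \<ge> N" for i
      using that by (meson order.strict_trans1)
    then show "\<exists>N. \<forall>i\<ge>N. norm ((\<integral>x. (f i x - h x)\<^sup>2 \<partial>M) - 0) < e"
      by (intro exI[of _ N]) auto
  qed
  ultimately show ?thesis by blast
qed

section \<open>Laplace transforms of positive and signed measures\<close>

text \<open>What \<open>laplace_measures\<close> demands of each half of a Jordan decomposition; it
  also holds for \<open>\<sigma>\<close>.\<close>

definition laplace_pos :: "real measure \<Rightarrow> bool"
  where "laplace_pos \<mu> \<longleftrightarrow> sets \<mu> = sets borel \<and> emeasure \<mu> {..<0} = 0 \<and>
    (\<forall>t>0. (\<integral>\<^sup>+l. ennreal (exp (- l * t)) \<partial>\<mu>) < \<infinity>)"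

lemma laplace_pos_AE_nonneg: "laplace_pos \<mu> \<Longrightarrow> AE l in \<mu>. 0 \<le> l"
  unfolding laplace_pos_def by (intro AE_I[of _ _ "{..<0}"]) auto

text \<open>Each power of \<open>l\<close> is paid for with half of the exponent, since
  \<open>l \<le> (2 / t) * exp (l * t / 2)\<close>; hence the induction with \<open>t\<close>
  arbitrary.\<close>

lemma laplace_pos_integrable:
  assumes "laplace_pos \<mu>" and "0 < t"
  shows "integrable \<mu> (\<lambda>l. l ^ k * exp (- l * t))"
  using \<open>0 < t\<close>
proof (induction k arbitrary: t)
  case 0
  have [measurable_cong]: "sets \<mu> = sets borel" using assms by (simp add: laplace_pos_def)
  show ?case
    using assms 0 by (intro integrableI_bounded) (auto simp: laplace_pos_def)
next
  case (Suc k)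
  have [measurable_cong]: "sets \<mu> = sets borel" using assms by (simp add: laplace_pos_def)
  show ?case
  proof (rule Bochner_Integration.integrable_bound)
    show "integrable \<mu> (\<lambda>l. (2 / t) * (l ^ k * exp (- l * (t / 2))))"
      using Suc by (intro integrable_mult_right Suc.IH) auto
    show "(\<lambda>l. l ^ Suc k * exp (- l * t)) \<in> borel_measurable \<mu>" by measurable
    show "AE l in \<mu>. norm (l ^ Suc k * exp (- l * t)) \<le> norm ((2 / t) * (l ^ k * exp (- l * (t / 2))))"
      using laplace_pos_AE_nonneg[OF assms(1)]
    proof eventually_elim
      case (elim l)
      have "l * t / 2 \<le> exp (l * t / 2)" using exp_ge_add_one_self[of "l * t / 2"] by linarith
      then have "l \<le> (2 / t) * exp (l * t / 2)" using Suc.prems by (simp add: field_simps)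
      then have "l * (l ^ k * exp (- l * t)) \<le> ((2 / t) * exp (l * t / 2)) * (l ^ k * exp (- l * t))"
        using elim by (intro mult_right_mono) auto
      also have "\<dots> = (2 / t) * (l ^ k * (exp (l * t / 2) * exp (- l * t)))" by (simp add: ac_simps)
      also have "exp (l * t / 2) * exp (- l * t) = exp (- l * (t / 2))"
        by (simp add: exp_add[symmetric])
      finally show ?case using elim Suc.prems by (simp add: abs_mult ac_simps)
    qed
  qed
qed

text \<open>Serves to dominate difference quotients in the next lemma: on the half-line starting at
  \<open>d\<close> the slope of the decaying exponential is at most
  \<open>exp (- d)\<close>.\<close>

lemma exp_minus_diff_le:
  fixes a c d :: real
  assumes "d \<le> a" and "d \<le> c"
  shows "\<bar>exp (- a) - exp (- c)\<bar> \<le> \<bar>a - c\<bar> * exp (- d)"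
proof -
  have *: "exp (- u) - exp (- v) \<le> (v - u) * exp (- d)" if "d \<le> u" "u \<le> v" for u v :: real
  proof -
    have "exp (- u) - exp (- v) = exp (- u) * (1 - exp (- (v - u)))"
      by (simp add: right_diff_distrib exp_add[symmetric])
    also have "\<dots> \<le> exp (- d) * (v - u)"
    proof (rule mult_mono)
      show "1 - exp (- (v - u)) \<le> v - u" using exp_ge_add_one_self[of "- (v - u)"] by linarith
    qed (use that in auto)
    finally show ?thesis by (simp add: mult.commute)
  qed
  show ?thesis
    using *[of a c] *[of c a] assms by (cases "a \<le> c") (auto simp: abs_if)
qed

lemma laplace_pos_has_derivative:
  assumes \<mu>: "laplace_pos \<mu>" and t: "0 < t"
  shows "((\<lambda>t. \<integral>l. l ^ k * exp (- l * t) \<partial>\<mu>) has_real_derivative - (\<integral>l. l ^ Suc k * exp (- l * t) \<partial>\<mu>)) (at t)"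
proof -
  have [measurable_cong]: "sets \<mu> = sets borel" using \<mu> by (simp add: laplace_pos_def)
  define F where "F t = (\<integral>l. l ^ k * exp (- l * t) \<partial>\<mu>)" for t
  \<comment> \<open>Increments shorter than t/2 keep the argument above t/2, so that
    \<open>l ^ Suc k * exp (- l * (t / 2))\<close> dominates all difference quotients.\<close>
  let ?S = "{- (t/2)<..<t/2}"
  have "((\<lambda>h. (F (t + h) - F t) / h) \<longlongrightarrow> - (\<integral>l. l ^ Suc k * exp (- l * t) \<partial>\<mu>)) (at 0 within ?S)"
    unfolding tendsto_at_iff_sequentially comp_def
  proof (intro allI impI)
    fix Y :: "nat \<Rightarrow> real" assume Y: "\<forall>i. Y i \<in> ?S - {0}" and Y0: "Y \<longlonglongrightarrow> 0"
    have eq: "(F (t + Y i) - F t) / Y i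
        = (\<integral>l. l ^ k * ((exp (- l * (t + Y i)) - exp (- l * t)) / Y i) \<partial>\<mu>)" for i
    proof -
      have "0 < t + Y i" using Y[rule_format, of i] by auto
      then have "F (t + Y i) - F t = (\<integral>l. l ^ k * exp (- l * (t + Y i)) - l ^ k * exp (- l * t) \<partial>\<mu>)"
        unfolding F_def using t by (intro Bochner_Integration.integral_diff[symmetric] laplace_pos_integrable[OF \<mu>])
      then show ?thesis
        by (simp only: integral_divide_zero[symmetric]) (simp add: right_diff_distrib diff_divide_distrib)
    qed
    have "(\<lambda>i. \<integral>l. l ^ k * ((exp (- l * (t + Y i)) - exp (- l * t)) / Y i) \<partial>\<mu>)
        \<longlonglongrightarrow> (\<integral>l. - (l ^ Suc k * exp (- l * t)) \<partial>\<mu>)"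
    proof (rule integral_dominated_convergence)
      show "integrable \<mu> (\<lambda>l. l ^ Suc k * exp (- l * (t / 2)))"
        using t by (intro laplace_pos_integrable[OF \<mu>]) auto
      show "AE l in \<mu>. (\<lambda>i. l ^ k * ((exp (- l * (t + Y i)) - exp (- l * t)) / Y i))
          \<longlonglongrightarrow> - (l ^ Suc k * exp (- l * t))"
      proof (intro AE_I2)
        fix l
        have "((\<lambda>z. exp (- l * z)) has_real_derivative - l * exp (- l * t)) (at t)"
          by (auto intro!: derivative_eq_intros)
        then have "((\<lambda>h. (exp (- l * (t + h)) - exp (- l * t)) / h) \<longlongrightarrow> - l * exp (- l * t)) (at 0)"
          by (simp add: DERIV_def)
        then have "(\<lambda>i. (exp (- l * (t + Y i)) - exp (- l * t)) / Y i) \<longlonglongrightarrow> - l * exp (- l * t)"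
          using Y Y0 by (auto simp: tendsto_at_iff_sequentially comp_def)
        then have "(\<lambda>i. l ^ k * ((exp (- l * (t + Y i)) - exp (- l * t)) / Y i)) \<longlonglongrightarrow> l ^ k * (- l * exp (- l * t))"
          by (intro tendsto_intros)
        then show "(\<lambda>i. l ^ k * ((exp (- l * (t + Y i)) - exp (- l * t)) / Y i))
          \<longlonglongrightarrow> - (l ^ Suc k * exp (- l * t))"
          by (simp add: ac_simps)
      qed
      show "AE l in \<mu>. norm (l ^ k * ((exp (- l * (t + Y i)) - exp (- l * t)) / Y i))
          \<le> l ^ Suc k * exp (- l * (t / 2))" for i
        using laplace_pos_AE_nonneg[OF \<mu>]
      proof eventually_elim
        case (elim l)
        have Yi: "Y i \<noteq> 0" "- (t/2) \<le> Y i" using Y[rule_format, of i] by auto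
        have "l * (t/2) \<le> l * (t + Y i)" "l * (t/2) \<le> l * t"
          by (rule mult_left_mono; use elim Yi t in auto)+
        from exp_minus_diff_le[OF this]
        have "\<bar>exp (- l * (t + Y i)) - exp (- l * t)\<bar> \<le> \<bar>l * (t + Y i) - l * t\<bar> * exp (- l * (t/2))"
          by simp
        also have "\<bar>l * (t + Y i) - l * t\<bar> = l * \<bar>Y i\<bar>"
          using elim by (simp add: algebra_simps abs_mult)
        finally have "\<bar>exp (- l * (t + Y i)) - exp (- l * t)\<bar> / \<bar>Y i\<bar> \<le> l * exp (- l * (t/2))"
          using Yi by (simp add: field_simps)
        then have "l ^ k * (\<bar>exp (- l * (t + Y i)) - exp (- l * t)\<bar> / \<bar>Y i\<bar>) \<le> l ^ k * (l * exp (- l * (t/2)))"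
          using elim by (intro mult_left_mono) auto
        then show ?case using elim by (simp add: abs_mult ac_simps)
      qed
    qed measurable
    then show "(\<lambda>i. (F (t + Y i) - F t) / Y i) \<longlonglongrightarrow> - (\<integral>l. l ^ Suc k * exp (- l * t) \<partial>\<mu>)"
      by (simp add: eq)
  qed
  moreover have "at 0 within ?S = at (0::real)"
    using t by (intro at_within_open) auto
  ultimately show ?thesis by (simp add: DERIV_def F_def)
qed

text \<open>The easy half of Bernstein's theorem: each differentiation under the integral brings
  down a factor \<open>- l\<close>, and the measure lives on the nonnegative half-line.\<close>

lemma laplace_pos_completely_monotone:
  assumes \<mu>: "laplace_pos \<mu>"
  shows "completely_monotone (\<lambda>t. \<integral>l. exp (- l * t) \<partial>\<mu>)"
proof -
  define L where "L = (\<lambda>t. \<integral>l. exp (- l * t) \<partial>\<mu>)"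
  have ev: "\<forall>\<^sub>F z in nhds t. 0 < z" if "0 < t" for t :: real
    using that by (intro eventually_nhds_in_open[of "{0<..}", simplified]) auto
  have D: "\<forall>t>0. (deriv ^^ k) L t = (- 1) ^ k * (\<integral>l. l ^ k * exp (- l * t) \<partial>\<mu>)" for k
  proof (induction k)
    case 0 then show ?case by (simp add: L_def)
  next
    case (Suc k)
    show ?case
    proof (intro allI impI)
      fix t :: real assume t: "0 < t"
      \<comment> \<open>The formula for the previous iterate is known for positive arguments only,
        which is enough because differentiation is local.\<close>
      have "(deriv ^^ Suc k) L t = deriv (\<lambda>t. (- 1) ^ k * (\<integral>l. l ^ k * exp (- l * t) \<partial>\<mu>)) t"
        unfolding funpow.simps comp_def
        by (rule deriv_cong_ev) (use ev[OF t] Suc in \<open>auto elim: eventually_mono\<close>)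
      also have "\<dots> = (- 1) ^ k * (- (\<integral>l. l ^ Suc k * exp (- l * t) \<partial>\<mu>))"
        by (intro DERIV_imp_deriv DERIV_cmult laplace_pos_has_derivative[OF \<mu> t])
      finally show "(deriv ^^ Suc k) L t = (- 1) ^ Suc k * (\<integral>l. l ^ Suc k * exp (- l * t) \<partial>\<mu>)"
        by simp
    qed
  qed
  have "(deriv ^^ k) L differentiable at t" if t: "0 < t" for k t
  proof -
    have "((\<lambda>t. (- 1) ^ k * (\<integral>l. l ^ k * exp (- l * t) \<partial>\<mu>)) has_real_derivative
        (- 1) ^ k * (- (\<integral>l. l ^ Suc k * exp (- l * t) \<partial>\<mu>))) (at t)"
      by (intro DERIV_cmult laplace_pos_has_derivative[OF \<mu> t])
    then have "((deriv ^^ k) L has_real_derivative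
        (- 1) ^ k * (- (\<integral>l. l ^ Suc k * exp (- l * t) \<partial>\<mu>))) (at t)"
      by (subst DERIV_cong_ev[OF refl _ refl]) (use ev[OF t] D in \<open>auto elim: eventually_mono\<close>)
    then show ?thesis by (auto simp: real_differentiable_def)
  qed
  moreover have "0 \<le> (- 1) ^ k * (deriv ^^ k) L t" if t: "0 < t" for k t
  proof -
    have "0 \<le> (\<integral>l. l ^ k * exp (- l * t) \<partial>\<mu>)"
      using laplace_pos_AE_nonneg[OF \<mu>] by (intro integral_nonneg_AE) auto
    moreover have "(- 1 :: real) ^ k * (- 1) ^ k = 1" by (simp add: power_mult_distrib[symmetric])
    ultimately show ?thesis using D t by (simp add: mult.assoc[symmetric])
  qed
  ultimately show ?thesis unfolding completely_monotone_def L_def by blast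
qed

text \<open>The substitution $y = e^{-l}$ turns Laplace transforms at $t = 1, 2, \dots$ into moments on
  $[0,1]$, to which the Weierstrass theorem applies.\<close>

lemma laplace_diff_unique_continuous:
  assumes pos: "laplace_pos p" "laplace_pos n" "laplace_pos p'" "laplace_pos n'"
    and eq: "\<And>t. 0 < t \<Longrightarrow> (\<integral>l. exp (- l * t) \<partial>p) - (\<integral>l. exp (- l * t) \<partial>n)
      = (\<integral>l. exp (- l * t) \<partial>p') - (\<integral>l. exp (- l * t) \<partial>n')"
    and F: "continuous_on UNIV F"
  shows "(\<integral>l. F (exp (- l)) * exp (- l) \<partial>p) - (\<integral>l. F (exp (- l)) * exp (- l) \<partial>n)
      = (\<integral>l. F (exp (- l)) * exp (- l) \<partial>p') - (\<integral>l. F (exp (- l)) * exp (- l) \<partial>n')"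
proof -
  define E where "E \<mu> F = (\<integral>l. F (exp (- l)) * exp (- l) \<partial>\<mu>)" for \<mu> :: "real measure" and F :: "real \<Rightarrow> real"
  have int: "integrable \<mu> (\<lambda>l. F (exp (- l)) * exp (- l))"
    if \<mu>: "laplace_pos \<mu>" and F: "continuous_on UNIV F" for \<mu> and F :: "real \<Rightarrow> real"
  proof -
    have [measurable_cong]: "sets \<mu> = sets borel" using \<mu> by (simp add: laplace_pos_def)
    have [measurable]: "F \<in> borel_measurable borel" using F by (rule borel_measurable_continuous_onI)
    have "bounded (F ` {0..1})"
      using F by (intro compact_imp_bounded compact_continuous_image) (auto intro: continuous_on_subset)
    then obtain K where K: "\<And>y. y \<in> {0..1} \<Longrightarrow> \<bar>F y\<bar> \<le> K" unfolding bounded_iff by (metis imageI real_norm_def)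
    show ?thesis
    proof (rule Bochner_Integration.integrable_bound)
      show "integrable \<mu> (\<lambda>l. K * exp (- l))"
        using laplace_pos_integrable[OF \<mu>, of 1 0] by simp
      show "AE l in \<mu>. norm (F (exp (- l)) * exp (- l)) \<le> norm (K * exp (- l))"
        using laplace_pos_AE_nonneg[OF \<mu>]
      proof eventually_elim
        case (elim l)
        then have "\<bar>F (exp (- l))\<bar> \<le> K" by (intro K) auto
        then show ?case by (auto simp: abs_mult intro!: mult_right_mono)
      qed
    qed measurable
  qed
  have poly: "E p P - E n P = E p' P - E n' P" if Pp: "real_polynomial_function P" for P
  proof -
    obtain a d where P: "P = (\<lambda>x. \<Sum>i\<le>d. a i * x ^ i)"
      using Pp unfolding real_polynomial_function_iff_sum by blast
    have "E \<mu> P = (\<Sum>i\<le>d. a i * (\<integral>l. exp (- l * real (Suc i)) \<partial>\<mu>))" if \<mu>: "laplace_pos \<mu>" for \<mu>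
    proof -
      have "E \<mu> P = (\<integral>l. (\<Sum>i\<le>d. a i * exp (- l * real (Suc i))) \<partial>\<mu>)"
        unfolding E_def P
      proof (intro Bochner_Integration.integral_cong refl)
        fix l
        \<comment> \<open>The weight \<open>exp (- l)\<close> makes the measures finite and shifts
          the exponents by one: the monomial of degree i becomes the Laplace transform at i + 1,
          which is positive even for i = 0.\<close>
        have "a i * exp (- l) ^ i * exp (- l) = a i * exp (- l * real (Suc i))" for i
          using exp_of_nat_mult[of "Suc i" "- l"] by (simp add: ac_simps)
        then show "(\<Sum>i\<le>d. a i * exp (- l) ^ i) * exp (- l) = (\<Sum>i\<le>d. a i * exp (- l * real (Suc i)))"
          by (simp only: sum_distrib_right)
      qed
      also have "\<dots> = (\<Sum>i\<le>d. a i * (\<integral>l. exp (- l * real (Suc i)) \<partial>\<mu>))"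
        using laplace_pos_integrable[OF \<mu>, of "real (Suc _)" 0]
        by (subst Bochner_Integration.integral_sum) (auto intro!: integrable_mult_right)
      finally show ?thesis .
    qed
    then show ?thesis
      using pos eq by (simp add: sum_subtractf[symmetric] right_diff_distrib[symmetric])
  qed
  \<comment> \<open>The total mass of the four weighted measures; a uniform error e on [0,1] costs
    at most \<open>e * C\<close>.\<close>
  define C where "C = E p (\<lambda>_. 1) + E n (\<lambda>_. 1) + E p' (\<lambda>_. 1) + E n' (\<lambda>_. 1)"
  have E1: "0 \<le> E \<mu> (\<lambda>_. 1)" for \<mu> by (simp add: E_def)
  have C: "0 \<le> C" using E1[of p] E1[of n] E1[of p'] E1[of n'] by (simp add: C_def)
  have le: "\<bar>(E p F - E n F) - (E p' F - E n' F)\<bar> \<le> e * C" if e: "0 < e" for e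
  proof -
    have "continuous_on {0..1} F" using F by (rule continuous_on_subset) simp
    then obtain P where P: "real_polynomial_function P" "\<And>y. y \<in> {0..1} \<Longrightarrow> \<bar>F y - P y\<bar> < e"
      using Stone_Weierstrass_real_polynomial_function[of "{0..1}" F e] e by auto
    have Pc: "continuous_on UNIV P" using P(1) by (intro continuous_on_polymonial_function) (simp add: real_polynomial_function_eq)
    have dist: "\<bar>E \<mu> F - E \<mu> P\<bar> \<le> e * E \<mu> (\<lambda>_. 1)" if \<mu>: "laplace_pos \<mu>" for \<mu>
    proof -
      have "E \<mu> F - E \<mu> P = (\<integral>l. (F (exp (- l)) - P (exp (- l))) * exp (- l) \<partial>\<mu>)"
        unfolding E_def using int[OF \<mu> F] int[OF \<mu> Pc] by (simp add: left_diff_distrib)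
      also have "\<bar>\<dots>\<bar> \<le> (\<integral>l. \<bar>(F (exp (- l)) - P (exp (- l))) * exp (- l)\<bar> \<partial>\<mu>)"
        by (rule integral_abs_bound)
      also have "\<dots> \<le> (\<integral>l. e * (1 * exp (- l)) \<partial>\<mu>)"
      proof (rule integral_mono_AE)
        show "integrable \<mu> (\<lambda>l. \<bar>(F (exp (- l)) - P (exp (- l))) * exp (- l)\<bar>)"
          using int[OF \<mu> F] int[OF \<mu> Pc] by (simp add: left_diff_distrib)
        show "integrable \<mu> (\<lambda>l. e * (1 * exp (- l)))"
          using laplace_pos_integrable[OF \<mu>, of 1 0] by simp
        show "AE l in \<mu>. \<bar>(F (exp (- l)) - P (exp (- l))) * exp (- l)\<bar> \<le> e * (1 * exp (- l))"
          using laplace_pos_AE_nonneg[OF \<mu>]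
        proof eventually_elim
          case (elim l)
          then have "\<bar>F (exp (- l)) - P (exp (- l))\<bar> \<le> e" by (intro less_imp_le P) auto
          then show ?case by (auto simp: abs_mult intro!: mult_right_mono)
        qed
      qed
      also have "\<dots> = e * E \<mu> (\<lambda>_. 1)" unfolding E_def by (rule integral_mult_right_zero)
      finally show ?thesis .
    qed
    show ?thesis
      using dist[OF pos(1)] dist[OF pos(2)] dist[OF pos(3)] dist[OF pos(4)] poly[OF P(1)]
      unfolding C_def distrib_left by linarith
  qed
  have "(E p F - E n F) - (E p' F - E n' F) = 0"
  proof (rule ccontr)
    assume ne: "(E p F - E n F) - (E p' F - E n' F) \<noteq> 0" (is "?d \<noteq> 0")
    define \<delta> where "\<delta> = \<bar>?d\<bar>"
    have \<delta>: "0 < \<delta>" using ne by (simp add: \<delta>_def)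
    \<comment> \<open>The tolerance is chosen so that its product with \<open>C\<close> stays below
      \<open>\<delta>\<close>; adding one to \<open>C\<close> avoids division by zero.\<close>
    have "\<delta> \<le> (\<delta> / (2 * (C + 1))) * C" using \<delta> C unfolding \<delta>_def by (intro le) auto
    also have "\<dots> < \<delta>" using \<delta> C by (simp add: field_simps add_nonneg_pos)
    finally show False by simp
  qed
  then show ?thesis by (simp add: E_def)
qed

text \<open>In the variable y = exp(-l) the half-line up to \<open>a\<close> becomes the set where y
  is at least exp(-a), and its indicator is a pointwise limit of continuous functions.\<close>

lemma laplace_diff_unique_atMost:
  assumes pos: "laplace_pos p" "laplace_pos n" "laplace_pos p'" "laplace_pos n'"
    and eq: "\<And>t. 0 < t \<Longrightarrow> (\<integral>l. exp (- l * t) \<partial>p) - (\<integral>l. exp (- l * t) \<partial>n)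
      = (\<integral>l. exp (- l * t) \<partial>p') - (\<integral>l. exp (- l * t) \<partial>n')"
  shows "(\<integral>l. indicator {..a} l * exp (- l) \<partial>p) - (\<integral>l. indicator {..a} l * exp (- l) \<partial>n)
      = (\<integral>l. indicator {..a} l * exp (- l) \<partial>p') - (\<integral>l. indicator {..a} l * exp (- l) \<partial>n')"
proof -
  \<comment> \<open>For positive \<open>k\<close> a ramp: equal to 1 from exp(-a) on, and falling to
    0 over a length 1/k to the left of that point.\<close>
  define F where "F k y = max 0 (min 1 (real k * (y - exp (- a)) + 1))" for k y
  have Fc: "continuous_on UNIV (F k)" for k unfolding F_def by (intro continuous_intros)
  have lim: "(\<lambda>k. \<integral>l. F k (exp (- l)) * exp (- l) \<partial>\<mu>) \<longlonglongrightarrow> (\<integral>l. indicator {..a} l * exp (- l) \<partial>\<mu>)"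
    if \<mu>: "laplace_pos \<mu>" for \<mu>
  proof -
    have [measurable_cong]: "sets \<mu> = sets borel" using \<mu> by (simp add: laplace_pos_def)
    have [measurable]: "F k \<in> borel_measurable borel" for k using Fc by (rule borel_measurable_continuous_onI)
    show ?thesis
    proof (rule integral_dominated_convergence)
      show "integrable \<mu> (\<lambda>l. exp (- l))" using laplace_pos_integrable[OF \<mu>, of 1 0] by simp
      show "AE l in \<mu>. (\<lambda>k. F k (exp (- l)) * exp (- l)) \<longlonglongrightarrow> indicator {..a} l * exp (- l)"
      proof (intro AE_I2 tendsto_intros)
        fix l
        show "(\<lambda>k. F k (exp (- l))) \<longlonglongrightarrow> indicator {..a} l"
        proof (cases "l \<le> a")
          case True
          then have "F k (exp (- l)) = 1" for k by (simp add: F_def max_def min_def)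
          then show ?thesis using True by simp
        next
          case False
          define c where "c = exp (- a) - exp (- l)"
          have c: "0 < c" using False by (simp add: c_def)
          obtain k0 where k0: "1 / c < real k0" using reals_Archimedean2 by blast
          have "F k (exp (- l)) = 0" if "k \<ge> k0" for k
          proof -
            have "1 < real k0 * c" using k0 c by (simp add: field_simps)
            also have "\<dots> \<le> real k * c" using that c by (intro mult_right_mono) auto
            finally have "real k * (exp (- l) - exp (- a)) + 1 \<le> 0" by (simp add: c_def algebra_simps)
            then show ?thesis by (simp add: F_def)
          qed
          then have "\<forall>\<^sub>F k in sequentially. F k (exp (- l)) = 0" by (auto simp: eventually_sequentially)
          then show ?thesis using False by (simp add: tendsto_eventually)
        qed
      qed
      show "AE l in \<mu>. norm (F k (exp (- l)) * exp (- l)) \<le> exp (- l)" for k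
        by (auto simp: F_def abs_mult)
    qed measurable
  qed
  have "(\<lambda>k. (\<integral>l. F k (exp (- l)) * exp (- l) \<partial>p) - (\<integral>l. F k (exp (- l)) * exp (- l) \<partial>n))
      \<longlonglongrightarrow> (\<integral>l. indicator {..a} l * exp (- l) \<partial>p) - (\<integral>l. indicator {..a} l * exp (- l) \<partial>n)"
    by (intro tendsto_diff lim pos)
  then have "(\<lambda>k. (\<integral>l. F k (exp (- l)) * exp (- l) \<partial>p') - (\<integral>l. F k (exp (- l)) * exp (- l) \<partial>n'))
      \<longlonglongrightarrow> (\<integral>l. indicator {..a} l * exp (- l) \<partial>p) - (\<integral>l. indicator {..a} l * exp (- l) \<partial>n)"
    by (simp only: laplace_diff_unique_continuous[OF pos eq Fc])
  moreover have "(\<lambda>k. (\<integral>l. F k (exp (- l)) * exp (- l) \<partial>p') - (\<integral>l. F k (exp (- l)) * exp (- l) \<partial>n'))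
      \<longlonglongrightarrow> (\<integral>l. indicator {..a} l * exp (- l) \<partial>p') - (\<integral>l. indicator {..a} l * exp (- l) \<partial>n')"
    by (intro tendsto_diff lim pos)
  ultimately show ?thesis by (rule LIMSEQ_unique)
qed

text \<open>The weight \<open>exp (- l)\<close> turns a possibly infinite measure into a finite one,
  for which subtraction and complements make sense; by the last claim no information is
  lost.\<close>

lemma laplace_pos_density:
  assumes \<mu>: "laplace_pos \<mu>"
  defines "D \<equiv> density \<mu> (\<lambda>l. ennreal (exp (- l)))"
  shows "finite_measure D" and "sets D = sets borel"
    and "A \<in> sets borel \<Longrightarrow> measure D A = (\<integral>l. indicator A l * exp (- l) \<partial>\<mu>)"
    and "A \<in> sets borel \<Longrightarrow> emeasure \<mu> A = 0 \<Longrightarrow> measure D A = 0"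
    and "density D (\<lambda>l. ennreal (exp l)) = \<mu>"
proof -
  have s[measurable_cong]: "sets \<mu> = sets borel" using \<mu> by (simp add: laplace_pos_def)
  have i: "integrable \<mu> (\<lambda>l. exp (- l))" using laplace_pos_integrable[OF \<mu>, of 1 0] by simp
  show fin: "finite_measure D"
  proof (rule finite_measureI)
    have "emeasure D (space D) = (\<integral>\<^sup>+l. ennreal (exp (- l)) \<partial>\<mu>)"
      by (simp add: D_def emeasure_density cong: nn_integral_cong)
    then show "emeasure D (space D) \<noteq> \<infinity>" using \<mu> by (auto simp: laplace_pos_def dest!: spec[of _ 1])
  qed
  show "sets D = sets borel" by (simp add: D_def s)
  show *: "measure D A = (\<integral>l. indicator A l * exp (- l) \<partial>\<mu>)" if [measurable]: "A \<in> sets borel" for A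
  proof -
    have ii: "integrable \<mu> (\<lambda>l. indicator A l * exp (- l))"
      using integrable_mult_indicator[OF _ i, of A] by (simp add: s)
    have "emeasure D A = (\<integral>\<^sup>+l. ennreal (indicator A l * exp (- l)) \<partial>\<mu>)"
      by (simp add: D_def emeasure_density s ennreal_mult' mult.commute ennreal_indicator[symmetric])
    also have "\<dots> = ennreal (\<integral>l. indicator A l * exp (- l) \<partial>\<mu>)"
      by (intro nn_integral_eq_integral ii) auto
    finally show ?thesis by (simp add: measure_def)
  qed
  show "measure D A = 0" if A[measurable]: "A \<in> sets borel" and "emeasure \<mu> A = 0" for A
  proof -
    have "AE l in \<mu>. l \<notin> A" using that by (intro AE_not_in) (auto simp: s)
    then have "(\<integral>l. indicator A l * exp (- l) \<partial>\<mu>) = (\<integral>l. 0 \<partial>\<mu>)"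
      by (intro integral_cong_AE) (auto simp: indicator_def)
    then show ?thesis using *[OF A] by simp
  qed
  show "density D (\<lambda>l. ennreal (exp l)) = \<mu>"
    unfolding D_def by (subst density_density_eq)
      (auto simp: ennreal_mult'[symmetric] exp_add[symmetric] density_1)
qed

text \<open>After weighting, p + n' and p' + n agree on half-lines, hence on all Borel sets; mutual
  singularity within each pair then separates the positive parts from the negative ones.\<close>

lemma inv_laplace_eq:
  assumes \<mu>: "\<mu> \<in> laplace_measures" and L: "\<And>t. 0 < t \<Longrightarrow> laplace \<mu> t = h t"
  shows "inv_laplace h = \<mu>"
  unfolding inv_laplace_def
proof (rule the_equality)
  show "\<mu> \<in> laplace_measures \<and> (\<forall>t>0. laplace \<mu> t = h t)" using assms by auto
next
  fix \<mu>' assume *: "\<mu>' \<in> laplace_measures \<and> (\<forall>t>0. laplace \<mu>' t = h t)"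
  obtain p n where pn: "\<mu> = (p, n)" by (cases \<mu>)
  obtain p' n' where pn': "\<mu>' = (p', n')" by (cases \<mu>')
  have pos: "laplace_pos p" "laplace_pos n" "laplace_pos p'" "laplace_pos n'"
    using \<mu> * unfolding pn pn' laplace_measures_def laplace_pos_def by (auto simp: less_top)
  have eq: "(\<integral>l. exp (- l * t) \<partial>p) - (\<integral>l. exp (- l * t) \<partial>n)
      = (\<integral>l. exp (- l * t) \<partial>p') - (\<integral>l. exp (- l * t) \<partial>n')" if "0 < t" for t
    using L[OF that] * that by (simp add: pn pn' laplace_def signed_integral_def)
  define D where "D \<mu> = density \<mu> (\<lambda>l. ennreal (exp (- l)))" for \<mu> :: "real measure"
  note dens = laplace_pos_density[folded D_def]
  interpret P: finite_measure "D p" by (rule dens(1)[OF pos(1)])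
  interpret N: finite_measure "D n" by (rule dens(1)[OF pos(2)])
  interpret P': finite_measure "D p'" by (rule dens(1)[OF pos(3)])
  interpret N': finite_measure "D n'" by (rule dens(1)[OF pos(4)])
  have s[simp, measurable_cong]: "sets (D p) = sets borel" "sets (D n) = sets borel"
    "sets (D p') = sets borel" "sets (D n') = sets borel"
    using dens(2) pos by auto
  have sp[simp]: "space (D p) = UNIV" "space (D n) = UNIV" "space (D p') = UNIV" "space (D n') = UNIV"
    using s[THEN sets_eq_imp_space_eq] by auto
  have key: "measure (D p) A + measure (D n') A = measure (D p') A + measure (D n) A"
    if "A \<in> sets borel" for A
  proof -
    have atM: "measure (D p) {..a} + measure (D n') {..a} = measure (D p') {..a} + measure (D n) {..a}" for a
      using laplace_diff_unique_atMost[OF pos eq, of a] dens(3)[of _ "{..a}"] pos by simp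
    \<comment> \<open>Complements in the Dynkin system argument need equality of the total masses,
      which are Laplace transforms at t = 1.\<close>
    have top: "measure (D p) UNIV + measure (D n') UNIV = measure (D p') UNIV + measure (D n) UNIV"
      using eq[of 1] dens(3)[of _ UNIV] pos by simp
    have "Int_stable (range (\<lambda>a. {..a::real}))"
      by (auto simp: Int_stable_def)
    moreover have "range (\<lambda>a. {..a::real}) \<subseteq> Pow UNIV" by simp
    moreover have "A \<in> sigma_sets UNIV (range (\<lambda>a. {..a::real}))"
      using that by (subst (asm) borel_eq_atMost) simp
    ultimately show ?thesis
    proof (induction rule: sigma_sets_induct_disjoint)
      case (basic A) then show ?case using atM by auto
    next
      case empty then show ?case by simp
    next
      case (compl A)
      then have "A \<in> sets borel" by (subst borel_eq_atMost) simp
      then show ?case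
        using compl.IH top P.finite_measure_compl[of A] P'.finite_measure_compl[of A]
          N.finite_measure_compl[of A] N'.finite_measure_compl[of A] by simp
    next
      case (union A)
      then have r: "range A \<subseteq> sets borel" by (subst borel_eq_atMost) auto
      have "(\<lambda>i. measure (D p) (A i) + measure (D n') (A i)) sums
          (measure (D p) (\<Union>i. A i) + measure (D n') (\<Union>i. A i))"
        using r union by (intro sums_add P.finite_measure_UNION N'.finite_measure_UNION) auto
      moreover have "(\<lambda>i. measure (D p') (A i) + measure (D n) (A i)) sums
          (measure (D p') (\<Union>i. A i) + measure (D n) (\<Union>i. A i))"
        using r union by (intro sums_add P'.finite_measure_UNION N.finite_measure_UNION) auto
      ultimately show ?case using union.IH by (simp add: sums_unique2)
    qed
  qed
  \<comment> \<open>Uniqueness of the Jordan decomposition. Outside \<open>D1\<close> and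
    \<open>D2\<close> both negative parts vanish, so \<open>P1\<close> and \<open>P2\<close> agree
    there. On \<open>D2\<close> without \<open>D1\<close> the measures \<open>N1\<close> and
    \<open>P2\<close> vanish, so \<open>P1 + N2\<close> does too, and symmetrically on
    \<open>D1\<close> without \<open>D2\<close>. What remains of \<open>A\<close> is null for
    \<open>P1\<close> inside \<open>D1\<close> and for \<open>P2\<close> inside
    \<open>D2\<close>.\<close>
  have sing: "measure P1 A = measure P2 A"
    if fin: "finite_measure P1" "finite_measure P2" "finite_measure N1" "finite_measure N2"
      and s: "sets P1 = sets borel" "sets P2 = sets borel" "sets N1 = sets borel" "sets N2 = sets borel"
      and k: "\<And>A. A \<in> sets borel \<Longrightarrow> measure P1 A + measure N2 A = measure P2 A + measure N1 A"
      and D: "D1 \<in> sets borel" "D2 \<in> sets borel" "measure P1 D1 = 0" "measure N1 (- D1) = 0"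
        "measure P2 D2 = 0" "measure N2 (- D2) = 0"
      and A: "A \<in> sets borel" for P1 P2 N1 N2 :: "real measure" and D1 D2 A
  proof -
    interpret P1: finite_measure P1 by fact
    interpret P2: finite_measure P2 by fact
    interpret N1: finite_measure N1 by fact
    interpret N2: finite_measure N2 by fact
    have sub: "measure Q B = 0" if "finite_measure Q" "sets Q = sets borel" "measure Q C = 0" "B \<subseteq> C"
      "C \<in> sets borel" for Q :: "real measure" and B C
      using finite_measure.finite_measure_mono[OF that(1), of B C] that measure_nonneg[of Q B] by simp
    define B where "B = A \<inter> - D1 \<inter> - D2"
    have B: "measure P1 B = measure P2 B"
      using k[of B] A D sub[OF fin(3) s(3) D(4), of B] sub[OF fin(4) s(4) D(6), of B] by (auto simp: B_def)
    have 1: "measure P1 (A \<inter> - D1 \<inter> D2) = 0"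
    proof -
      have X: "A \<inter> - D1 \<inter> D2 \<in> sets borel" using A D by auto
      have "measure N1 (A \<inter> - D1 \<inter> D2) = 0" by (rule sub[OF fin(3) s(3) D(4)]) (use D in auto)
      moreover have "measure P2 (A \<inter> - D1 \<inter> D2) = 0" by (rule sub[OF fin(2) s(2) D(5)]) (use D in auto)
      ultimately have "measure P1 (A \<inter> - D1 \<inter> D2) + measure N2 (A \<inter> - D1 \<inter> D2) = 0" using k[OF X] by simp
      then show ?thesis using measure_nonneg[of P1 "A \<inter> - D1 \<inter> D2"] measure_nonneg[of N2 "A \<inter> - D1 \<inter> D2"] by linarith
    qed
    have 2: "measure P2 (A \<inter> - D2 \<inter> D1) = 0"
    proof -
      have X: "A \<inter> - D2 \<inter> D1 \<in> sets borel" using A D by auto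
      have "measure N2 (A \<inter> - D2 \<inter> D1) = 0" by (rule sub[OF fin(4) s(4) D(6)]) (use D in auto)
      moreover have "measure P1 (A \<inter> - D2 \<inter> D1) = 0" by (rule sub[OF fin(1) s(1) D(3)]) (use D in auto)
      ultimately have "measure P2 (A \<inter> - D2 \<inter> D1) + measure N1 (A \<inter> - D2 \<inter> D1) = 0" using k[OF X] by simp
      then show ?thesis using measure_nonneg[of P2 "A \<inter> - D2 \<inter> D1"] measure_nonneg[of N1 "A \<inter> - D2 \<inter> D1"] by linarith
    qed
    have split: "measure Q A = measure Q (A \<inter> E) + (measure Q (A \<inter> - E \<inter> F) + measure Q (A \<inter> - E \<inter> - F))"
      if Q: "finite_measure Q" "sets Q = sets borel" and EF: "E \<in> sets borel" "F \<in> sets borel"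
      for Q :: "real measure" and E F
    proof -
      have "measure Q ((A \<inter> E) \<union> (A \<inter> - E)) = measure Q (A \<inter> E) + measure Q (A \<inter> - E)"
        using A EF Q(2) by (intro finite_measure.finite_measure_Union[OF Q(1)]) auto
      moreover have "measure Q ((A \<inter> - E \<inter> F) \<union> (A \<inter> - E \<inter> - F))
          = measure Q (A \<inter> - E \<inter> F) + measure Q (A \<inter> - E \<inter> - F)"
        using A EF Q(2) by (intro finite_measure.finite_measure_Union[OF Q(1)]) auto
      moreover have "(A \<inter> E) \<union> (A \<inter> - E) = A" "(A \<inter> - E \<inter> F) \<union> (A \<inter> - E \<inter> - F) = A \<inter> - E" by auto
      ultimately show ?thesis by simp
    qed
    have "A \<inter> - D2 \<inter> - D1 = B" by (auto simp: B_def)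
    moreover note split[OF fin(1) s(1) D(1,2)] split[OF fin(2) s(2) D(2,1)]
    ultimately show ?thesis
      using B 1 2 sub[OF fin(1) s(1) D(3), of "A \<inter> D1"] sub[OF fin(2) s(2) D(5), of "A \<inter> D2"] D by (simp add: B_def)
  qed
  obtain D1 where D1: "D1 \<in> sets borel" "emeasure p D1 = 0" "emeasure n (- D1) = 0"
    using \<mu> by (auto simp: pn laplace_measures_def)
  obtain D2 where D2: "D2 \<in> sets borel" "emeasure p' D2 = 0" "emeasure n' (- D2) = 0"
    using * by (auto simp: pn' laplace_measures_def)
  note fin = P.finite_measure_axioms P'.finite_measure_axioms N.finite_measure_axioms N'.finite_measure_axioms
  have z: "measure (D p) D1 = 0" "measure (D n) (- D1) = 0" "measure (D p') D2 = 0" "measure (D n') (- D2) = 0"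
    using D1 D2 pos dens(4) by auto
  have "D p = D p'"
  proof (rule measure_eqI)
    fix A assume "A \<in> sets (D p)"
    then have "measure (D p) A = measure (D p') A"
      using D1(1) D2(1) z key by (intro sing[of "D p" "D p'" "D n" "D n'" D1 D2] fin s) auto
    then show "emeasure (D p) A = emeasure (D p') A"
      by (simp add: P.emeasure_eq_measure P'.emeasure_eq_measure)
  qed simp
  moreover have "D n = D n'"
  proof (rule measure_eqI)
    fix A assume "A \<in> sets (D n)"
    \<comment> \<open>The same argument with the two parts exchanged, so that the separating sets
      become the complements.\<close>
    then have "measure (D n) A = measure (D n') A"
      using D1(1) D2(1) z key by (intro sing[of "D n" "D n'" "D p" "D p'" "- D1" "- D2"] fin s) (auto simp: add.commute)
    then show "emeasure (D n) A = emeasure (D n') A"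
      by (simp add: N.emeasure_eq_measure N'.emeasure_eq_measure)
  qed simp
  ultimately show "\<mu>' = \<mu>"
    using dens(5) pos by (simp add: pn pn') metis
qed

section \<open>Gronwall and mean value inequalities relative to a measure and a scale\<close>

text \<open>Allows division by 1 - t at the price of exp(2t). The reason is that (1 - t)(1 + 2t)
  equals 1 + t(1 - 2t).\<close>

lemma inverse_one_minus_le_exp:
  fixes t :: real
  assumes "0 \<le> t" and "t \<le> 1/2"
  shows "1 \<le> (1 - t) * exp (2 * t)"
proof -
  have "0 \<le> t * (1 - 2 * t)" using assms by (intro mult_nonneg_nonneg) auto
  then have "1 \<le> (1 - t) * (1 + 2 * t)" by (simp add: algebra_simps)
  also have "\<dots> \<le> (1 - t) * exp (2 * t)"
    using exp_ge_add_one_self[of "2 * t"] assms by (intro mult_left_mono) auto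
  finally show ?thesis .
qed

text \<open>The factor \<open>2\<close> pays for atoms of \<open>\<kappa>\<close>: the bound is propagated over intervals
  \<open>{x<..y}\<close> whose interior has small mass, whatever the mass of \<open>{y}\<close>.\<close>

lemma Gronwall_measure:
  fixes \<kappa> :: "real measure" and q :: "real \<Rightarrow> real"
  assumes "finite_measure \<kappa>" and s: "sets \<kappa> = sets borel" and lam: "0 \<le> r"
    and q: "integrable \<kappa> q" "\<And>y. 0 \<le> q y"
    and q_le: "\<And>y. 0 < y \<Longrightarrow> y \<le> c \<Longrightarrow> q y \<le> 1 + r * (\<integral>z. indicator {0<..<y} z * q z \<partial>\<kappa>)"
    and y: "0 < y" "y \<le> c"
  shows "q y \<le> exp (2 * r * measure \<kappa> {0<..y})"
proof -
  interpret finite_measure \<kappa> by fact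
  have [simp]: "space \<kappa> = UNIV" using sets_eq_imp_space_eq[OF s] by simp
  have [measurable_cong]: "sets \<kappa> = sets borel" by fact
  define J where "J A = (\<integral>z. indicator A z * q z \<partial>\<kappa>)" for A
  have int: "integrable \<kappa> (\<lambda>z. indicator A z * q z)" if "A \<in> sets borel" for A
    using integrable_mult_indicator[OF _ q(1), of A] that s by simp
  have J_Un: "J (A \<union> B) = J A + J B" if "A \<in> sets borel" "B \<in> sets borel" "A \<inter> B = {}" for A B
  proof -
    have "indicator (A \<union> B) z * q z = indicator A z * q z + indicator B z * q z" for z
      using that(3) by (auto simp: indicator_def)
    then show ?thesis unfolding J_def using int[OF that(1)] int[OF that(2)] by simp
  qed
  have J_le: "J A \<le> K * measure \<kappa> A" if A: "A \<in> sets borel" and K: "\<And>z. z \<in> A \<Longrightarrow> q z \<le> K" for A K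
  proof -
    have "J A \<le> (\<integral>z. indicator A z * K \<partial>\<kappa>)"
      unfolding J_def
    proof (rule integral_mono)
      show "integrable \<kappa> (\<lambda>z. indicator A z * K)"
        using A s by (intro integrable_mult_left) (simp add: emeasure_eq_measure)
    qed (use int[OF A] K in \<open>auto simp: indicator_def\<close>)
    then show ?thesis using A s by (simp add: mult.commute)
  qed
  \<comment> \<open>\<open>\<Phi>' y\<close>, defined next, omits a possible atom at
    \<open>y\<close> and by monotonicity already dominates \<open>q\<close> on (0,y];
    \<open>\<Phi> y\<close> includes the atom. The propagation step passes from
    \<open>\<Phi> x\<close> to \<open>\<Phi>' y\<close> and then to \<open>\<Phi> y\<close>.\<close>
  define \<Phi> where "\<Phi> y = 1 + r * J {0<..y}" for y
  define \<Phi>' where "\<Phi>' y = 1 + r * J {0<..<y}" for y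
  define a where "a y = measure \<kappa> {0<..y}" for y
  have J_pos: "0 \<le> J A" for A unfolding J_def using q(2) by (intro Bochner_Integration.integral_nonneg) auto
  have \<Phi>_pos: "1 \<le> \<Phi> y" "1 \<le> \<Phi>' y" for y
    using J_pos lam by (auto simp: \<Phi>_def \<Phi>'_def)
  have \<Phi>'_mono: "\<Phi>' z \<le> \<Phi>' y" if "z \<le> y" for y z
  proof -
    have "J {0<..<z} \<le> J {0<..<y}"
      unfolding J_def using that q(2) by (intro integral_mono int) (auto simp: indicator_def)
    then show ?thesis using lam by (simp add: \<Phi>'_def mult_left_mono)
  qed
  have step: "\<Phi> y \<le> \<Phi> x * exp (2 * r * measure \<kappa> {x<..y})"
    if x: "0 \<le> x" "x < y" "y \<le> c" and small: "r * measure \<kappa> {x<..<y} \<le> 1/2" for x y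
  proof -
    have "{0<..<y} = {0<..x} \<union> {x<..<y}" using x by auto
    then have "J {0<..<y} = J {0<..x} + J {x<..<y}" by (simp add: J_Un disjoint_iff)
    also have "J {x<..<y} \<le> \<Phi>' y * measure \<kappa> {x<..<y}"
    proof (rule J_le)
      show "q z \<le> \<Phi>' y" if "z \<in> {x<..<y}" for z
        using that x q_le[of z] \<Phi>'_mono[of z y] by (auto simp: \<Phi>'_def J_def)
    qed simp
    finally have "r * J {0<..<y} \<le> r * (J {0<..x} + \<Phi>' y * measure \<kappa> {x<..<y})"
      using lam by (intro mult_left_mono) auto
    \<comment> \<open>\<open>\<Phi>' y\<close> occurs on both sides and is absorbed on the left; the
      small mass of the open interval keeps the factor in front of it at least 1/2.\<close>
    then have 1: "\<Phi>' y * (1 - r * measure \<kappa> {x<..<y}) \<le> \<Phi> x"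
      by (simp add: \<Phi>_def \<Phi>'_def algebra_simps)
    have "\<Phi>' y * 1 \<le> \<Phi>' y * ((1 - r * measure \<kappa> {x<..<y}) * exp (2 * (r * measure \<kappa> {x<..<y})))"
      using \<Phi>_pos(2)[of y] small lam
      by (intro mult_left_mono inverse_one_minus_le_exp) auto
    also have "\<dots> \<le> \<Phi> x * exp (2 * (r * measure \<kappa> {x<..<y}))"
      using 1 by (simp add: mult.assoc[symmetric] mult_right_mono)
    finally have 2: "\<Phi>' y \<le> \<Phi> x * exp (2 * (r * measure \<kappa> {x<..<y}))" by simp
    have "{0<..y} = {0<..<y} \<union> {y}" using x by auto
    then have "J {0<..y} = J {0<..<y} + J {y}" using J_Un[of "{0<..<y}" "{y}"] by simp
    also have "J {y} \<le> \<Phi>' y * measure \<kappa> {y}"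
      using q_le[of y] x by (intro J_le) (auto simp: \<Phi>'_def J_def)
    finally have "r * J {0<..y} \<le> r * (J {0<..<y} + \<Phi>' y * measure \<kappa> {y})"
      using lam by (intro mult_left_mono) auto
    then have "\<Phi> y \<le> \<Phi>' y * (1 + r * measure \<kappa> {y})"
      by (simp add: \<Phi>_def \<Phi>'_def algebra_simps)
    also have "\<dots> \<le> \<Phi>' y * exp (2 * (r * measure \<kappa> {y}))"
    proof (rule mult_left_mono)
      have "1 + r * measure \<kappa> {y} \<le> exp (r * measure \<kappa> {y})" by (rule exp_ge_add_one_self)
      also have "\<dots> \<le> exp (2 * (r * measure \<kappa> {y}))" using lam by simp
      finally show "1 + r * measure \<kappa> {y} \<le> exp (2 * (r * measure \<kappa> {y}))" .
    qed (use \<Phi>_pos(2)[of y] in auto)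
    also have "\<dots> \<le> (\<Phi> x * exp (2 * (r * measure \<kappa> {x<..<y}))) * exp (2 * (r * measure \<kappa> {y}))"
      using 2 by (intro mult_right_mono) auto
    also have "\<dots> = \<Phi> x * exp (2 * r * (measure \<kappa> {x<..<y} + measure \<kappa> {y}))"
      by (simp add: mult.assoc mult_exp_exp distrib_left)
    also have "measure \<kappa> {x<..<y} + measure \<kappa> {y} = measure \<kappa> ({x<..<y} \<union> {y})"
      using s by (subst finite_measure_Union) auto
    also have "{x<..<y} \<union> {y} = {x<..y}" using x by auto
    finally show ?thesis .
  qed
  define good where "good y \<longleftrightarrow> \<Phi> y \<le> exp (2 * r * a y)" for y
  have good0: "good 0" by (simp add: good_def \<Phi>_def a_def J_def)
  have good_step: "good y"
    if "0 \<le> x" "x < y" "y \<le> c" "r * measure \<kappa> {x<..<y} \<le> 1/2" "good x" for x y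
  proof -
    have "\<Phi> y \<le> \<Phi> x * exp (2 * r * measure \<kappa> {x<..y})" by (rule step) fact+
    also have "\<dots> \<le> exp (2 * r * a x) * exp (2 * r * measure \<kappa> {x<..y})"
      using that by (intro mult_right_mono) (auto simp: good_def)
    also have "\<dots> = exp (2 * r * (measure \<kappa> {0<..x} + measure \<kappa> {x<..y}))"
      by (simp add: a_def mult_exp_exp distrib_left)
    also have "measure \<kappa> {0<..x} + measure \<kappa> {x<..y} = measure \<kappa> ({0<..x} \<union> {x<..y})"
      using s by (subst finite_measure_Union) auto
    also have "{0<..x} \<union> {x<..y} = {0<..y}" using that by auto
    finally show ?thesis by (simp add: good_def a_def)
  qed
  have small_lim: "\<exists>k. r * measure \<kappa> (A k) \<le> 1/2"
    if "decseq A" "\<And>k. A k \<in> sets borel" "(\<Inter>k. A k) = {}" for A :: "nat \<Rightarrow> real set"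
  proof -
    have "(\<lambda>k. measure \<kappa> (A k)) \<longlonglongrightarrow> measure \<kappa> (\<Inter>k. A k)"
      using that s by (intro finite_Lim_measure_decseq) auto
    then have "(\<lambda>k. r * measure \<kappa> (A k)) \<longlonglongrightarrow> r * 0"
      using that(3) by (intro tendsto_mult tendsto_const) simp
    then have "\<forall>\<^sub>F k in sequentially. r * measure \<kappa> (A k) < 1/2"
      by (intro order_tendstoD) auto
    then show ?thesis unfolding eventually_sequentially by (meson less_imp_le order_refl)
  qed
  \<comment> \<open>Continuation along the interval: \<open>z0\<close> is the supremum of the points
    up to which the bound holds throughout. The bound reaches \<open>z0\<close> from the left and,
    unless \<open>z0\<close> is \<open>c\<close>, extends beyond it to the right.\<close>
  define B where "B = {y\<in>{0..c}. \<forall>z\<in>{0..y}. good z}"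
  define z0 where "z0 = Sup B"
  have c: "0 < c" using y by simp
  have B0: "0 \<in> B" using c good0 by (auto simp: B_def)
  have Bbdd: "bdd_above B" by (auto simp: B_def intro: bdd_aboveI[of _ c])
  have z0: "0 \<le> z0" "z0 \<le> c"
  proof -
    show "0 \<le> z0" unfolding z0_def by (rule cSup_upper[OF B0 Bbdd])
    show "z0 \<le> c" unfolding z0_def
    proof (rule cSup_least)
      show "B \<noteq> {}" using B0 by blast
      show "z \<le> c" if "z \<in> B" for z using that by (simp add: B_def)
    qed
  qed
  have below: "good z" if z: "0 \<le> z" "z < z0" for z
  proof -
    obtain y where "y \<in> B" "z < y"
      using less_cSupD[of B z] B0 z(2) unfolding z0_def by blast
    then show ?thesis using z by (auto simp: B_def)
  qed
  have gz0: "good z0"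
  proof (cases "z0 = 0")
    case False
    then have z0p: "0 < z0" using z0 by simp
    \<comment> \<open>Open intervals ending at \<open>z0\<close> shrink to the empty set, so their
      mass becomes small even if \<open>z0\<close> is an atom. The same holds below for intervals to
      the right of \<open>z0\<close>.\<close>
    have "\<exists>k. r * measure \<kappa> {z0 - z0 / real (Suc k)<..<z0} \<le> 1/2"
    proof (rule small_lim)
      show "decseq (\<lambda>k. {z0 - z0 / real (Suc k)<..<z0})"
      proof (rule decseq_SucI)
        fix k
        have "z0 / real (Suc (Suc k)) \<le> z0 / real (Suc k)" using z0p by (intro divide_left_mono) auto
        then show "{z0 - z0 / real (Suc (Suc k))<..<z0} \<subseteq> {z0 - z0 / real (Suc k)<..<z0}" by auto
      qed
      show "(\<Inter>k. {z0 - z0 / real (Suc k)<..<z0}) = {}"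
      proof (rule ccontr)
        assume "(\<Inter>k. {z0 - z0 / real (Suc k)<..<z0}) \<noteq> {}"
        then obtain z where zI: "z \<in> (\<Inter>k. {z0 - z0 / real (Suc k)<..<z0})" by blast
        have z: "z0 - z0 / real (Suc k) < z" "z < z0" for k using INT_D[OF zI, of k] by simp_all
        obtain k where "z0 / (z0 - z) < real k" using reals_Archimedean2 by blast
        then have "z0 < real (Suc k) * (z0 - z)" using z(2) by (simp add: field_simps)
        then show False using z(1)[of k] by (simp add: field_simps)
      qed
    qed simp
    then obtain k where k: "r * measure \<kappa> {z0 - z0 / real (Suc k)<..<z0} \<le> 1/2" by blast
    have "0 \<le> z0 - z0 / real (Suc k)" using z0p by (simp add: field_simps)
    moreover have "z0 - z0 / real (Suc k) < z0" using z0p by simp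
    ultimately show ?thesis using good_step[OF _ _ z0(2) k] below by auto
  qed (simp add: good0)
  have "z0 = c"
  proof (rule ccontr)
    assume "z0 \<noteq> c"
    then have lt: "z0 < c" using z0 by simp
    have "\<exists>k. r * measure \<kappa> {z0<..<z0 + (c - z0) / real (Suc k)} \<le> 1/2"
    proof (rule small_lim)
      show "decseq (\<lambda>k. {z0<..<z0 + (c - z0) / real (Suc k)})"
      proof (rule decseq_SucI)
        fix k
        have "(c - z0) / real (Suc (Suc k)) \<le> (c - z0) / real (Suc k)" using lt by (intro divide_left_mono) auto
        then show "{z0<..<z0 + (c - z0) / real (Suc (Suc k))} \<subseteq> {z0<..<z0 + (c - z0) / real (Suc k)}" by auto
      qed
      show "(\<Inter>k. {z0<..<z0 + (c - z0) / real (Suc k)}) = {}"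
      proof (rule ccontr)
        assume "(\<Inter>k. {z0<..<z0 + (c - z0) / real (Suc k)}) \<noteq> {}"
        then obtain z where zI: "z \<in> (\<Inter>k. {z0<..<z0 + (c - z0) / real (Suc k)})" by blast
        have z: "z < z0 + (c - z0) / real (Suc k)" "z0 < z" for k using INT_D[OF zI, of k] by simp_all
        obtain k where "(c - z0) / (z - z0) < real k" using reals_Archimedean2 by blast
        then have "c - z0 < real (Suc k) * (z - z0)" using z(2) by (simp add: field_simps)
        then show False using z(1)[of k] by (simp add: field_simps)
      qed
    qed simp
    then obtain k where k: "r * measure \<kappa> {z0<..<z0 + (c - z0) / real (Suc k)} \<le> 1/2" by blast
    define y1 where "y1 = z0 + (c - z0) / real (Suc k)"
    have y1: "z0 < y1" "y1 \<le> c" using lt by (auto simp: y1_def field_simps mult_right_mono)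
    have "good z" if z: "z0 < z" "z \<le> y1" for z
    proof (rule good_step[OF z0(1) z(1)])
      have "measure \<kappa> {z0<..<z} \<le> measure \<kappa> {z0<..<y1}"
        using z s by (intro finite_measure_mono) auto
      then have "r * measure \<kappa> {z0<..<z} \<le> r * measure \<kappa> {z0<..<y1}" using lam by (rule mult_left_mono)
      then show "r * measure \<kappa> {z0<..<z} \<le> 1/2" using k by (simp add: y1_def)
    qed (use z y1 gz0 in auto)
    then have "good z" if "0 \<le> z" "z \<le> y1" for z
      using that below[of z] gz0 by (cases z z0 rule: linorder_cases) auto
    then have "y1 \<in> B" using y1 z0 by (simp add: B_def)
    then have "y1 \<le> z0" unfolding z0_def by (intro cSup_upper Bbdd)
    then show False using y1 by simp
  qed
  then have "good y" using below[of y] gz0 y by (cases "y = c") auto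
  moreover have "q y \<le> \<Phi> y"
  proof -
    have "J {0<..<y} \<le> J {0<..y}"
      unfolding J_def using q(2) by (intro integral_mono int) (auto simp: indicator_def)
    then have "r * J {0<..<y} \<le> r * J {0<..y}" using lam by (rule mult_left_mono)
    then show ?thesis using q_le[OF y] by (simp add: \<Phi>_def J_def)
  qed
  ultimately show ?thesis by (simp add: good_def a_def)
qed

text \<open>The replacement for the sign of a two-sided derivative. By continuity there is a last
  point where \<phi> does not exceed its value at the start, and the local hypothesis would push it
  further unless it is \<open>y\<close>.\<close>

lemma right_nonincreasing_imp_le:
  fixes \<phi> :: "real \<Rightarrow> real"
  assumes xy: "x < y" and cont: "continuous_on {x..y} \<phi>"
    and loc: "\<And>z. x < z \<Longrightarrow> z < y \<Longrightarrow> \<forall>\<^sub>F t in at_right z. \<phi> t \<le> \<phi> z"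
  shows "\<phi> y \<le> \<phi> x"
proof -
  have le: "\<phi> y \<le> \<phi> x1" if x1: "x < x1" "x1 < y" for x1
  proof -
    define A where "A = {z\<in>{x1..y}. \<phi> z \<le> \<phi> x1}"
    have cont1: "continuous_on {x1..y} \<phi>" using cont by (rule continuous_on_subset) (use x1 in auto)
    have "closed A" unfolding A_def
      using continuous_on_closed_Collect_le[OF cont1 continuous_on_const closed_atLeastAtMost] by simp
    moreover have "bounded A" by (rule bounded_subset[OF bounded_closed_interval[of x1 y]]) (auto simp: A_def)
    ultimately have comp: "compact A" by (simp add: compact_eq_bounded_closed)
    have "x1 \<in> A" using x1 by (simp add: A_def)
    then have ne: "A \<noteq> {}" by blast
    obtain z0 where z0: "z0 \<in> A" "\<And>z. z \<in> A \<Longrightarrow> z \<le> z0"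
      using compact_attains_sup[OF comp ne] by blast
    have "z0 = y"
    proof (rule ccontr)
      assume "z0 \<noteq> y"
      then have lt: "z0 < y" "x < z0" using z0(1) x1 by (auto simp: A_def)
      have "\<forall>\<^sub>F t in at_right z0. \<phi> t \<le> \<phi> z0 \<and> z0 < t \<and> t < y"
        using loc[OF lt(2,1)] eventually_at_right_real[OF lt(1)] by eventually_elim auto
      then obtain t where "\<phi> t \<le> \<phi> z0" "z0 < t" "t < y"
        using eventually_happens[of _ "at_right z0"] by (auto simp: trivial_limit_at_right_real)
      then have "t \<in> A" using z0(1) by (auto simp: A_def)
      then show False using z0(2)[of t] \<open>z0 < t\<close> by simp
    qed
    then show ?thesis using z0(1) by (simp add: A_def)
  qed
  have "(\<phi> \<longlongrightarrow> \<phi> x) (at x within {x..y})"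
    using cont xy by (simp add: continuous_on_def)
  then have "(\<phi> \<longlongrightarrow> \<phi> x) (at_right x)"
    using xy by (simp add: at_within_Icc_at_right)
  moreover have "\<forall>\<^sub>F t in at_right x. \<phi> y \<le> \<phi> t"
    using eventually_at_right_real[OF xy] by eventually_elim (auto intro: le)
  ultimately show ?thesis by (intro tendsto_lowerbound[of \<phi> _ "at_right x"]) (auto simp: trivial_limit_at_right_real)
qed

text \<open>Only right derivatives are available, so the difference of \<open>u\<close> and a
  slightly too steep multiple of \<open>s\<close> is shown to be nonincreasing. The slope
  \<open>d\<close> is free; it is later the derivative at the right endpoint or 0.\<close>

lemma scale_deriv_mean_value:
  assumes xy: "x < y" and s: "continuous_on {x..y} s" "strict_mono_on {x..y} s"
    and u: "continuous_on {x..y} u"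
    and w: "\<And>z. x < z \<Longrightarrow> z < y \<Longrightarrow> has_scale_deriv s u (w z) z"
    and K: "\<And>z. x < z \<Longrightarrow> z < y \<Longrightarrow> \<bar>w z - d\<bar> \<le> K"
  shows "\<bar>u y - u x - d * (s y - s x)\<bar> \<le> K * (s y - s x)"
proof -
  have sxy: "0 < s y - s x" using s(2) xy by (auto simp: strict_mono_on_def)
  have upper: "u y - u x \<le> D * (s y - s x)"
    if u: "continuous_on {x..y} u" and w: "\<And>z. x < z \<Longrightarrow> z < y \<Longrightarrow> has_scale_deriv s u (w z) z \<and> w z \<le> D"
    for u w D
  proof (rule field_le_epsilon)
    fix e :: real assume e: "0 < e"
    \<comment> \<open>The tilt gives the strict inequality that passes from a limit to nearby
      quotients; its size makes the total cost exactly \<open>e\<close>.\<close>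
    define \<delta> where "\<delta> = e / (s y - s x)"
    have \<delta>: "0 < \<delta>" using e sxy by (simp add: \<delta>_def)
    have "u y - (D + \<delta>) * s y \<le> u x - (D + \<delta>) * s x"
    proof (rule right_nonincreasing_imp_le[OF xy])
      show "continuous_on {x..y} (\<lambda>x. u x - (D + \<delta>) * s x)" by (intro continuous_intros u s)
    next
      fix z assume z: "x < z" "z < y"
      have "\<forall>\<^sub>F t in at_right z. (u t - u z) / (s t - s z) < D + \<delta>"
        using w[OF z] \<delta> unfolding has_scale_deriv_def by (intro order_tendstoD) auto
      then show "\<forall>\<^sub>F t in at_right z. u t - (D + \<delta>) * s t \<le> u z - (D + \<delta>) * s z"
        using eventually_at_right_real[OF z(2)]
      proof eventually_elim
        case (elim t)
        have "s z < s t" using s(2) elim z by (auto simp: strict_mono_on_def)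
        then show ?case using elim by (simp add: field_simps)
      qed
    qed
    then have "u y - u x \<le> (D + \<delta>) * (s y - s x)" by (simp add: algebra_simps)
    also have "\<dots> = D * (s y - s x) + e" using sxy by (simp add: \<delta>_def distrib_right)
    finally show "u y - u x \<le> D * (s y - s x) + e" .
  qed
  have "u y - u x \<le> (d + K) * (s y - s x)"
    using w K by (intro upper[where w = w] u) (auto simp: abs_le_iff algebra_simps)
  moreover have "- u y - - u x \<le> (K - d) * (s y - s x)"
  proof (intro upper[where w = "\<lambda>z. - w z"] conjI)
    fix z assume z: "x < z" "z < y"
    show "has_scale_deriv s (\<lambda>x. - u x) (- w z) z"
      using tendsto_minus[OF w[OF z, unfolded has_scale_deriv_def]]
      unfolding has_scale_deriv_def by (simp add: minus_divide_left)
    show "- w z \<le> K - d" using K[OF z] by (auto simp: abs_le_iff)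
  qed (intro continuous_intros u)
  ultimately show ?thesis by (simp add: abs_le_iff algebra_simps)
qed

section \<open>Scale functions and eigenfunctions near an accessible boundary\<close>

lemma integral_indicator_tendsto_0:
  fixes g :: "real \<Rightarrow> real"
  assumes s: "sets M = sets borel" and g: "integrable M g"
  shows "((\<lambda>y. \<integral>z. indicator {0<..y} z * g z \<partial>M) \<longlongrightarrow> 0) (at_right 0)"
  unfolding tendsto_at_iff_sequentially comp_def
proof (intro allI impI)
  fix Y :: "nat \<Rightarrow> real" assume Y: "\<forall>i. Y i \<in> {0<..} - {0}" and Y0: "Y \<longlonglongrightarrow> 0"
  have [measurable_cong]: "sets M = sets borel" by fact
  have [measurable]: "g \<in> borel_measurable M" using g by simp
  have "(\<lambda>i. \<integral>z. indicator {0<..Y i} z * g z \<partial>M) \<longlonglongrightarrow> (\<integral>z. 0 \<partial>M)"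
  proof (rule integral_dominated_convergence[where w = "\<lambda>z. \<bar>g z\<bar>"])
    show "AE z in M. (\<lambda>i. indicator {0<..Y i} z * g z) \<longlonglongrightarrow> 0"
    proof (intro AE_I2)
      fix z
      have "\<forall>\<^sub>F i in sequentially. indicator {0<..Y i} z * g z = 0"
      proof (cases "z \<le> 0")
        case False
        then have "\<forall>\<^sub>F i in sequentially. Y i < z" using Y0 by (intro order_tendstoD) auto
        then show ?thesis by eventually_elim (simp add: indicator_def)
      qed simp
      then show "(\<lambda>i. indicator {0<..Y i} z * g z) \<longlonglongrightarrow> 0" by (rule tendsto_eventually)
    qed
  qed (use g in \<open>auto simp: indicator_def\<close>)
  then show "(\<lambda>i. \<integral>z. indicator {0<..Y i} z * g z \<partial>M) \<longlonglongrightarrow> 0" by simp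
qed

locale accessible_scale =
  fixes b :: ereal and s :: "real \<Rightarrow> real" and m :: "real measure"
  assumes b_pos: "0 < b" and scale: "scale_function b s" and speed: "speed_measure b m"
    and access: "zero_accessible b s m"
begin

abbreviation I :: "real set" where "I \<equiv> interior_pts b"

lemma sets_m [simp, measurable_cong]: "sets m = sets borel" and space_m [simp]: "space m = UNIV"
proof -
  show *: "sets m = sets borel" using speed by (simp add: speed_measure_def)
  show "space m = UNIV" using sets_eq_imp_space_eq[OF *] by simp
qed

lemma I_open: "open I"
proof -
  have "I = {0<..} \<inter> ereal -` {..<b}" by auto
  moreover have "open (ereal -` {..<b})" by (intro open_vimage) (auto intro: continuous_intros)
  ultimately show ?thesis by (simp add: open_Int)
qed

lemma I_borel [measurable, simp]: "I \<in> sets borel"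
  by (rule borel_open[OF I_open])

lemma ereal_less_b: "x \<le> y \<Longrightarrow> ereal y < b \<Longrightarrow> ereal x < b"
  by (rule le_less_trans[of _ "ereal y"]) simp_all

lemma I_downward: "x \<in> I \<Longrightarrow> 0 < y \<Longrightarrow> y \<le> x \<Longrightarrow> y \<in> I"
  using ereal_less_b[of y x] by simp

lemma AE_m_I: "AE x in m. x \<in> I"
proof (rule AE_I)
  show "emeasure m (- I) = 0" using speed by (simp add: speed_measure_def)
qed auto

lemma emeasure_m_Icc: "0 < x \<Longrightarrow> y \<in> I \<Longrightarrow> emeasure m {x..y} < \<infinity>"
proof -
  assume xy: "0 < x" "y \<in> I"
  \<comment> \<open>\<open>speed_measure\<close> speaks of nondegenerate intervals only; enlarging
    the interval to the right also covers x = y.\<close>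
  have "\<exists>z. y < z \<and> ereal z < b" using xy ereal_dense2[of "ereal y" b] by auto
  then obtain z where z: "y < z" "ereal z < b" by blast
  show ?thesis
  proof (cases "x \<le> y")
    case True
    then have "emeasure m {x..z} < \<infinity>" using speed xy z by (auto simp: speed_measure_def)
    moreover have "emeasure m {x..y} \<le> emeasure m {x..z}" using z by (intro emeasure_mono) auto
    ultimately show ?thesis by (rule le_less_trans[rotated])
  qed simp
qed

lemma emeasure_m_Ioo_pos: "0 < x \<Longrightarrow> x < y \<Longrightarrow> y \<in> I \<Longrightarrow> 0 < emeasure m {x<..<y}"
  using speed by (simp add: speed_measure_def)

lemma s_tendsto: "(s \<longlongrightarrow> s 0) (at_right 0)"
  using access by (simp add: zero_accessible_def)

lemma s_less: assumes "0 \<le> x" "x < y" "ereal y < b" shows "s x < s y"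
proof -
  have mono: "s x < s y" if "0 < x" "x < y" "ereal y < b" for x y
  proof -
    have "ereal x < b" using that ereal_less_b[of x y] by simp
    then show ?thesis using scale that by (auto simp: scale_function_def strict_mono_on_def)
  qed
  show ?thesis
  proof (cases "x = 0")
    case True
    \<comment> \<open>Passing to the limit at 0 loses strictness, and the intermediate point y/2
      restores it.\<close>
    have y2: "0 < y / 2" "y / 2 < y" using assms by auto
    then have y2b: "ereal (y / 2) < b" using assms ereal_less_b[of "y/2" y] by simp
    have "s 0 \<le> s (y / 2)"
    proof (rule tendsto_upperbound[OF s_tendsto])
      show "\<forall>\<^sub>F t in at_right 0. s t \<le> s (y / 2)"
        using eventually_at_right_real[OF y2(1)] by eventually_elim (use mono y2b in \<open>auto intro: less_imp_le\<close>)
    qed (simp add: trivial_limit_at_right_real)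
    also have "\<dots> < s y" using mono y2 assms by auto
    finally show ?thesis using True by simp
  qed (use mono assms in auto)
qed

lemma s_pos: "x \<in> I \<Longrightarrow> 0 < s x - s 0"
  using s_less[of 0 x] by simp

lemma s_le: "0 \<le> x \<Longrightarrow> x \<le> y \<Longrightarrow> ereal y < b \<Longrightarrow> s x \<le> s y"
  using s_less[of x y] by (cases "x = y") auto

lemma s_strict_mono: "ereal y < b \<Longrightarrow> 0 \<le> x \<Longrightarrow> strict_mono_on {x..y} s"
proof (rule strict_mono_onI)
  fix z z' assume a: "ereal y < b" "0 \<le> x" "z \<in> {x..y}" "z' \<in> {x..y}" "z < z'"
  then show "s z < s z'" using ereal_less_b[of z' y] by (intro s_less) auto
qed

lemma s_cont: "continuous_on {x. 0 \<le> x \<and> ereal x < b} s"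
  unfolding continuous_on_def
proof
  fix x assume x: "x \<in> {x. 0 \<le> x \<and> ereal x < b}"
  show "(s \<longlongrightarrow> s x) (at x within {x. 0 \<le> x \<and> ereal x < b})"
  proof (cases "x = 0")
    case True
    show ?thesis unfolding True
      by (rule tendsto_within_subset[of s _ 0 "{0..}"]) (auto simp: at_within_Ici_at_right s_tendsto)
  next
    case False
    have "continuous_on I s" using scale by (simp add: scale_function_def)
    moreover have "x \<in> I" using x False by simp
    ultimately have "isCont s x" using I_open continuous_on_eq_continuous_at by blast
    then show ?thesis unfolding isCont_def by (rule tendsto_within_subset) simp
  qed
qed

lemma s_cont_Icc: "0 \<le> x \<Longrightarrow> ereal y < b \<Longrightarrow> continuous_on {x..y} s"
  by (rule continuous_on_subset[OF s_cont]) (auto intro: ereal_less_b)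

text \<open>Nothing is assumed of \<open>s\<close> beyond the interval apart from its value at 0;
  the cutoff makes the normalised scale a nonnegative Borel function on the whole line.\<close>

definition S :: "real \<Rightarrow> real" where "S x = indicator I x * (s x - s 0)"

lemma S_eq: "x \<in> I \<Longrightarrow> S x = s x - s 0" and S_nonneg: "0 \<le> S x" and S_pos: "x \<in> I \<Longrightarrow> 0 < S x"
  using s_pos by (auto simp: S_def indicator_def dest: less_imp_le)

lemma S_borel [measurable]: "S \<in> borel_measurable borel"
proof -
  have "continuous_on I (\<lambda>x. s x - s 0)"
    by (intro continuous_intros continuous_on_subset[OF s_cont]) auto
  from borel_measurable_continuous_on_indicator[OF I_borel this] show ?thesis
    by (simp add: S_def[abs_def])
qed

section \<open>Growth of the eigenfunctions near the accessible boundary\<close>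

lemma psi_borel:
  assumes "is_psi b s m l u"
  shows "u \<in> borel_measurable borel"
proof -
  let ?J = "{x. 0 \<le> x \<and> ereal x < b}"
  have "?J \<in> sets borel" by measurable
  from borel_measurable_continuous_on_indicator[OF this, of u]
  have "(\<lambda>x. indicator ?J x *\<^sub>R u x) \<in> borel_measurable borel" using assms by (simp add: is_psi_def)
  moreover have "(\<lambda>x. indicator ?J x *\<^sub>R u x) = u"
    using assms by (auto simp: is_psi_def indicator_def not_less not_le fun_eq_iff)
  ultimately show ?thesis by simp
qed

lemma psi_zero: "is_psi b s m l u \<Longrightarrow> x \<notin> I \<Longrightarrow> u x = 0"
  by (cases "x = 0") (auto simp: is_psi_def not_less)

lemma psi_cont: "is_psi b s m l u \<Longrightarrow> continuous_on I u"
  by (auto simp: is_psi_def dmds_def)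

lemma psi_ratio:
  assumes "is_psi b s m l u"
  shows "((\<lambda>y. u y / (s y - s 0)) \<longlongrightarrow> 1) (at_right 0)"
proof -
  have "u 0 = 0" "has_scale_deriv s u 1 0" using assms by (simp_all add: is_psi_def)
  then show ?thesis by (simp add: has_scale_deriv_def)
qed

lemma eventually_I: "\<forall>\<^sub>F y in at_right 0. y \<in> I"
proof -
  obtain base where base: "base \<in> I" using access by (auto simp: zero_accessible_def)
  then have "0 < base" by simp
  from eventually_at_right_real[OF this] show ?thesis
    by eventually_elim (use base I_downward[OF base] in auto)
qed

lemma psi_eventually_pos:
  assumes "is_psi b s m l u"
  shows "\<forall>\<^sub>F y in at_right 0. 0 < u y"
proof -
  have "\<forall>\<^sub>F y in at_right 0. 0 < u y / (s y - s 0)"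
    using psi_ratio[OF assms] by (rule order_tendstoD) simp
  then show ?thesis using eventually_I
  proof eventually_elim
    case (elim y)
    then show ?case using s_pos[of y] by (simp add: zero_less_divide_iff)
  qed
qed

text \<open>The quantity a(y) of the introduction.\<close>

definition near0_mass :: "real \<Rightarrow> real" where "near0_mass y = (\<integral>z. indicator {0<..y} z * S z \<partial>m)"

text \<open>A point fixed once and for all; the local estimates take place on (0,base], where
  \<open>S\<close> is m-integrable by accessibility.\<close>

definition base where "base = (SOME base. base \<in> I \<and> integrable m (\<lambda>z. indicator {0<..base} z * S z))"

lemma base: "base \<in> I" "integrable m (\<lambda>z. indicator {0<..base} z * S z)"
proof -
  obtain base' where base': "0 < base'" "ereal base' < b" "(\<integral>\<^sup>+x\<in>{0<..base'}. ennreal (s x - s 0) \<partial>m) < \<infinity>"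
    using access by (auto simp: zero_accessible_def)
  have eq: "ennreal (indicator {0<..base'} z * S z) = ennreal (s z - s 0) * indicator {0<..base'} z" for z
    using I_downward[of base' z] base' by (auto simp: indicator_def S_def)
  have "integrable m (\<lambda>z. indicator {0<..base'} z * S z)"
  proof (rule integrableI_bounded)
    show "(\<integral>\<^sup>+ x. ennreal (norm (indicator {0<..base'} x * S x)) \<partial>m) < \<infinity>"
      using base'(3) S_nonneg by (simp add: eq abs_mult)
  qed simp
  then have "\<exists>base. base \<in> I \<and> integrable m (\<lambda>z. indicator {0<..base} z * S z)" using base' by auto
  from someI_ex[OF this] show "base \<in> I" "integrable m (\<lambda>z. indicator {0<..base} z * S z)"
    by (auto simp: base_def)
qed

lemma base_pos: "0 < base"
  using base(1) by simp

lemma Ioc_base_I: "z \<in> {0<..base} \<Longrightarrow> z \<in> I"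
  using I_downward[OF base(1)] by simp

lemma near0_mass_tendsto_0: "(near0_mass \<longlongrightarrow> 0) (at_right 0)"
proof -
  have "((\<lambda>y. \<integral>z. indicator {0<..y} z * (indicator {0<..base} z * S z) \<partial>m) \<longlongrightarrow> 0) (at_right 0)"
    by (rule integral_indicator_tendsto_0[OF sets_m base(2)])
  moreover have "\<forall>\<^sub>F y in at_right 0. (\<integral>z. indicator {0<..y} z * (indicator {0<..base} z * S z) \<partial>m) = near0_mass y"
    using eventually_at_right_real[OF base_pos]
  proof eventually_elim
    case (elim y)
    then show ?case unfolding near0_mass_def
      by (intro Bochner_Integration.integral_cong) (auto simp: indicator_def)
  qed
  ultimately show ?thesis by (rule Lim_transform_eventually)
qed

text \<open>A crude bound whose purpose is integrability of \<open>u\<close> on (0,base], the entry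
  condition for Gronwall. Near 0 the ratio to \<open>S\<close> tends to 1; away from 0 compactness
  and S > 0 suffice.\<close>

lemma psi_le_linear:
  assumes "is_psi b s m l u"
  shows "\<exists>K. \<forall>z\<in>{0<..base}. \<bar>u z\<bar> \<le> K * S z"
proof -
  have "\<forall>\<^sub>F y in at_right 0. u y / (s y - s 0) < 2 \<and> 0 < u y \<and> y \<in> I"
    using order_tendstoD(2)[OF psi_ratio[OF assms], of 2] psi_eventually_pos[OF assms] eventually_I
    by (intro eventually_conj) auto
  then obtain d where d: "0 < d" "\<And>y. 0 < y \<Longrightarrow> y < d \<Longrightarrow> u y / (s y - s 0) < 2 \<and> 0 < u y \<and> y \<in> I"
    unfolding eventually_at_right_field by auto
  define e where "e = min d base"
  have e: "0 < e" "e \<le> d" "e \<le> base" using d(1) base by (auto simp: e_def)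
  then have eI: "e \<in> I" using Ioc_base_I by simp
  have "continuous_on {e..base} u"
    by (rule continuous_on_subset[OF psi_cont[OF assms]]) (use e Ioc_base_I in auto)
  then have "bounded (u ` {e..base})" by (intro compact_imp_bounded compact_continuous_image) auto
  then obtain B where B: "\<And>y. y \<in> {e..base} \<Longrightarrow> \<bar>u y\<bar> \<le> B" unfolding bounded_iff by (metis imageI real_norm_def)
  have "\<bar>u z\<bar> \<le> max 2 (\<bar>B\<bar> / S e) * S z" if z: "z \<in> {0<..base}" for z
  proof (cases "z < e")
    case True
    then have "u z / (s z - s 0) < 2" "0 < u z" "z \<in> I" using d(2)[of z] z e by auto
    then have "\<bar>u z\<bar> \<le> 2 * S z" using s_pos[of z] by (simp add: S_eq field_simps)
    also have "\<dots> \<le> max 2 (\<bar>B\<bar> / S e) * S z" by (intro mult_right_mono S_nonneg) simp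
    finally show ?thesis .
  next
    case False
    have "\<bar>u z\<bar> \<le> \<bar>B\<bar>" using B[of z] False z by simp
    also have "\<dots> = \<bar>B\<bar> / S e * S e" using S_pos[OF eI] by simp
    also have "\<dots> \<le> \<bar>B\<bar> / S e * S z"
    proof (rule mult_left_mono)
      show "S e \<le> S z"
        using S_eq[OF eI] S_eq[of z] s_le[of e z] Ioc_base_I[OF z] False e by simp
      show "0 \<le> \<bar>B\<bar> / S e" using S_pos[OF eI] by simp
    qed
    also have "\<dots> \<le> max 2 (\<bar>B\<bar> / S e) * S z" by (intro mult_right_mono S_nonneg) simp
    finally show ?thesis .
  qed
  then show ?thesis by blast
qed

text \<open>The equation bounds the oscillation of w = du/ds by integrals of |u|, w tends to 1 at 0,
  and the mean value inequality bounds u by S times a bound for w. Thus |u|/S satisfies a Gronwall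
  inequality with respect to S dm, whose mass on (0,y] is \<open>near0_mass y\<close>.\<close>

theorem psi_le_exp:
  assumes psi: "is_psi b s m l u" and y: "0 < y" "y \<le> base"
  shows "\<bar>u y\<bar> \<le> S y * exp (2 * \<bar>l\<bar> * near0_mass y)"
proof -
  have [measurable]: "u \<in> borel_measurable borel" by (rule psi_borel[OF psi])
  obtain K where K: "\<And>z. z \<in> {0<..base} \<Longrightarrow> \<bar>u z\<bar> \<le> K * S z" using psi_le_linear[OF psi] by blast
  obtain w where w: "\<And>x. x \<in> I \<Longrightarrow> has_scale_deriv s u (w x) x"
    and wd: "\<And>x y. 0 < x \<Longrightarrow> x < y \<Longrightarrow> ereal y < b \<Longrightarrow> w y - w x = (LINT z:{x<..y}|m. l * u z)"
    using psi unfolding is_psi_def dmds_def by auto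
  have u0: "u 0 = 0" using psi by (simp add: is_psi_def)
  have int_c: "integrable m (\<lambda>z. indicator {0<..base} z * \<bar>u z\<bar>)"
  proof (rule Bochner_Integration.integrable_bound)
    show "integrable m (\<lambda>z. K * (indicator {0<..base} z * S z))" using base(2) by simp
    show "AE z in m. norm (indicator {0<..base} z * \<bar>u z\<bar>) \<le> norm (K * (indicator {0<..base} z * S z))"
      using K by (intro AE_I2) (auto simp: indicator_def intro: order_trans[OF K abs_ge_self])
  qed simp
  have int: "integrable m (\<lambda>z. indicator B z * \<bar>u z\<bar>)" if "B \<in> sets borel" "B \<subseteq> {0<..base}" for B
  proof -
    have "integrable m (\<lambda>z. indicator B z * (indicator {0<..base} z * \<bar>u z\<bar>))"
      using integrable_mult_indicator[OF _ int_c, of B] that by simp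
    moreover have "(\<lambda>z. indicator B z * (indicator {0<..base} z * \<bar>u z\<bar>)) = (\<lambda>z. indicator B z * \<bar>u z\<bar>)"
      using that by (auto simp: indicator_def fun_eq_iff)
    ultimately show ?thesis by (simp only:)
  qed
  define J where "J B = (\<integral>z. indicator B z * \<bar>u z\<bar> \<partial>m)" for B
  have J_mono: "J B \<le> J B'" if "B \<in> sets borel" "B' \<in> sets borel" "B \<subseteq> B'" "B' \<subseteq> {0<..base}" for B B'
    unfolding J_def using that by (intro integral_mono int) (auto simp: indicator_def)
  have w_diff: "\<bar>w z - w x\<bar> \<le> \<bar>l\<bar> * J {x<..z}" if xz: "0 < x" "x < z" "z \<le> base" for x z
  proof -
    have "w z - w x = (\<integral>t. indicator {x<..z} t * (l * u t) \<partial>m)"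
      using wd[of x z] xz Ioc_base_I[of z] by (simp add: set_lebesgue_integral_def mult.left_commute[of _ l])
    also have "\<bar>\<dots>\<bar> \<le> (\<integral>t. \<bar>indicator {x<..z} t * (l * u t)\<bar> \<partial>m)" by (rule integral_abs_bound)
    also have "\<dots> = (\<integral>t. \<bar>l\<bar> * (indicator {x<..z} t * \<bar>u t\<bar>) \<partial>m)"
      by (simp add: abs_mult ac_simps)
    finally show ?thesis by (simp add: J_def)
  qed
  have hyps: "continuous_on {0..y} s" "strict_mono_on {0..y} s" "continuous_on {0..y} u" if "y \<in> {0<..base}" for y
  proof -
    have yb: "ereal y < b" using Ioc_base_I[OF that] by simp
    show "continuous_on {0..y} s" "strict_mono_on {0..y} s" using s_cont_Icc s_strict_mono yb by auto
    have "continuous_on {x. 0 \<le> x \<and> ereal x < b} u" using psi by (simp add: is_psi_def)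
    then show "continuous_on {0..y} u"
      by (rule continuous_on_subset) (use yb ereal_less_b in auto)
  qed
  have ratio_w: "\<bar>u y / (s y - s 0) - w y\<bar> \<le> \<bar>l\<bar> * J {0<..y}" if y: "y \<in> {0<..base}" for y
  proof -
    have "\<bar>w z - w y\<bar> \<le> \<bar>l\<bar> * J {0<..y}" if z: "0 < z" "z < y" for z
    proof -
      have "\<bar>w z - w y\<bar> \<le> \<bar>l\<bar> * J {z<..y}" using w_diff[of z y] z y by (simp add: abs_minus_commute)
      also have "\<dots> \<le> \<bar>l\<bar> * J {0<..y}" using z y by (intro mult_left_mono J_mono) auto
      finally show ?thesis .
    qed
    then have "\<bar>u y - u 0 - w y * (s y - s 0)\<bar> \<le> (\<bar>l\<bar> * J {0<..y}) * (s y - s 0)"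
      using y by (intro scale_deriv_mean_value[OF _ hyps, where w = w]) (auto intro!: w[OF Ioc_base_I])
    then show ?thesis using s_pos[OF Ioc_base_I[OF y]] u0 by (simp add: abs_le_iff field_simps)
  qed
  have J0: "((\<lambda>y. \<bar>l\<bar> * J {0<..y}) \<longlongrightarrow> \<bar>l\<bar> * 0) (at_right 0)"
  proof (rule tendsto_mult[OF tendsto_const])
    have "((\<lambda>y. \<integral>z. indicator {0<..y} z * (indicator {0<..base} z * \<bar>u z\<bar>) \<partial>m) \<longlongrightarrow> 0) (at_right 0)"
      by (rule integral_indicator_tendsto_0[OF sets_m int_c])
    moreover have "\<forall>\<^sub>F y in at_right 0. (\<integral>z. indicator {0<..y} z * (indicator {0<..base} z * \<bar>u z\<bar>) \<partial>m) = J {0<..y}"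
      using eventually_at_right_real[OF base_pos]
    proof eventually_elim
      case (elim y)
      then show ?case unfolding J_def
        by (intro Bochner_Integration.integral_cong) (auto simp: indicator_def)
    qed
    ultimately show "((\<lambda>y. J {0<..y}) \<longlongrightarrow> 0) (at_right 0)" by (rule Lim_transform_eventually)
  qed
  \<comment> \<open>The scale derivative at 0 is prescribed, but not its continuity there. So
    \<open>w x\<close> is compared with the difference quotient from 0, which tends to 1, with an
    error \<open>\<bar>l\<bar> * J {0<..x}\<close> that tends to 0.\<close>
  have w_le: "\<bar>w y\<bar> \<le> 1 + \<bar>l\<bar> * J {0<..y}" if y: "y \<in> {0<..base}" for y
  proof (rule tendsto_lowerbound)
    show "((\<lambda>x. \<bar>u x / (s x - s 0)\<bar> + \<bar>l\<bar> * J {0<..x} + \<bar>l\<bar> * J {0<..y}) \<longlongrightarrow> 1 + \<bar>l\<bar> * J {0<..y}) (at_right 0)"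
      using tendsto_add[OF tendsto_add[OF tendsto_rabs[OF psi_ratio[OF psi]] J0] tendsto_const[of "\<bar>l\<bar> * J {0<..y}"]]
      by simp
    have "0 < y" using y by simp
    from eventually_at_right_real[OF this]
    show "\<forall>\<^sub>F x in at_right 0. \<bar>w y\<bar> \<le> \<bar>u x / (s x - s 0)\<bar> + \<bar>l\<bar> * J {0<..x} + \<bar>l\<bar> * J {0<..y}"
    proof eventually_elim
      case (elim x)
      have "\<bar>w y - w x\<bar> \<le> \<bar>l\<bar> * J {x<..y}" using w_diff[of x y] elim y by simp
      also have "\<dots> \<le> \<bar>l\<bar> * J {0<..y}" using elim y by (intro mult_left_mono J_mono) auto
      finally have "\<bar>w y - w x\<bar> \<le> \<bar>l\<bar> * J {0<..y}" .
      moreover have "\<bar>u x / (s x - s 0) - w x\<bar> \<le> \<bar>l\<bar> * J {0<..x}" using ratio_w[of x] elim y by simp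
      ultimately show ?case by linarith
    qed
  qed (simp add: trivial_limit_at_right_real)
  \<comment> \<open>Only derivatives at points strictly before \<open>y\<close> enter the mean value
    inequality, so an atom at \<open>y\<close> does not contribute. This is the open-interval form
    that \<open>Gronwall_measure\<close> expects.\<close>
  have u_le: "\<bar>u y\<bar> \<le> S y * (1 + \<bar>l\<bar> * J {0<..<y})" if y: "y \<in> {0<..base}" for y
  proof -
    have "\<bar>w z - 0\<bar> \<le> 1 + \<bar>l\<bar> * J {0<..<y}" if z: "0 < z" "z < y" for z
    proof -
      have "\<bar>w z\<bar> \<le> 1 + \<bar>l\<bar> * J {0<..z}" using w_le[of z] z y by simp
      also have "\<bar>l\<bar> * J {0<..z} \<le> \<bar>l\<bar> * J {0<..<y}" using z y by (intro mult_left_mono J_mono) auto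
      finally show ?thesis by simp
    qed
    then have "\<bar>u y - u 0 - 0 * (s y - s 0)\<bar> \<le> (1 + \<bar>l\<bar> * J {0<..<y}) * (s y - s 0)"
      using y by (intro scale_deriv_mean_value[OF _ hyps, where w = w]) (auto intro!: w[OF Ioc_base_I])
    then show ?thesis using u0 S_eq[OF Ioc_base_I[OF y]] by (simp add: mult.commute)
  qed
  define \<kappa> where "\<kappa> = density m (\<lambda>z. ennreal (indicator {0<..base} z * S z))"
  define q where "q z = indicator {0<..base} z * (\<bar>u z\<bar> / S z)" for z
  have [measurable]: "q \<in> borel_measurable borel" unfolding q_def by measurable
  have wt: "0 \<le> indicator {0<..base} z * S z" for z using S_nonneg by simp
  have q_eq: "indicator {0<..base} z * S z * (indicator B z * q z) = indicator (B \<inter> {0<..base}) z * \<bar>u z\<bar>" for z B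
    using S_pos[OF Ioc_base_I[of z]] by (auto simp: indicator_def q_def)
  have meas: "measure \<kappa> {0<..y} = near0_mass y" if "0 < y" "y \<le> base" for y
  proof -
    have ii: "integrable m (\<lambda>z. indicator {0<..y} z * S z)"
    proof -
      have "integrable m (\<lambda>z. indicator {0<..y} z * (indicator {0<..base} z * S z))"
        using integrable_mult_indicator[OF _ base(2), of "{0<..y}"] by simp
      moreover have "(\<lambda>z. indicator {0<..y} z * (indicator {0<..base} z * S z)) = (\<lambda>z. indicator {0<..y} z * S z)"
        using that by (auto simp: indicator_def fun_eq_iff)
      ultimately show ?thesis by (simp only:)
    qed
    have "emeasure \<kappa> {0<..y} = (\<integral>\<^sup>+z. ennreal (indicator {0<..y} z * S z) \<partial>m)"
      unfolding \<kappa>_def using that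
      by (subst emeasure_density) (auto intro!: nn_integral_cong simp: indicator_def)
    also have "\<dots> = ennreal (near0_mass y)"
      unfolding near0_mass_def using S_nonneg by (intro nn_integral_eq_integral ii) auto
    finally show ?thesis
      using S_nonneg by (simp add: measure_def near0_mass_def Bochner_Integration.integral_nonneg)
  qed
  have fin: "finite_measure \<kappa>"
  proof (rule finite_measureI)
    have "emeasure \<kappa> (space \<kappa>) = (\<integral>\<^sup>+z. ennreal (indicator {0<..base} z * S z) \<partial>m)"
      unfolding \<kappa>_def by (subst emeasure_density) auto
    also have "\<dots> = ennreal (\<integral>z. indicator {0<..base} z * S z \<partial>m)"
      using wt by (intro nn_integral_eq_integral base(2)) auto
    finally show "emeasure \<kappa> (space \<kappa>) \<noteq> \<infinity>" by simp
  qed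
  have J_q: "(\<integral>z. indicator {0<..<y} z * q z \<partial>\<kappa>) = J {0<..<y}" if "y \<le> base" for y
  proof -
    have "(\<integral>z. indicator {0<..<y} z * q z \<partial>\<kappa>) = (\<integral>z. indicator ({0<..<y} \<inter> {0<..base}) z * \<bar>u z\<bar> \<partial>m)"
      unfolding \<kappa>_def using wt by (subst integral_density) (auto simp: q_eq[symmetric])
    also have "{0<..<y} \<inter> {0<..base} = {0<..<y}" using that by auto
    finally show ?thesis by (simp add: J_def)
  qed
  have "q y \<le> exp (2 * \<bar>l\<bar> * measure \<kappa> {0<..y})"
  proof (rule Gronwall_measure[OF fin _ _ _ _ _ y])
    show "sets \<kappa> = sets borel" by (simp add: \<kappa>_def)
    have "integrable m (\<lambda>z. (indicator {0<..base} z * S z) *\<^sub>R q z)"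
    proof -
      have "(\<lambda>z. (indicator {0<..base} z * S z) *\<^sub>R q z) = (\<lambda>z. indicator {0<..base} z * \<bar>u z\<bar>)"
        by (rule ext) (use q_eq[of _ UNIV] in simp)
      then show ?thesis using int_c by (simp only:)
    qed
    then show "integrable \<kappa> q"
      unfolding \<kappa>_def using wt by (subst integrable_density) auto
    show "0 \<le> q z" for z using S_nonneg[of z] by (simp add: q_def)
    show "q z \<le> 1 + \<bar>l\<bar> * (\<integral>t. indicator {0<..<z} t * q t \<partial>\<kappa>)" if z: "0 < z" "z \<le> base" for z
      using u_le[of z] S_pos[OF Ioc_base_I[of z]] z J_q[of z] by (simp add: q_def field_simps)
  qed simp
  then have "\<bar>u y\<bar> / S y \<le> exp (2 * \<bar>l\<bar> * near0_mass y)" using y meas[OF y] by (simp add: q_def)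
  then show ?thesis using S_pos[OF Ioc_base_I[of y]] y by (simp add: field_simps)
qed

end

section \<open>The spectral transform and its adjoint\<close>

text \<open>Collects the analytic side of the hypotheses; paths and probabilities enter only with
  \<open>spectral_diffusion\<close>.\<close>

locale spectral_scale = accessible_scale +
  fixes \<psi> :: "real \<Rightarrow> real \<Rightarrow> real" and \<sigma> :: "real measure"
  assumes psi: "\<And>l. is_psi b s m l (\<psi> l)"
    and sets_\<sigma> [simp, measurable_cong]: "sets \<sigma> = sets borel"
    and \<sigma>_neg: "emeasure \<sigma> {..<0} = 0"
    and Parseval: "\<And>h. L2_fun m h \<Longrightarrow> (\<exists>R\<in>interior_pts b. \<forall>x\<ge>R. h x = 0) \<Longrightarrow>
       (\<integral>\<^sup>+x. ennreal ((h x)\<^sup>2) \<partial>m) = (\<integral>\<^sup>+l. ennreal ((spectral_transform m \<psi> h l)\<^sup>2) \<partial>\<sigma>)"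
    and kernel_integrable: "\<And>t x y. 0 < t \<Longrightarrow> x \<in> interior_pts b \<Longrightarrow> y \<in> interior_pts b \<Longrightarrow>
       integrable \<sigma> (\<lambda>l. exp (- l * t) * \<psi> (- l) x * \<psi> (- l) y)"
    and laplace_\<sigma>: "\<And>t. 0 < t \<Longrightarrow> (\<integral>\<^sup>+l. ennreal (exp (- l * t)) \<partial>\<sigma>) < \<infinity>"
begin

section \<open>Joint measurability of the eigenfunctions and sigma-finiteness\<close>

lemma space_\<sigma> [simp]: "space \<sigma> = UNIV"
  using sets_eq_imp_space_eq[OF sets_\<sigma>] by simp

lemma laplace_pos_\<sigma>: "laplace_pos \<sigma>"
  using \<sigma>_neg laplace_\<sigma> by (auto simp: laplace_pos_def)

lemma AE_\<sigma>_nonneg: "AE l in \<sigma>. 0 \<le> l"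
  by (rule laplace_pos_AE_nonneg[OF laplace_pos_\<sigma>])

lemma psi_outside: "x \<notin> I \<Longrightarrow> \<psi> l x = 0"
  by (rule psi_zero[OF psi])

lemma psi_continuous: "continuous_on I (\<psi> l)"
  by (rule psi_cont[OF psi])

lemma psi_measurable_x [measurable]: "\<psi> l \<in> borel_measurable borel"
  by (rule psi_borel[OF psi])

text \<open>Measurability in the spectral variable comes from the integrability of the kernel: the
  products $\psi_{-l}(x)\psi_{-l}(y)$ are measurable, and $\psi_{-l}(y) > 0$ for small \<open>y\<close>.\<close>

lemma psi_measurable_l: "(\<lambda>l. \<psi> (- l) x) \<in> borel_measurable borel"
proof (cases "x \<in> I")
  case x: True
  have prod: "(\<lambda>l. \<psi> (- l) x * \<psi> (- l) y) \<in> borel_measurable borel" if x: "x \<in> I" and y: "y \<in> I" for x y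
  proof -
    have "(\<lambda>l. exp (- l * 1) * \<psi> (- l) x * \<psi> (- l) y) \<in> borel_measurable \<sigma>"
      using kernel_integrable[OF zero_less_one x y] by (rule borel_measurable_integrable)
    then have [measurable]: "(\<lambda>l. exp (- l * 1) * \<psi> (- l) x * \<psi> (- l) y) \<in> borel_measurable borel"
      using measurable_cong_sets[OF sets_\<sigma> refl] by blast
    have "(\<lambda>l. exp l * (exp (- l * 1) * \<psi> (- l) x * \<psi> (- l) y)) \<in> borel_measurable borel" by measurable
    also have "(\<lambda>l. exp l * (exp (- l * 1) * \<psi> (- l) x * \<psi> (- l) y)) = (\<lambda>l. \<psi> (- l) x * \<psi> (- l) y)"
      by (rule ext) (simp add: mult.assoc[symmetric] mult_exp_exp)
    finally show ?thesis .
  qed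
  define Y where "Y n = base / real (Suc n)" for n
  have Y_pos: "0 < Y n" for n using base_pos by (simp add: Y_def)
  have Y_I: "Y n \<in> I" for n
    by (rule I_downward[OF base(1) Y_pos]) (use base_pos in \<open>simp add: Y_def field_simps\<close>)
  have "(\<lambda>n. base * inverse (real (Suc n))) \<longlonglongrightarrow> base * 0"
    by (intro tendsto_mult tendsto_const LIMSEQ_inverse_real_of_nat)
  then have "Y \<longlonglongrightarrow> 0" by (simp add: Y_def[abs_def] divide_inverse)
  then have Y_lim: "filterlim Y (at_right 0) sequentially"
    using Y_pos by (intro tendsto_imp_filterlim_at_right) auto
  show ?thesis
  proof (rule borel_measurable_LIMSEQ_real)
    fix l :: real
    have "\<forall>\<^sub>F n in sequentially. 0 < \<psi> (- l) (Y n)"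
      using filterlim_iff[THEN iffD1, OF Y_lim] psi_eventually_pos[OF psi] by blast
    \<comment> \<open>The quotient uses products of two eigenfunctions only: the root of the square
      is \<open>\<psi> (- l) (Y n)\<close> itself as soon as this is positive.\<close>
    then have "\<forall>\<^sub>F n in sequentially. \<psi> (- l) x * \<psi> (- l) (Y n) / sqrt (\<psi> (- l) (Y n) * \<psi> (- l) (Y n)) = \<psi> (- l) x"
      by eventually_elim simp
    then show "(\<lambda>n. \<psi> (- l) x * \<psi> (- l) (Y n) / sqrt (\<psi> (- l) (Y n) * \<psi> (- l) (Y n))) \<longlonglongrightarrow> \<psi> (- l) x"
      by (rule tendsto_eventually)
  next
    fix n
    note [measurable] = prod[OF x Y_I[of n]] prod[OF Y_I[of n] Y_I[of n]]
    show "(\<lambda>l. \<psi> (- l) x * \<psi> (- l) (Y n) / sqrt (\<psi> (- l) (Y n) * \<psi> (- l) (Y n))) \<in> borel_measurable borel"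
      by measurable
  qed
qed (simp add: psi_outside)

text \<open>For fixed x measurability in l is known, so x is rounded to a grid and continuity in x
  gives the limit. Rounding up matters: it moves no point outside (0,b) into it, neither from the
  left of 0 nor from \<open>b\<close> onwards.\<close>

lemma psi_measurable_pair: "(\<lambda>p. \<psi> (- fst p) (snd p)) \<in> borel_measurable (borel \<Otimes>\<^sub>M borel)"
proof -
  define g where "g n x = real_of_int \<lceil>real (Suc n) * x\<rceil> / real (Suc n)" for n and x :: real
  show ?thesis
  proof (rule borel_measurable_LIMSEQ_real)
    fix n
    show "(\<lambda>p. \<psi> (- fst p) (g n (snd p))) \<in> borel_measurable (borel \<Otimes>\<^sub>M borel)"
      unfolding g_def
    proof (rule measurable_compose_countable[where f = "\<lambda>k p. \<psi> (- fst p) (real_of_int k / real (Suc n))"])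
      fix k :: int
      note [measurable] = psi_measurable_l[of "real_of_int k / real (Suc n)"]
      show "(\<lambda>p. \<psi> (- fst p) (real_of_int k / real (Suc n))) \<in> borel_measurable (borel \<Otimes>\<^sub>M borel)"
        using measurable_compose[OF measurable_fst psi_measurable_l] by simp
    qed measurable
  next
    fix p :: "real \<times> real"
    define l x where "l = fst p" and "x = snd p"
    have ge: "x \<le> g n x" for n
      using le_of_int_ceiling[of "real (Suc n) * x"] by (simp add: g_def field_simps)
    have le: "g n x \<le> x + inverse (real (Suc n))" for n
    proof -
      have "g n x \<le> (real (Suc n) * x + 1) / real (Suc n)"
        unfolding g_def by (intro divide_right_mono) linarith+
      also have "\<dots> = x + inverse (real (Suc n))"
        by (simp add: add_divide_distrib inverse_eq_divide del: of_nat_Suc)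
      finally show ?thesis .
    qed
    have lim: "(\<lambda>n. g n x) \<longlonglongrightarrow> x"
    proof (rule real_tendsto_sandwich[where f = "\<lambda>_. x" and h = "\<lambda>n. x + inverse (real (Suc n))"])
      show "(\<lambda>n. x + inverse (real (Suc n))) \<longlonglongrightarrow> x"
        using tendsto_add[OF tendsto_const LIMSEQ_inverse_real_of_nat, of x] by simp
    qed (use ge le in auto)
    show "(\<lambda>n. \<psi> (- fst p) (g n (snd p))) \<longlonglongrightarrow> \<psi> (- fst p) (snd p)"
    proof (cases "x \<in> I")
      case True
      then have "isCont (\<psi> (- l)) x"
        using psi_continuous I_open continuous_on_eq_continuous_at by blast
      from isCont_tendsto_compose[OF this lim] show ?thesis by (simp add: l_def x_def)
    next
      case False
      have "g n x \<notin> I" for n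
      proof (cases "x \<le> 0")
        case True
        then have "\<lceil>real (Suc n) * x\<rceil> \<le> 0" by (simp add: ceiling_le_zero mult_nonneg_nonpos)
        then have "g n x \<le> 0" by (simp add: g_def divide_nonpos_pos)
        then show ?thesis by simp
      next
        case x0: False
        then have "b \<le> ereal x" using False by (simp add: not_less)
        also have "ereal x \<le> ereal (g n x)" using ge by simp
        finally show ?thesis by (simp add: not_less)
      qed
      then have "\<psi> (- l) (g n x) = \<psi> (- l) x" for n using False psi_outside by metis
      then show ?thesis by (simp add: l_def x_def)
    qed
  qed
qed

lemma psi_measurable [measurable (raw)]:
  assumes [measurable]: "f \<in> borel_measurable N" "g \<in> borel_measurable N"
  shows "(\<lambda>z. \<psi> (- f z) (g z)) \<in> borel_measurable N"
proof -
  have "(\<lambda>z. (f z, g z)) \<in> N \<rightarrow>\<^sub>M borel \<Otimes>\<^sub>M borel" by measurable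
  from measurable_compose[OF this psi_measurable_pair] show ?thesis by simp
qed

lemma L2_exp: "0 < t \<Longrightarrow> L2_fun \<sigma> (\<lambda>l. exp (- l * t))"
  using laplace_pos_integrable[OF laplace_pos_\<sigma>, of "2 * t" 0]
  by (simp add: L2_fun_def exp_double[symmetric] ac_simps)

text \<open>The square is the integrand of the kernel at time 2t on the diagonal.\<close>

lemma L2_exp_psi: "0 < t \<Longrightarrow> L2_fun \<sigma> (\<lambda>l. exp (- l * t) * \<psi> (- l) x)"
proof (cases "x \<in> I")
  case True
  assume t: "0 < t"
  have "integrable \<sigma> (\<lambda>l. exp (- l * (2 * t)) * \<psi> (- l) x * \<psi> (- l) x)"
    using t True by (intro kernel_integrable) auto
  also have "(\<lambda>l. exp (- l * (2 * t)) * \<psi> (- l) x * \<psi> (- l) x) = (\<lambda>l. (exp (- l * t) * \<psi> (- l) x)\<^sup>2)"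
    by (rule ext) (simp add: power_mult_distrib power2_eq_square[of "\<psi> _ _"] exp_double[symmetric] ac_simps)
  finally show ?thesis by (simp add: L2_fun_def)
qed (simp add: psi_outside L2_fun_def)

text \<open>On [0,R] the exponential is at least exp(-R), so the cutoff is dominated by a multiple
  of the function in \<open>L2_exp_psi\<close> at t = 1.\<close>

lemma L2_indicator_psi: "L2_fun \<sigma> (\<lambda>l. indicator {0..R} l * \<psi> (- l) x)"
proof (rule L2_fun_bound)
  show "L2_fun \<sigma> (\<lambda>l. exp R * (exp (- l * 1) * \<psi> (- l) x))"
    by (intro L2_fun_cmult L2_exp_psi) simp
  show "AE l in \<sigma>. \<bar>indicator {0..R} l * \<psi> (- l) x\<bar> \<le> \<bar>exp R * (exp (- l * 1) * \<psi> (- l) x)\<bar>"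
  proof (rule AE_I2)
    fix l
    show "\<bar>indicator {0..R} l * \<psi> (- l) x\<bar> \<le> \<bar>exp R * (exp (- l * 1) * \<psi> (- l) x)\<bar>"
    proof (cases "l \<in> {0..R}")
      case True
      then have "1 * \<bar>\<psi> (- l) x\<bar> \<le> (exp R * exp (- l)) * \<bar>\<psi> (- l) x\<bar>"
        by (intro mult_right_mono) (auto simp: mult_exp_exp)
      then show ?thesis using True by (simp add: abs_mult mult.assoc)
    qed simp
  qed
qed measurable

lemma emeasure_\<sigma>_atMost: "emeasure \<sigma> {..R} < \<infinity>"
proof -
  have "emeasure \<sigma> {..R} = (\<integral>\<^sup>+l. indicator {..R} l \<partial>\<sigma>)" by simp
  also have "\<dots> \<le> (\<integral>\<^sup>+l. ennreal (exp R) * ennreal (exp (- l * 1)) \<partial>\<sigma>)"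
  proof (rule nn_integral_mono)
    fix l
    have "1 \<le> exp R * exp (- l)" if "l \<le> R" using that by (simp add: mult_exp_exp)
    then show "indicator {..R} l \<le> ennreal (exp R) * ennreal (exp (- l * 1))"
      by (auto simp: indicator_def ennreal_mult[symmetric])
  qed
  also have "\<dots> = ennreal (exp R) * (\<integral>\<^sup>+l. ennreal (exp (- l * 1)) \<partial>\<sigma>)"
    by (rule nn_integral_cmult) measurable
  also have "\<dots> < \<infinity>" using laplace_\<sigma>[of 1] by (simp add: ennreal_mult_less_top)
  finally show ?thesis .
qed

sublocale \<sigma>: sigma_finite_measure \<sigma>
proof
  show "\<exists>C. countable C \<and> C \<subseteq> sets \<sigma> \<and> \<Union>C = space \<sigma> \<and> (\<forall>a\<in>C. emeasure \<sigma> a \<noteq> \<infinity>)"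
  proof (intro exI[of _ "range (\<lambda>n::nat. {..real n})"] conjI)
    show "\<Union>(range (\<lambda>n::nat. {..real n})) = space \<sigma>"
      using real_arch_simple by auto
  qed (use emeasure_\<sigma>_atMost in \<open>auto simp: less_top\<close>)
qed

text \<open>\<open>m\<close> may be infinite near both ends and Parseval's identity requires
  functions vanishing near \<open>b\<close>; compact subintervals avoid both ends.\<close>

definition exhaust :: "nat \<Rightarrow> real set"
  where "exhaust = (SOME exhaust. (\<forall>n. \<exists>x y. 0 < x \<and> y \<in> I \<and> exhaust n = {x..y}) \<and> incseq exhaust \<and> (\<Union>n. exhaust n) = I)"

lemma exhaust: "\<exists>x y. 0 < x \<and> y \<in> I \<and> exhaust n = {x..y}" "incseq exhaust" "(\<Union>n. exhaust n) = I"
proof -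
  obtain X :: "nat \<Rightarrow> real" where X: "incseq X" "\<And>i. 0 < ereal (X i)" "\<And>i. X i < b" "X \<longlonglongrightarrow> b"
    using ereal_incseq_approx[OF b_pos] by metis
  define a where "a n = inverse (real (Suc n))" for n
  have a: "0 < a n" "a (Suc n) \<le> a n" for n by (auto simp: a_def)
  have "(\<forall>n. \<exists>x y. 0 < x \<and> y \<in> I \<and> {a n..X n} = {x..y}) \<and> incseq (\<lambda>n. {a n..X n}) \<and> (\<Union>n. {a n..X n}) = I"
  proof (intro conjI allI)
    show "\<exists>x y. 0 < x \<and> y \<in> I \<and> {a n..X n} = {x..y}" for n
      using a(1)[of n] X(2,3)[of n] by (intro exI[of _ "a n"] exI[of _ "X n"]) auto
    show "incseq (\<lambda>n. {a n..X n})"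
    proof (rule incseq_SucI)
      fix n show "{a n..X n} \<subseteq> {a (Suc n)..X (Suc n)}"
        using a(2)[of n] incseq_SucD[OF X(1), of n] by auto
    qed
    show "(\<Union>n. {a n..X n}) = I"
    proof (intro equalityI subsetI)
      fix x assume "x \<in> (\<Union>n. {a n..X n})"
      then obtain n where "a n \<le> x" "x \<le> X n" by auto
      then show "x \<in> I" using a(1)[of n] X(3)[of n] ereal_less_b[of x "X n"] by auto
    next
      fix x assume x: "x \<in> I"
      have "\<forall>\<^sub>F n in sequentially. ereal x < ereal (X n)" using X(4) x by (intro order_tendstoD) auto
      moreover have "\<forall>\<^sub>F n in sequentially. a n < x"
        unfolding a_def using LIMSEQ_inverse_real_of_nat x by (intro order_tendstoD(2)) auto
      ultimately have "\<forall>\<^sub>F n in sequentially. x \<in> {a n..X n}" by eventually_elim auto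
      then obtain n where "x \<in> {a n..X n}" by (auto simp: eventually_sequentially)
      then show "x \<in> (\<Union>n. {a n..X n})" by blast
    qed
  qed
  then have "(\<forall>n. \<exists>x y. 0 < x \<and> y \<in> I \<and> exhaust n = {x..y}) \<and> incseq exhaust \<and> (\<Union>n. exhaust n) = I"
    unfolding exhaust_def
    by (rule someI[of "\<lambda>exhaust. (\<forall>n. \<exists>x y. 0 < x \<and> y \<in> I \<and> exhaust n = {x..y}) \<and> incseq exhaust \<and> (\<Union>n. exhaust n) = I"])
  then show "\<exists>x y. 0 < x \<and> y \<in> I \<and> exhaust n = {x..y}" "incseq exhaust" "(\<Union>n. exhaust n) = I" by blast+
qed

lemma exhaust_borel [measurable, simp]: "exhaust n \<in> sets borel"
  using exhaust(1)[of n] by auto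

lemma exhaust_finite: "emeasure m (exhaust n) < \<infinity>"
  using exhaust(1)[of n] emeasure_m_Icc by auto

lemma exhaust_eventually: "x \<in> I \<Longrightarrow> \<forall>\<^sub>F n in sequentially. x \<in> exhaust n"
proof -
  assume "x \<in> I"
  then obtain n where "x \<in> exhaust n" using exhaust(3) by blast
  then have "x \<in> exhaust k" if "n \<le> k" for k using monoD[OF exhaust(2) that] by auto
  then show ?thesis by (auto simp: eventually_sequentially)
qed

sublocale m: sigma_finite_measure m
proof
  show "\<exists>C. countable C \<and> C \<subseteq> sets m \<and> \<Union>C = space m \<and> (\<forall>a\<in>C. emeasure m a \<noteq> \<infinity>)"
  proof (intro exI[of _ "insert (- I) (range exhaust)"] conjI)
    show "\<Union>(insert (- I) (range exhaust)) = space m" using exhaust(3) by auto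
    have "emeasure m (- I) = 0" using speed by (simp add: speed_measure_def)
    then show "\<forall>a\<in>insert (- I) (range exhaust). emeasure m a \<noteq> \<infinity>"
      using exhaust_finite by (auto simp: less_top)
  qed auto
qed

sublocale m\<sigma>: pair_sigma_finite m \<sigma> ..

definition adj :: "(real \<Rightarrow> real) \<Rightarrow> real \<Rightarrow> real"
  where "adj G x = (\<integral>l. G l * \<psi> (- l) x \<partial>\<sigma>)"

abbreviation hat :: "(real \<Rightarrow> real) \<Rightarrow> real \<Rightarrow> real"
  where "hat \<equiv> spectral_transform m \<psi>"

text \<open>The square-integrable functions for which \<open>adj\<close> is an absolutely convergent
  integral at every point, rather than the default value 0. Every point is required because the
  hitting density is identified for each starting point.\<close>

definition admissible :: "(real \<Rightarrow> real) \<Rightarrow> bool"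
  where "admissible G \<longleftrightarrow> L2_fun \<sigma> G \<and> (\<forall>x. integrable \<sigma> (\<lambda>l. G l * \<psi> (- l) x))"

lemma adj_outside: "x \<notin> I \<Longrightarrow> adj G x = 0"
  by (simp add: adj_def psi_outside)

lemma adj_measurable: "G \<in> borel_measurable borel \<Longrightarrow> adj G \<in> borel_measurable borel"
proof -
  assume [measurable]: "G \<in> borel_measurable borel"
  show ?thesis unfolding adj_def by measurable
qed

lemma L2_\<sigma>_measurable: "L2_fun \<sigma> G \<Longrightarrow> G \<in> borel_measurable borel"
  unfolding L2_fun_def using measurable_cong_sets[OF sets_\<sigma> refl] by blast

lemma L2_m_measurable: "L2_fun m G \<Longrightarrow> G \<in> borel_measurable borel"
  unfolding L2_fun_def using measurable_cong_sets[OF sets_m refl] by blast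

lemma hat_measurable: "h \<in> borel_measurable borel \<Longrightarrow> hat h \<in> borel_measurable borel"
proof -
  assume [measurable]: "h \<in> borel_measurable borel"
  show ?thesis unfolding spectral_transform_def by measurable
qed

lemma hat_Parseval:
  assumes h: "L2_fun m h" and R: "R \<in> I" "\<And>x. R < x \<Longrightarrow> h x = 0"
  shows "L2_fun \<sigma> (hat h)" and "(\<integral>l. (hat h l)\<^sup>2 \<partial>\<sigma>) = (\<integral>x. (h x)\<^sup>2 \<partial>m)"
proof -
  note [measurable] = hat_measurable[OF L2_m_measurable[OF h]]
  \<comment> \<open>The hypothesis allows a nonzero value at \<open>R\<close>, as for functions
    supported in a closed interval, whereas Parseval asks for zeros from some point on,
    inclusive.\<close>
  obtain R' where R': "R < R'" "ereal R' < b" using R(1) ereal_dense2[of "ereal R" b] by auto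
  then have "\<exists>R\<in>I. \<forall>x\<ge>R. h x = 0" using R by (intro bexI[of _ R']) auto
  from Parseval[OF h this] have eq: "(\<integral>\<^sup>+l. ennreal ((hat h l)\<^sup>2) \<partial>\<sigma>) = ennreal (\<integral>x. (h x)\<^sup>2 \<partial>m)"
    using h by (subst (asm) nn_integral_eq_integral) (auto simp: L2_fun_def)
  then have i: "integrable \<sigma> (\<lambda>l. (hat h l)\<^sup>2)"
    by (intro integrableI_bounded) auto
  then show "L2_fun \<sigma> (hat h)" by (simp add: L2_fun_def)
  show "(\<integral>l. (hat h l)\<^sup>2 \<partial>\<sigma>) = (\<integral>x. (h x)\<^sup>2 \<partial>m)"
    using eq by (simp add: nn_integral_eq_integral[OF i])
qed

lemma L2_indicator_m:
  assumes "0 < x" "y \<in> I"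
  shows "L2_fun m (indicator {x..y})"
proof -
  have "(\<lambda>z. (indicator {x..y} z :: real)\<^sup>2) = indicator {x..y}" by (auto simp: indicator_def)
  then show ?thesis using emeasure_m_Icc[OF assms] by (simp add: L2_fun_def less_top)
qed

lemma psi_bounded_Icc:
  assumes "0 < x" "y \<in> I"
  shows "\<exists>K. \<forall>z\<in>{x..y}. \<bar>\<psi> l z\<bar> \<le> K"
proof -
  have "continuous_on {x..y} (\<psi> l)"
    using assms by (intro continuous_on_subset[OF psi_continuous]) (auto intro: ereal_less_b)
  then have "bounded (\<psi> l ` {x..y})" by (intro compact_imp_bounded compact_continuous_image) auto
  then show ?thesis unfolding bounded_iff by (metis imageI real_norm_def)
qed

lemma L2_psi_Icc:
  assumes "0 < x" "y \<in> I"
  shows "L2_fun m (\<lambda>z. indicator {x..y} z * \<psi> l z)"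
proof -
  obtain K where K: "\<And>z. z \<in> {x..y} \<Longrightarrow> \<bar>\<psi> l z\<bar> \<le> K" using psi_bounded_Icc[OF assms] by blast
  show ?thesis
  proof (rule L2_fun_bound[OF L2_fun_cmult[OF L2_indicator_m[OF assms], of K]])
    show "AE z in m. \<bar>indicator {x..y} z * \<psi> l z\<bar> \<le> \<bar>K * indicator {x..y} z\<bar>"
      using K by (intro AE_I2) (auto simp: indicator_def intro: order_trans[OF K abs_ge_self])
  qed measurable
qed

lemma hat_integrable:
  assumes h: "L2_fun m h" and exhaust: "0 < x" "y \<in> I" "\<And>z. z \<notin> {x..y} \<Longrightarrow> h z = 0"
  shows "integrable m (\<lambda>z. h z * \<psi> l z)"
proof -
  have "integrable m (\<lambda>z. h z * (indicator {x..y} z * \<psi> l z))"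
    by (rule L2_fun_mult_integrable[OF h L2_psi_Icc[OF exhaust(1,2)]])
  moreover have "(\<lambda>z. h z * (indicator {x..y} z * \<psi> l z)) = (\<lambda>z. h z * \<psi> l z)"
    using exhaust(3) by (auto simp: indicator_def fun_eq_iff)
  ultimately show ?thesis by (simp only:)
qed

end

section \<open>The adjoint as a contraction dual to the transform\<close>

context spectral_scale
begin

text \<open>With bounded eigenfunctions and finite measures on both sides, the duality is Fubini's
  theorem; \<open>adj_hat\<close> later removes the bounds by truncation.\<close>

lemma adj_hat_bounded:
  assumes xy: "0 < x" "y \<in> I" and G: "L2_fun \<sigma> G"
    and K: "K \<in> sets borel" "emeasure \<sigma> K < \<infinity>" "\<And>l. l \<notin> K \<Longrightarrow> G l = 0"
    and bound: "\<And>l z. l \<in> K \<Longrightarrow> z \<in> {x..y} \<Longrightarrow> \<bar>\<psi> (- l) z\<bar> \<le> k"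
    and h: "L2_fun m h" "\<And>z. z \<notin> {x..y} \<Longrightarrow> h z = 0"
  shows "(\<integral>z. h z * adj G z \<partial>m) = (\<integral>l. G l * hat h l \<partial>\<sigma>)"
    and "integrable \<sigma> G"
proof -
  note [measurable] = L2_\<sigma>_measurable[OF G] L2_m_measurable[OF h(1)] K(1)
  have "L2_fun \<sigma> (indicator K)"
  proof -
    have "(\<lambda>z. (indicator K z :: real)\<^sup>2) = indicator K" by (auto simp: indicator_def)
    then show ?thesis using K(1,2) by (simp add: L2_fun_def less_top)
  qed
  from L2_fun_mult_integrable[OF this G]
  show Gi: "integrable \<sigma> G"
  proof -
    have "(\<lambda>l. indicator K l * G l) = G" using K(3) by (auto simp: indicator_def fun_eq_iff)
    then show ?thesis using \<open>integrable \<sigma> (\<lambda>l. indicator K l * G l)\<close> by (simp only:)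
  qed
  have hi: "integrable m h"
  proof -
    have "(\<lambda>z. indicator {x..y} z * h z) = h" using h(2) by (auto simp: indicator_def fun_eq_iff)
    then show ?thesis using L2_fun_mult_integrable[OF L2_indicator_m[OF xy] h(1)] by (simp only:)
  qed
  have dom: "integrable (m \<Otimes>\<^sub>M \<sigma>) (\<lambda>p. h (fst p) * (k * G (snd p)))"
  proof (rule m\<sigma>.Fubini_integrable)
    show "integrable m (\<lambda>z. \<integral>l. norm (h (fst (z, l)) * (k * G (snd (z, l)))) \<partial>\<sigma>)"
      using hi by (simp add: abs_mult mult.assoc[symmetric])
    show "AE z in m. integrable \<sigma> (\<lambda>l. h (fst (z, l)) * (k * G (snd (z, l))))"
      using Gi by auto
  qed measurable
  have int: "integrable (m \<Otimes>\<^sub>M \<sigma>) (\<lambda>(z, l). h z * (G l * \<psi> (- l) z))"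
  proof (rule Bochner_Integration.integrable_bound[OF dom])
    have "\<bar>h z * (G l * \<psi> (- l) z)\<bar> \<le> \<bar>h z * (k * G l)\<bar>" for z l
    proof (cases "z \<in> {x..y} \<and> l \<in> K")
      case True
      then have "\<bar>\<psi> (- l) z\<bar> \<le> \<bar>k\<bar>" using bound[of l z] by simp
      then have "(\<bar>h z\<bar> * \<bar>G l\<bar>) * \<bar>\<psi> (- l) z\<bar> \<le> (\<bar>h z\<bar> * \<bar>G l\<bar>) * \<bar>k\<bar>" by (intro mult_left_mono) auto
      then show ?thesis by (simp add: abs_mult ac_simps)
    next
      case False
      then show ?thesis using h(2)[of z] K(3)[of l] by auto
    qed
    then show "AE p in m \<Otimes>\<^sub>M \<sigma>. norm (case p of (z, l) \<Rightarrow> h z * (G l * \<psi> (- l) z)) \<le> norm (h (fst p) * (k * G (snd p)))"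
      by (intro AE_I2) (auto split: prod.split)
  qed measurable
  have "(\<integral>z. h z * adj G z \<partial>m) = (\<integral>z. (\<integral>l. h z * (G l * \<psi> (- l) z) \<partial>\<sigma>) \<partial>m)"
    by (simp add: adj_def)
  also have "\<dots> = (\<integral>l. (\<integral>z. h z * (G l * \<psi> (- l) z) \<partial>m) \<partial>\<sigma>)"
    by (rule m\<sigma>.Fubini_integral[OF int, symmetric])
  also have "\<dots> = (\<integral>l. G l * hat h l \<partial>\<sigma>)"
    by (simp add: spectral_transform_def mult.left_commute[of _ "G _"])
  finally show "(\<integral>z. h z * adj G z \<partial>m) = (\<integral>l. G l * hat h l \<partial>\<sigma>)" .
qed

text \<open>Duality tested against the adjoint itself: if N is its squared norm on the interval,
  then by Cauchy-Schwarz and Parseval N^2 is at most N times the squared norm of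
  \<open>G\<close>.\<close>

lemma adj_contraction_bounded:
  assumes xy: "0 < x" "y \<in> I" and G: "L2_fun \<sigma> G"
    and K: "K \<in> sets borel" "emeasure \<sigma> K < \<infinity>" "\<And>l. l \<notin> K \<Longrightarrow> G l = 0"
    and bound: "\<And>l z. l \<in> K \<Longrightarrow> z \<in> {x..y} \<Longrightarrow> \<bar>\<psi> (- l) z\<bar> \<le> k"
  defines "h \<equiv> \<lambda>z. indicator {x..y} z * adj G z"
  shows "L2_fun m h" and "(\<integral>z. (h z)\<^sup>2 \<partial>m) \<le> (\<integral>l. (G l)\<^sup>2 \<partial>\<sigma>)"
proof -
  note [measurable] = L2_\<sigma>_measurable[OF G] adj_measurable[OF L2_\<sigma>_measurable[OF G]]
  have Gi: "integrable \<sigma> G"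
    by (rule adj_hat_bounded(2)[OF xy G K bound, of "\<lambda>_. 0"]) (auto simp: L2_fun_def)
  define B where "B = k * (\<integral>l. \<bar>G l\<bar> \<partial>\<sigma>)"
  have B: "\<bar>adj G z\<bar> \<le> B" if z: "z \<in> {x..y}" for z
  proof -
    have le: "\<bar>G l * \<psi> (- l) z\<bar> \<le> k * \<bar>G l\<bar>" for l
    proof (cases "l \<in> K")
      case True
      have "\<bar>G l\<bar> * \<bar>\<psi> (- l) z\<bar> \<le> \<bar>G l\<bar> * k" using bound[OF True z] by (intro mult_left_mono) auto
      then show ?thesis by (simp add: abs_mult ac_simps)
    qed (simp add: K(3))
    have "integrable \<sigma> (\<lambda>l. k * \<bar>G l\<bar>)" using Gi by simp
    then have "integrable \<sigma> (\<lambda>l. G l * \<psi> (- l) z)"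
      by (rule Bochner_Integration.integrable_bound) (use le in \<open>auto intro!: AE_I2 order_trans[OF le abs_ge_self]\<close>)
    have "\<bar>adj G z\<bar> \<le> (\<integral>l. \<bar>G l * \<psi> (- l) z\<bar> \<partial>\<sigma>)" unfolding adj_def by (rule integral_abs_bound)
    also have "\<dots> \<le> (\<integral>l. k * \<bar>G l\<bar> \<partial>\<sigma>)"
      using \<open>integrable \<sigma> (\<lambda>l. G l * \<psi> (- l) z)\<close> \<open>integrable \<sigma> (\<lambda>l. k * \<bar>G l\<bar>)\<close> le
      by (intro integral_mono) auto
    finally show ?thesis by (simp add: B_def)
  qed
  show hL2: "L2_fun m h"
  proof (rule L2_fun_bound[OF L2_fun_cmult[OF L2_indicator_m[OF xy], of B]])
    show "AE z in m. \<bar>h z\<bar> \<le> \<bar>B * indicator {x..y} z\<bar>"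
      using B by (intro AE_I2) (auto simp: h_def indicator_def intro: order_trans[OF B abs_ge_self])
  qed (unfold h_def, measurable)
  define N where "N = (\<integral>z. (h z)\<^sup>2 \<partial>m)"
  have h0: "h z = 0" if "z \<notin> {x..y}" for z using that by (simp add: h_def)
  have hat: "L2_fun \<sigma> (hat h)" "(\<integral>l. (hat h l)\<^sup>2 \<partial>\<sigma>) = N"
    unfolding N_def using hat_Parseval[OF hL2 xy(2)] h0 by auto
  have "N = (\<integral>z. h z * adj G z \<partial>m)"
    unfolding N_def by (intro Bochner_Integration.integral_cong) (auto simp: h_def power2_eq_square indicator_def)
  also have "\<dots> = (\<integral>l. G l * hat h l \<partial>\<sigma>)"
    by (rule adj_hat_bounded(1)[OF xy G K bound hL2 h0])
  finally have "N\<^sup>2 \<le> (\<integral>l. (G l)\<^sup>2 \<partial>\<sigma>) * N"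
    using Cauchy_Schwarz_integral[OF G hat(1)] hat(2) by simp
  moreover have "0 \<le> N" by (simp add: N_def)
  ultimately have "N \<le> (\<integral>l. (G l)\<^sup>2 \<partial>\<sigma>)"
    by (cases "N = 0") (auto simp: power2_eq_square)
  then show "(\<integral>z. (h z)\<^sup>2 \<partial>m) \<le> (\<integral>l. (G l)\<^sup>2 \<partial>\<sigma>)" by (simp add: N_def)
qed

text \<open>\<open>psi_le_exp\<close> controls the eigenfunctions on (0,base] only. On a general
  compact interval these level sets of their supremum take the place of a bound uniform in
  l.\<close>

definition bd_set :: "real \<Rightarrow> real \<Rightarrow> nat \<Rightarrow> real set"
  where "bd_set x y k = {l. l \<le> real k \<and> (\<forall>z\<in>{x..y}. \<bar>\<psi> (- l) z\<bar> \<le> real k)}"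

text \<open>By continuity in z the condition on the whole interval reduces to a countable dense
  subset, where each condition is measurable in l.\<close>

lemma bd_set_borel:
  assumes "0 < x" "y \<in> I"
  shows "bd_set x y k \<in> sets borel"
proof -
  obtain D where D: "countable D" "D \<subseteq> {x..y}" "{x..y} \<subseteq> closure D"
    by (rule separable[of "{x..y}"]) blast
  have cl: "closure D = {x..y}"
    using D(2,3) closure_minimal[OF D(2) closed_atLeastAtMost] by blast
  have "bd_set x y k = {l. l \<le> real k \<and> (\<forall>z\<in>D. \<bar>\<psi> (- l) z\<bar> \<le> real k)}"
  proof -
    have "\<bar>\<psi> (- l) z\<bar> \<le> real k" if "\<forall>z\<in>D. \<bar>\<psi> (- l) z\<bar> \<le> real k" "z \<in> {x..y}" for l z
    proof (rule continuous_le_on_closure[of D "\<lambda>z. \<bar>\<psi> (- l) z\<bar>"])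
      have "{x..y} \<subseteq> I" using assms by (auto intro: ereal_less_b)
      then show "continuous_on (closure D) (\<lambda>z. \<bar>\<psi> (- l) z\<bar>)"
        unfolding cl by (intro continuous_intros continuous_on_subset[OF psi_continuous])
    qed (use that cl in auto)
    then show ?thesis using D(2) unfolding bd_set_def by blast
  qed
  also have "\<dots> = {..real k} \<inter> (\<Inter>z\<in>D. {l. \<bar>\<psi> (- l) z\<bar> \<le> real k}) " by auto
  also have "\<dots> \<in> sets borel"
  proof (cases "D = {}")
    case False
    have "{l. \<bar>\<psi> (- l) z\<bar> \<le> real k} \<in> sets borel" for z by measurable
    then have "(\<Inter>z\<in>D. {l. \<bar>\<psi> (- l) z\<bar> \<le> real k}) \<in> sets borel"
      using False D(1) by (intro sets.countable_INT') auto
    then show ?thesis by auto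
  qed simp
  finally show ?thesis .
qed

lemma bd_set_eventually:
  assumes "0 < x" "y \<in> I"
  shows "\<forall>\<^sub>F k in sequentially. l \<in> bd_set x y k"
proof -
  obtain B where B: "\<And>z. z \<in> {x..y} \<Longrightarrow> \<bar>\<psi> (- l) z\<bar> \<le> B" using psi_bounded_Icc[OF assms] by blast
  obtain n where n: "max l B \<le> real n" using real_arch_simple by blast
  have "l \<in> bd_set x y k" if "n \<le> k" for k
  proof -
    have "max l B \<le> real k" using n that by simp
    then have "l \<le> real k" "\<And>z. z \<in> {x..y} \<Longrightarrow> \<bar>\<psi> (- l) z\<bar> \<le> real k"
      using order_trans[OF B] by simp_all
    then show ?thesis by (simp add: bd_set_def)
  qed
  then show ?thesis by (auto simp: eventually_sequentially)
qed

lemma emeasure_bd_set: "0 < x \<Longrightarrow> y \<in> I \<Longrightarrow> emeasure \<sigma> (bd_set x y k) < \<infinity>"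
  by (rule le_less_trans[OF emeasure_mono[of _ "{..real k}"] emeasure_\<sigma>_atMost[of "real k"]])
    (auto simp: bd_set_def)

lemma L2_truncation_tendsto:
  assumes G: "L2_fun \<sigma> G" and B: "\<And>k. B k \<in> sets borel"
    and ev: "AE l in \<sigma>. \<forall>\<^sub>F k in sequentially. l \<in> B k"
  shows "(\<lambda>k. \<integral>l. (indicator (B k) l * G l - G l)\<^sup>2 \<partial>\<sigma>) \<longlonglongrightarrow> 0"
proof -
  note [measurable] = L2_\<sigma>_measurable[OF G] B
  have "(\<lambda>k. \<integral>l. (indicator (B k) l * G l - G l)\<^sup>2 \<partial>\<sigma>) \<longlonglongrightarrow> (\<integral>l. 0 \<partial>\<sigma>)"
  proof (rule integral_dominated_convergence[where w = "\<lambda>l. (G l)\<^sup>2"])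
    show "integrable \<sigma> (\<lambda>l. (G l)\<^sup>2)" using G by (simp add: L2_fun_def)
    show "AE l in \<sigma>. (\<lambda>k. (indicator (B k) l * G l - G l)\<^sup>2) \<longlonglongrightarrow> 0"
      using ev
    proof eventually_elim
      case (elim l)
      then have "\<forall>\<^sub>F k in sequentially. (indicator (B k) l * G l - G l)\<^sup>2 = 0"
        by eventually_elim simp
      then show ?case by (rule tendsto_eventually)
    qed
  qed (auto simp: indicator_def)
  then show ?thesis by simp
qed

lemma admissible_indicator:
  assumes "admissible G" "B \<in> sets borel"
  shows "admissible (\<lambda>l. indicator B l * G l)"
  using assms L2_fun_indicator[of \<sigma> G B] integrable_mult_indicator[of B \<sigma> "\<lambda>l. G l * \<psi> (- l) _"]
  by (auto simp: admissible_def mult.assoc)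

lemma admissible_diff: "admissible G \<Longrightarrow> admissible G' \<Longrightarrow> admissible (\<lambda>l. G l - G' l)"
  using L2_fun_diff by (auto simp: admissible_def left_diff_distrib)

lemma adj_diff: "admissible G \<Longrightarrow> admissible G' \<Longrightarrow> adj (\<lambda>l. G l - G' l) x = adj G x - adj G' x"
  by (simp add: admissible_def adj_def left_diff_distrib)

lemma adj_truncation_tendsto:
  assumes G: "admissible G" and B: "\<And>k. B k \<in> sets borel"
    and ev: "AE l in \<sigma>. \<forall>\<^sub>F k in sequentially. l \<in> B k"
  shows "(\<lambda>k. adj (\<lambda>l. indicator (B k) l * G l) z) \<longlonglongrightarrow> adj G z"
  unfolding adj_def
proof (rule integral_dominated_convergence[where w = "\<lambda>l. \<bar>G l * \<psi> (- l) z\<bar>"])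
  have [measurable]: "G \<in> borel_measurable borel"
    using G L2_\<sigma>_measurable by (auto simp: admissible_def)
  note [measurable] = B
  show "(\<lambda>l. G l * \<psi> (- l) z) \<in> borel_measurable \<sigma>"
    "(\<lambda>l. indicator (B k) l * G l * \<psi> (- l) z) \<in> borel_measurable \<sigma>" for k
    by measurable
  show "integrable \<sigma> (\<lambda>l. \<bar>G l * \<psi> (- l) z\<bar>)" using G by (simp add: admissible_def)
  show "AE l in \<sigma>. (\<lambda>k. indicator (B k) l * G l * \<psi> (- l) z) \<longlonglongrightarrow> G l * \<psi> (- l) z"
    using ev
  proof eventually_elim
    case (elim l)
    then have "\<forall>\<^sub>F k in sequentially. indicator (B k) l * G l * \<psi> (- l) z = G l * \<psi> (- l) z"
      by eventually_elim simp
    then show ?case by (rule tendsto_eventually)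
  qed
  show "AE l in \<sigma>. norm (indicator (B k) l * G l * \<psi> (- l) z) \<le> \<bar>G l * \<psi> (- l) z\<bar>" for k
    by (auto simp: indicator_def)
qed

text \<open>Truncating \<open>G\<close> to the sets \<open>bd_set x y k\<close> gives the bounded
  case, admissibility gives pointwise convergence of the adjoints, and Fatou's lemma transfers the
  norm bound.\<close>

lemma adj_contraction_Icc:
  assumes xy: "0 < x" "y \<in> I" and G: "admissible G"
  defines "h \<equiv> \<lambda>z. indicator {x..y} z * adj G z"
  shows "L2_fun m h" and "(\<integral>z. (h z)\<^sup>2 \<partial>m) \<le> (\<integral>l. (G l)\<^sup>2 \<partial>\<sigma>)"
proof -
  have GL2: "L2_fun \<sigma> G" using G by (simp add: admissible_def)
  define Gk where "Gk k l = indicator (bd_set x y k) l * G l" for k l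
  note bd = bd_set_borel[OF xy] emeasure_bd_set[OF xy]
  have Gk: "L2_fun \<sigma> (Gk k)" for k unfolding Gk_def using bd by (intro L2_fun_indicator[OF GL2]) auto
  have cases: "L2_fun m (\<lambda>z. indicator {x..y} z * adj (Gk k) z)"
    "(\<integral>z. (indicator {x..y} z * adj (Gk k) z)\<^sup>2 \<partial>m) \<le> (\<integral>l. (Gk k l)\<^sup>2 \<partial>\<sigma>)" for k
    by (rule adj_contraction_bounded[where K = "bd_set x y k" and k = "real k", OF xy Gk bd(1,2)]; simp add: Gk_def bd_set_def)+
  have le: "(\<integral>l. (Gk k l)\<^sup>2 \<partial>\<sigma>) \<le> (\<integral>l. (G l)\<^sup>2 \<partial>\<sigma>)" for k
    using Gk[of k] GL2 by (intro integral_mono) (auto simp: L2_fun_def Gk_def indicator_def)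
  have lim: "AE z in m. (\<lambda>k. indicator {x..y} z * adj (Gk k) z) \<longlonglongrightarrow> h z"
    unfolding h_def Gk_def
    by (intro AE_I2 tendsto_mult tendsto_const adj_truncation_tendsto[OF G] bd AE_I2 bd_set_eventually xy)
  have meas: "h \<in> borel_measurable m"
  proof -
    note [measurable] = adj_measurable[OF L2_\<sigma>_measurable[OF GL2]]
    show ?thesis unfolding h_def by measurable
  qed
  have ev: "\<forall>\<^sub>F k in sequentially. (\<integral>z. (indicator {x..y} z * adj (Gk k) z)\<^sup>2 \<partial>m) \<le> (\<integral>l. (G l)\<^sup>2 \<partial>\<sigma>)"
    using order_trans[OF cases(2) le] by simp
  show "L2_fun m h" "(\<integral>z. (h z)\<^sup>2 \<partial>m) \<le> (\<integral>l. (G l)\<^sup>2 \<partial>\<sigma>)"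
    by (rule L2_Fatou[OF cases(1) meas lim ev])+
qed

text \<open>Fatou's lemma again, now along the exhaustion of (0,b).\<close>

lemma adj_contraction:
  assumes G: "admissible G"
  shows "L2_fun m (adj G)" and "(\<integral>z. (adj G z)\<^sup>2 \<partial>m) \<le> (\<integral>l. (G l)\<^sup>2 \<partial>\<sigma>)"
proof -
  have Jn: "L2_fun m (\<lambda>z. indicator (exhaust n) z * adj G z) \<and>
    (\<integral>z. (indicator (exhaust n) z * adj G z)\<^sup>2 \<partial>m) \<le> (\<integral>l. (G l)\<^sup>2 \<partial>\<sigma>)" for n
  proof -
    obtain x y where xy: "0 < x" "y \<in> I" "exhaust n = {x..y}" using exhaust(1)[of n] by blast
    show ?thesis unfolding xy(3) using adj_contraction_Icc[OF xy(1,2) G] by blast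
  qed
  have lim: "AE z in m. (\<lambda>n. indicator (exhaust n) z * adj G z) \<longlonglongrightarrow> adj G z"
    using AE_m_I
  proof eventually_elim
    case (elim z)
    from exhaust_eventually[OF this] have "\<forall>\<^sub>F n in sequentially. indicator (exhaust n) z * adj G z = adj G z"
      by eventually_elim simp
    then show ?case by (rule tendsto_eventually)
  qed
  have meas: "adj G \<in> borel_measurable m"
    using adj_measurable[OF L2_\<sigma>_measurable] G by (simp add: admissible_def)
  have ev: "\<forall>\<^sub>F n in sequentially. (\<integral>z. (indicator (exhaust n) z * adj G z)\<^sup>2 \<partial>m) \<le> (\<integral>l. (G l)\<^sup>2 \<partial>\<sigma>)"
    using Jn by simp
  show "L2_fun m (adj G)" "(\<integral>z. (adj G z)\<^sup>2 \<partial>m) \<le> (\<integral>l. (G l)\<^sup>2 \<partial>\<sigma>)"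
    by (rule L2_Fatou[OF conjunct1[OF Jn] meas lim ev])+
qed

text \<open>Both sides are continuous in \<open>G\<close> with respect to the L^2 norm, the left one
  by the contraction property applied to differences, so the bounded case passes to the
  limit.\<close>

theorem adj_hat:
  assumes G: "admissible G" and xy: "0 < x" "y \<in> I"
    and h: "L2_fun m h" "\<And>z. z \<notin> {x..y} \<Longrightarrow> h z = 0"
  shows "(\<integral>z. h z * adj G z \<partial>m) = (\<integral>l. G l * hat h l \<partial>\<sigma>)"
proof -
  have GL2: "L2_fun \<sigma> G" using G by (simp add: admissible_def)
  have hatL2: "L2_fun \<sigma> (hat h)" using hat_Parseval(1)[OF h(1) xy(2)] h(2) by auto
  define Gk where "Gk k l = indicator (bd_set x y k) l * G l" for k l
  note bd = bd_set_borel[OF xy] emeasure_bd_set[OF xy]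
  have Gk: "admissible (Gk k)" for k unfolding Gk_def by (rule admissible_indicator[OF G bd(1)])
  then have GkL2: "L2_fun \<sigma> (Gk k)" for k by (simp add: admissible_def)
  have lim: "(\<lambda>k. \<integral>l. (Gk k l - G l)\<^sup>2 \<partial>\<sigma>) \<longlonglongrightarrow> 0"
    unfolding Gk_def by (intro L2_truncation_tendsto[OF GL2] bd AE_I2 bd_set_eventually xy)
  have "(\<lambda>k. \<integral>z. (adj (Gk k) z - adj G z)\<^sup>2 \<partial>m) \<longlonglongrightarrow> 0"
  proof (rule tendsto_sandwich[OF _ _ tendsto_const lim])
    show "\<forall>\<^sub>F k in sequentially. (\<integral>z. (adj (Gk k) z - adj G z)\<^sup>2 \<partial>m) \<le> (\<integral>l. (Gk k l - G l)\<^sup>2 \<partial>\<sigma>)"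
      using adj_contraction(2)[OF admissible_diff[OF Gk G]] by (simp add: adj_diff[OF Gk G])
  qed simp
  from L2_inner_tendsto[OF adj_contraction(1)[OF Gk] adj_contraction(1)[OF G] h(1) this]
  have "(\<lambda>k. \<integral>z. h z * adj (Gk k) z \<partial>m) \<longlonglongrightarrow> (\<integral>z. h z * adj G z \<partial>m)"
    by (simp add: mult.commute[of "h _"])
  moreover have "(\<integral>z. h z * adj (Gk k) z \<partial>m) = (\<integral>l. Gk k l * hat h l \<partial>\<sigma>)" for k
    by (rule adj_hat_bounded(1)[where K = "bd_set x y k" and k = "real k", OF xy GkL2 bd(1,2)])
       (use h in \<open>auto simp: Gk_def bd_set_def\<close>)
  ultimately have "(\<lambda>k. \<integral>l. Gk k l * hat h l \<partial>\<sigma>) \<longlonglongrightarrow> (\<integral>z. h z * adj G z \<partial>m)" by simp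
  moreover have "(\<lambda>k. \<integral>l. Gk k l * hat h l \<partial>\<sigma>) \<longlonglongrightarrow> (\<integral>l. G l * hat h l \<partial>\<sigma>)"
    by (rule L2_inner_tendsto[OF GkL2 GL2 hatL2 lim])
  ultimately show ?thesis by (rule LIMSEQ_unique)
qed

text \<open>The integral for the transform of \<eta> itself need not converge, so \<open>H\<close>
  is the L^2 limit of the transforms of its truncations, which form a Cauchy sequence by Parseval.
  The duality with admissible functions is the form in which \<open>H\<close> is used later.\<close>

theorem generalized_Fourier_transform:
  assumes \<eta>: "L2_fun m \<eta>"
  shows "\<exists>H. L2_fun \<sigma> H \<and> (\<integral>x. (\<eta> x)\<^sup>2 \<partial>m) = (\<integral>l. (H l)\<^sup>2 \<partial>\<sigma>) \<and>
    (\<forall>G. admissible G \<longrightarrow> (\<integral>x. adj G x * \<eta> x \<partial>m) = (\<integral>l. G l * H l \<partial>\<sigma>))"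
proof -
  note [measurable] = L2_m_measurable[OF \<eta>]
  define e where "e n x = indicator (exhaust n) x * \<eta> x" for n x
  have e: "L2_fun m (e n)" for n unfolding e_def by (rule L2_fun_indicator[OF \<eta>]) simp
  obtain a d where ad: "\<And>n. 0 < a n" "\<And>n. d n \<in> I" "\<And>n. exhaust n = {a n..d n}" using exhaust(1) by metis
  have e0: "x \<notin> {a n..d n} \<Longrightarrow> e n x = 0" for n x using ad(3) by (simp add: e_def)
  have ej0: "x \<notin> {a n..d n} \<Longrightarrow> e j x = 0" if "j \<le> n" for j n x
    using monoD[OF exhaust(2) that] ad(3) by (auto simp: e_def indicator_def)
  have lim_e: "(\<lambda>n. \<integral>x. (e n x - \<eta> x)\<^sup>2 \<partial>m) \<longlonglongrightarrow> 0"
  proof -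
    have "(\<lambda>n. \<integral>x. (e n x - \<eta> x)\<^sup>2 \<partial>m) \<longlonglongrightarrow> (\<integral>x. 0 \<partial>m)"
    proof (rule integral_dominated_convergence[where w = "\<lambda>x. (\<eta> x)\<^sup>2"])
      show "integrable m (\<lambda>x. (\<eta> x)\<^sup>2)" using \<eta> by (simp add: L2_fun_def)
      show "AE x in m. (\<lambda>n. (e n x - \<eta> x)\<^sup>2) \<longlonglongrightarrow> 0"
        using AE_m_I
      proof eventually_elim
        case (elim x)
        from exhaust_eventually[OF this] have "\<forall>\<^sub>F n in sequentially. (e n x - \<eta> x)\<^sup>2 = 0"
          by eventually_elim (simp add: e_def)
        then show ?case by (rule tendsto_eventually)
      qed
    qed (auto simp: e_def indicator_def)
    then show ?thesis by simp
  qed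
  have hatL2: "L2_fun \<sigma> (hat (e n))" for n
    using hat_Parseval(1)[OF e ad(2), of n n] e0 by auto
  \<comment> \<open>Parseval is applied to the difference; the larger index supplies one compact
    interval carrying both truncations.\<close>
  have hat_diff: "(\<integral>l. (hat (e i) l - hat (e j) l)\<^sup>2 \<partial>\<sigma>) = (\<integral>x. (e i x - e j x)\<^sup>2 \<partial>m)" for i j
  proof -
    let ?n = "max i j"
    have int: "integrable m (\<lambda>z. e k z * \<psi> l z)" if "k \<le> ?n" for k l
      by (rule hat_integrable[OF e ad(1,2)[of ?n]]) (rule ej0[OF that])
    have "hat (e i) l - hat (e j) l = hat (\<lambda>x. e i x - e j x) l" for l
      using int[of i] int[of j] by (simp add: spectral_transform_def left_diff_distrib)
    moreover have "(\<integral>l. (hat (\<lambda>x. e i x - e j x) l)\<^sup>2 \<partial>\<sigma>) = (\<integral>x. (e i x - e j x)\<^sup>2 \<partial>m)"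
      using ej0[of i ?n] ej0[of j ?n] by (intro hat_Parseval(2)[OF L2_fun_diff[OF e e] ad(2), of ?n]) auto
    ultimately show ?thesis by simp
  qed
  have "\<exists>H. L2_fun \<sigma> H \<and> (\<lambda>k. \<integral>l. (hat (e k) l - H l)\<^sup>2 \<partial>\<sigma>) \<longlonglongrightarrow> 0"
  proof (rule Riesz_Fischer_L2[OF hatL2])
    fix r :: real assume r: "0 < r"
    \<comment> \<open>A quarter, because the square of a sum is bounded by twice the sum of the
      squares and two such errors occur.\<close>
    then have "\<forall>\<^sub>F n in sequentially. (\<integral>x. (e n x - \<eta> x)\<^sup>2 \<partial>m) < r / 4"
      using lim_e by (intro order_tendstoD) auto
    then obtain N where N: "\<And>n. N \<le> n \<Longrightarrow> (\<integral>x. (e n x - \<eta> x)\<^sup>2 \<partial>m) < r / 4"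
      by (auto simp: eventually_sequentially)
    have "(\<integral>l. (hat (e i) l - hat (e j) l)\<^sup>2 \<partial>\<sigma>) \<le> r" if "N \<le> i" "N \<le> j" for i j
    proof -
      have "(\<integral>x. (e i x - e j x)\<^sup>2 \<partial>m) = (\<integral>x. ((e i x - \<eta> x) + (\<eta> x - e j x))\<^sup>2 \<partial>m)" by simp
      also have "\<dots> \<le> 2 * (\<integral>x. (e i x - \<eta> x)\<^sup>2 \<partial>m) + 2 * (\<integral>x. (\<eta> x - e j x)\<^sup>2 \<partial>m)"
        by (intro integral_sq_add_le L2_fun_diff e \<eta>)
      also have "(\<integral>x. (\<eta> x - e j x)\<^sup>2 \<partial>m) = (\<integral>x. (e j x - \<eta> x)\<^sup>2 \<partial>m)"
        by (simp add: power2_commute)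
      finally show ?thesis using N[OF that(1)] N[OF that(2)] by (simp add: hat_diff)
    qed
    then show "\<exists>N. \<forall>i\<ge>N. \<forall>j\<ge>N. (\<integral>l. (hat (e i) l - hat (e j) l)\<^sup>2 \<partial>\<sigma>) \<le> r" by blast
  qed
  then obtain H where H: "L2_fun \<sigma> H" "(\<lambda>k. \<integral>l. (hat (e k) l - H l)\<^sup>2 \<partial>\<sigma>) \<longlonglongrightarrow> 0" by blast
  have "(\<lambda>n. \<integral>x. (e n x)\<^sup>2 \<partial>m) \<longlonglongrightarrow> (\<integral>x. (\<eta> x)\<^sup>2 \<partial>m)" by (rule L2_norm_tendsto[OF e \<eta> lim_e])
  moreover have "(\<lambda>n. \<integral>l. (hat (e n) l)\<^sup>2 \<partial>\<sigma>) \<longlonglongrightarrow> (\<integral>l. (H l)\<^sup>2 \<partial>\<sigma>)" by (rule L2_norm_tendsto[OF hatL2 H])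
  moreover have "(\<integral>l. (hat (e n) l)\<^sup>2 \<partial>\<sigma>) = (\<integral>x. (e n x)\<^sup>2 \<partial>m)" for n
    using hat_Parseval(2)[OF e ad(2), of n n] e0 by auto
  ultimately have norm: "(\<integral>x. (\<eta> x)\<^sup>2 \<partial>m) = (\<integral>l. (H l)\<^sup>2 \<partial>\<sigma>)" by (simp add: LIMSEQ_unique)
  have "(\<integral>x. adj G x * \<eta> x \<partial>m) = (\<integral>l. G l * H l \<partial>\<sigma>)" if G: "admissible G" for G
  proof -
    have "(\<lambda>n. \<integral>x. e n x * adj G x \<partial>m) \<longlonglongrightarrow> (\<integral>x. \<eta> x * adj G x \<partial>m)"
      by (rule L2_inner_tendsto[OF e \<eta> adj_contraction(1)[OF G] lim_e])
    moreover have "(\<lambda>n. \<integral>l. hat (e n) l * G l \<partial>\<sigma>) \<longlonglongrightarrow> (\<integral>l. H l * G l \<partial>\<sigma>)"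
      using G by (intro L2_inner_tendsto[OF hatL2 H(1) _ H(2)]) (simp add: admissible_def)
    moreover have "(\<integral>x. e n x * adj G x \<partial>m) = (\<integral>l. hat (e n) l * G l \<partial>\<sigma>)" for n
      using adj_hat[OF G ad(1,2) e e0, of n n] by (simp add: mult.commute)
    ultimately show ?thesis by (simp add: LIMSEQ_unique mult.commute)
  qed
  with H(1) norm show ?thesis by blast
qed

section \<open>Recovering a function from the cutoffs of its transform\<close>

lemma admissible_cutoff:
  assumes H: "L2_fun \<sigma> H"
  shows "admissible (\<lambda>l. indicator {0..R} l * H l)"
proof -
  have "integrable \<sigma> (\<lambda>l. indicator {0..R} l * H l * \<psi> (- l) x)" for x
    using L2_fun_mult_integrable[OF H L2_indicator_psi[of R x]] by (simp add: ac_simps)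
  then show ?thesis using L2_fun_indicator[OF H, of "{0..R}"] by (simp add: admissible_def)
qed

text \<open>Expand the squared distance. By duality the mixed term is the squared norm of the cutoff
  of \<open>H\<close>, and by contraction the last term is no larger than that. What remains is the
  squared norm of the tail of \<open>H\<close>.\<close>

theorem adj_cutoff_tendsto:
  assumes \<eta>: "L2_fun m \<eta>" and H: "L2_fun \<sigma> H"
    and norm: "(\<integral>x. (\<eta> x)\<^sup>2 \<partial>m) = (\<integral>l. (H l)\<^sup>2 \<partial>\<sigma>)"
    and inner: "\<And>G. admissible G \<Longrightarrow> (\<integral>x. adj G x * \<eta> x \<partial>m) = (\<integral>l. G l * H l \<partial>\<sigma>)"
  shows "((\<lambda>R. \<integral>x. (\<eta> x - adj (\<lambda>l. indicator {0..R} l * H l) x)\<^sup>2 \<partial>m) \<longlongrightarrow> 0) at_top"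
proof (rule tendsto_at_topI_sequentially)
  fix R :: "nat \<Rightarrow> real" assume R: "filterlim R at_top sequentially"
  define HR where "HR n l = indicator {0..R n} l * H l" for n l
  have adm: "admissible (HR n)" for n unfolding HR_def by (rule admissible_cutoff[OF H])
  have HR: "L2_fun \<sigma> (HR n)" for n using adm by (simp add: admissible_def)
  have "(\<lambda>n. \<integral>l. (HR n l - H l)\<^sup>2 \<partial>\<sigma>) \<longlonglongrightarrow> 0"
    unfolding HR_def
  proof (rule L2_truncation_tendsto[OF H])
    show "AE l in \<sigma>. \<forall>\<^sub>F n in sequentially. l \<in> {0..R n}"
      using AE_\<sigma>_nonneg
    proof eventually_elim
      case (elim l)
      have "\<forall>\<^sub>F n in sequentially. l \<le> R n" using R by (simp add: filterlim_at_top)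
      then show ?case by eventually_elim (use elim in simp)
    qed
  qed simp
  from L2_norm_tendsto[OF HR H this]
  have "(\<lambda>n. (\<integral>l. (H l)\<^sup>2 \<partial>\<sigma>) - (\<integral>l. (HR n l)\<^sup>2 \<partial>\<sigma>)) \<longlonglongrightarrow> (\<integral>l. (H l)\<^sup>2 \<partial>\<sigma>) - (\<integral>l. (H l)\<^sup>2 \<partial>\<sigma>)"
    by (intro tendsto_intros)
  then have lim: "(\<lambda>n. (\<integral>l. (H l)\<^sup>2 \<partial>\<sigma>) - (\<integral>l. (HR n l)\<^sup>2 \<partial>\<sigma>)) \<longlonglongrightarrow> 0" by simp
  have le: "(\<integral>x. (\<eta> x - adj (HR n) x)\<^sup>2 \<partial>m) \<le> (\<integral>l. (H l)\<^sup>2 \<partial>\<sigma>) - (\<integral>l. (HR n l)\<^sup>2 \<partial>\<sigma>)" for n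
  proof -
    have "(\<integral>x. (\<eta> x - adj (HR n) x)\<^sup>2 \<partial>m)
        = (\<integral>x. (\<eta> x)\<^sup>2 - 2 * (adj (HR n) x * \<eta> x) + (adj (HR n) x)\<^sup>2 \<partial>m)"
      by (intro Bochner_Integration.integral_cong refl) (simp add: power2_diff algebra_simps)
    also have "\<dots> = (\<integral>x. (\<eta> x)\<^sup>2 \<partial>m) - 2 * (\<integral>x. adj (HR n) x * \<eta> x \<partial>m) + (\<integral>x. (adj (HR n) x)\<^sup>2 \<partial>m)"
      using \<eta> adj_contraction(1)[OF adm] L2_fun_mult_integrable[OF adj_contraction(1)[OF adm] \<eta>]
      by (simp add: L2_fun_def)
    also have "(\<integral>x. adj (HR n) x * \<eta> x \<partial>m) = (\<integral>l. HR n l * H l \<partial>\<sigma>)" by (rule inner[OF adm])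
    also have "\<dots> = (\<integral>l. (HR n l)\<^sup>2 \<partial>\<sigma>)"
      by (intro Bochner_Integration.integral_cong) (auto simp: HR_def indicator_def power2_eq_square)
    finally show ?thesis using norm adj_contraction(2)[OF adm, of n] by simp
  qed
  show "(\<lambda>n. \<integral>x. (\<eta> x - adj (\<lambda>l. indicator {0..R n} l * H l) x)\<^sup>2 \<partial>m) \<longlonglongrightarrow> 0"
    using tendsto_sandwich[OF _ _ tendsto_const lim, of "\<lambda>n. \<integral>x. (\<eta> x - adj (HR n) x)\<^sup>2 \<partial>m"] le
    by (simp add: HR_def[abs_def])
qed

lemma admissible_exp:
  assumes "0 < t"
  shows "admissible (\<lambda>l. exp (- l * t))"
proof -
  have "integrable \<sigma> (\<lambda>l. exp (- l * t) * \<psi> (- l) x)" for x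
  proof -
    \<comment> \<open>Half of the time goes into each factor: one is square-integrable by the
      Laplace transform of \<open>\<sigma>\<close>, the other by the kernel.\<close>
    have "integrable \<sigma> (\<lambda>l. exp (- l * (t / 2)) * (exp (- l * (t / 2)) * \<psi> (- l) x))"
      using assms by (intro L2_fun_mult_integrable L2_exp L2_exp_psi) auto
    then show ?thesis by (simp add: mult.assoc[symmetric] mult_exp_exp)
  qed
  then show ?thesis using L2_exp[OF assms] by (simp add: admissible_def)
qed

text \<open>The adjoint of this function at y is the transition density p(t,x,y).\<close>

lemma admissible_exp_psi:
  assumes "0 < t" and x: "x \<in> I"
  shows "admissible (\<lambda>l. exp (- l * t) * \<psi> (- l) x)"
proof -
  have "integrable \<sigma> (\<lambda>l. exp (- l * t) * \<psi> (- l) x * \<psi> (- l) y)" for y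
    using kernel_integrable[OF assms, of y] by (cases "y \<in> I") (auto simp: psi_outside)
  then show ?thesis using L2_exp_psi[OF assms(1)] by (simp add: admissible_def)
qed

end

section \<open>Test functions concentrating at the origin\<close>

context spectral_scale
begin

text \<open>The constant that makes \<open>bump p q * S\<close> a probability density with respect
  to \<open>m\<close>.\<close>

definition bump_mass :: "real \<Rightarrow> real \<Rightarrow> real" where "bump_mass p q = (\<integral>z. indicator {p..q} z * S z \<partial>m)"

definition bump :: "real \<Rightarrow> real \<Rightarrow> real \<Rightarrow> real" where "bump p q y = indicator {p..q} y / bump_mass p q"

text \<open>The solution v of (d/dm)(d/ds)v = \<open>bump p q\<close> that vanishes above
  \<open>q\<close>, written as the integral of the positive part of \<open>S z - S y\<close> against
  the bump. The normalisation gives v(0) = 1.\<close>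

definition potential :: "real \<Rightarrow> real \<Rightarrow> real \<Rightarrow> real"
  where "potential p q y = (\<integral>z. indicator ({p..q} \<inter> {y<..}) z * (S z - S y) \<partial>m) / bump_mass p q"

lemma S_mono: "0 \<le> x \<Longrightarrow> x \<le> y \<Longrightarrow> ereal y < b \<Longrightarrow> S x \<le> S y"
proof -
  assume *: "0 \<le> x" "x \<le> y" "ereal y < b"
  show "S x \<le> S y"
  proof (cases "x = 0")
    case True then show ?thesis using S_nonneg[of y] by (simp add: S_def)
  next
    case False
    then have "x \<in> I" "y \<in> I" using * ereal_less_b[of x y] by auto
    then show ?thesis using s_le[OF *] by (simp add: S_eq)
  qed
qed

lemma S_diff: "0 \<le> x \<Longrightarrow> x \<le> y \<Longrightarrow> ereal y < b \<Longrightarrow> S y - S x = s y - s x"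
  using S_eq[of x] S_eq[of y] ereal_less_b[of x y] by (cases "x = 0"; cases "y = 0") (auto simp: S_def)

context
  fixes p q :: real
  assumes pq: "0 < p" "p < q" "q \<le> base"
begin

lemma q_I: "q \<in> I" and q_less_b: "ereal q < b"
  using Ioc_base_I[of q] pq by auto

lemma Icc_I: "z \<in> {p..q} \<Longrightarrow> z \<in> I"
  using Ioc_base_I[of z] pq by auto

lemma integrable_Icc: "B \<in> sets borel \<Longrightarrow> integrable m (indicator ({p..q} \<inter> B) :: real \<Rightarrow> real)"
proof -
  assume B: "B \<in> sets borel"
  have "emeasure m ({p..q} \<inter> B) \<le> emeasure m {p..q}" using B by (intro emeasure_mono) auto
  also have "\<dots> < \<infinity>" by (rule emeasure_m_Icc[OF pq(1) q_I])
  finally show ?thesis using B by simp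
qed

lemma integrable_Icc_S: "B \<in> sets borel \<Longrightarrow> integrable m (\<lambda>z. indicator ({p..q} \<inter> B) z * S z)"
proof -
  assume B: "B \<in> sets borel"
  have "integrable m (\<lambda>z. indicator ({p..q} \<inter> B) z * (indicator {0<..base} z * S z))"
    using integrable_mult_indicator[OF _ base(2), of "{p..q} \<inter> B"] B by simp
  moreover have "(\<lambda>z. indicator ({p..q} \<inter> B) z * (indicator {0<..base} z * S z)) = (\<lambda>z. indicator ({p..q} \<inter> B) z * S z)"
    using pq by (auto simp: indicator_def fun_eq_iff)
  ultimately show ?thesis by (simp only:)
qed

lemma integrable_S: "integrable m (\<lambda>z. indicator {p..q} z * S z)"
  using integrable_Icc_S[of UNIV] by simp

lemma bump_mass_pos: "0 < bump_mass p q"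
proof -
  have "bump_mass p q \<noteq> 0"
  proof
    assume "bump_mass p q = 0"
    then have "AE z in m. indicator {p..q} z * S z = 0"
      unfolding bump_mass_def using integrable_S S_nonneg by (subst (asm) integral_nonneg_eq_0_iff_AE) auto
    then have "AE z in m. z \<notin> {p<..<q}"
    proof eventually_elim
      case (elim z)
      then show ?case using S_pos[OF Icc_I[of z]] by (auto simp: indicator_def)
    qed
    then have "emeasure m {p<..<q} = 0"
    proof (rule AE_iff_measurable[THEN iffD1, rotated 2])
      show "{z \<in> space m. \<not> z \<notin> {p<..<q}} = {p<..<q}" by auto
    qed simp
    then show False using emeasure_m_Ioo_pos[OF pq(1,2) q_I] by simp
  qed
  moreover have "0 \<le> bump_mass p q" unfolding bump_mass_def using S_nonneg by (intro Bochner_Integration.integral_nonneg) simp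
  ultimately show ?thesis by simp
qed

text \<open>Up to the factor \<open>- 1 / bump_mass p q\<close> this is the scale derivative of the
  potential.\<close>

definition bump_tail :: "real \<Rightarrow> real" where "bump_tail y = (\<integral>z. indicator ({p..q} \<inter> {y<..}) z \<partial>m)"

lemma bump_tail_nonneg: "0 \<le> bump_tail y"
  unfolding bump_tail_def by (intro Bochner_Integration.integral_nonneg) simp

lemma bump_tail_le_0: "0 \<le> y \<Longrightarrow> bump_tail y \<le> bump_tail 0"
  unfolding bump_tail_def by (intro integral_mono integrable_Icc) (auto simp: indicator_def)

lemma potential_integrable: "integrable m (\<lambda>z. indicator ({p..q} \<inter> {y<..}) z * (S z - S y))"
  using Bochner_Integration.integrable_diff[OF integrable_Icc_S[of "{y<..}"]
      integrable_mult_left[OF integrable_Icc[of "{y<..}"], of "S y"]]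
  by (simp add: right_diff_distrib)

text \<open>Convexity of the potential in the scale: its decrements lie between those given by the
  right slopes at the two endpoints, already for each integrand. Monotonicity, Lipschitz continuity
  and the scale derivative all follow from these two bounds.\<close>

lemma potential_diff_bounds:
  assumes y: "0 \<le> y" "y \<le> y'" "ereal y' < b"
  shows "(s y' - s y) * bump_tail y' \<le> bump_mass p q * (potential p q y - potential p q y')"
    and "bump_mass p q * (potential p q y - potential p q y') \<le> (s y' - s y) * bump_tail y"
proof -
  have "bump_mass p q * (potential p q y - potential p q y') = (\<integral>z. indicator ({p..q} \<inter> {y<..}) z * (S z - S y) \<partial>m)
      - (\<integral>z. indicator ({p..q} \<inter> {y'<..}) z * (S z - S y') \<partial>m)"
    using bump_mass_pos by (simp add: potential_def right_diff_distrib)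
  also have "\<dots> = (\<integral>z. indicator ({p..q} \<inter> {y<..}) z * (S z - S y) - indicator ({p..q} \<inter> {y'<..}) z * (S z - S y') \<partial>m)"
    by (intro Bochner_Integration.integral_diff[symmetric] potential_integrable)
  finally have eq: "bump_mass p q * (potential p q y - potential p q y')
      = (\<integral>z. indicator ({p..q} \<inter> {y<..}) z * (S z - S y) - indicator ({p..q} \<inter> {y'<..}) z * (S z - S y') \<partial>m)" .
  have int: "integrable m (\<lambda>z. indicator ({p..q} \<inter> {y<..}) z * (S z - S y) - indicator ({p..q} \<inter> {y'<..}) z * (S z - S y'))"
    by (intro Bochner_Integration.integrable_diff potential_integrable)
  have Sd: "S y' - S y = s y' - s y" by (rule S_diff[OF y])
  have G: "(s y' - s y) * bump_tail t = (\<integral>z. (S y' - S y) * indicator ({p..q} \<inter> {t<..}) z \<partial>m)" for t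
    unfolding Sd bump_tail_def by simp
  have iG: "integrable m (\<lambda>z. (S y' - S y) * indicator ({p..q} \<inter> {t<..}) z)" for t
    by (intro integrable_mult_right integrable_Icc) simp
  show "(s y' - s y) * bump_tail y' \<le> bump_mass p q * (potential p q y - potential p q y')"
    unfolding eq G
  proof (intro integral_mono int iG)
    fix z
    show "(S y' - S y) * indicator ({p..q} \<inter> {y'<..}) z
      \<le> indicator ({p..q} \<inter> {y<..}) z * (S z - S y) - indicator ({p..q} \<inter> {y'<..}) z * (S z - S y')"
      using y S_mono[of y z] Icc_I[of z] by (auto simp: indicator_def)
  qed
  show "bump_mass p q * (potential p q y - potential p q y') \<le> (s y' - s y) * bump_tail y"
    unfolding eq G
  proof (intro integral_mono int iG)
    fix z
    show "indicator ({p..q} \<inter> {y<..}) z * (S z - S y) - indicator ({p..q} \<inter> {y'<..}) z * (S z - S y')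
      \<le> (S y' - S y) * indicator ({p..q} \<inter> {y<..}) z"
      using y S_mono[of z y'] Icc_I[of z] by (auto simp: indicator_def)
  qed
qed

lemma potential_0: "potential p q 0 = 1"
proof -
  have "(\<integral>z. indicator ({p..q} \<inter> {0<..}) z * (S z - S 0) \<partial>m) = bump_mass p q"
    unfolding bump_mass_def using pq by (intro Bochner_Integration.integral_cong) (auto simp: indicator_def S_def)
  then show ?thesis using bump_mass_pos by (simp add: potential_def)
qed

lemma potential_above: "q \<le> y \<Longrightarrow> potential p q y = 0"
proof -
  assume "q \<le> y"
  then have "{p..q} \<inter> {y<..} = {}" by auto
  then show ?thesis by (simp add: potential_def)
qed

lemma potential_nonneg: "0 \<le> y \<Longrightarrow> 0 \<le> potential p q y"
proof (cases "y < q")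
  case True
  assume y: "0 \<le> y"
  have "0 \<le> (s q - s y) * bump_tail q" using s_le[OF y _ q_less_b] True bump_tail_nonneg by simp
  also have "\<dots> \<le> bump_mass p q * (potential p q y - potential p q q)" by (rule potential_diff_bounds) (use y True q_less_b in auto)
  finally show ?thesis using bump_mass_pos potential_above[of q] by (simp add: zero_le_mult_iff)
qed (simp add: potential_above)

lemma potential_le_1: "0 \<le> y \<Longrightarrow> ereal y < b \<Longrightarrow> potential p q y \<le> 1"
proof -
  assume y: "0 \<le> y" "ereal y < b"
  have "0 \<le> (s y - s 0) * bump_tail y" using s_le[of 0 y] y bump_tail_nonneg by simp
  also have "\<dots> \<le> bump_mass p q * (potential p q 0 - potential p q y)" by (rule potential_diff_bounds) (use y in auto)
  finally show ?thesis using bump_mass_pos potential_0 by (simp add: zero_le_mult_iff)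
qed

text \<open>Right-continuity is due to the strict inequality in \<open>{y<..}\<close>; atoms of
  \<open>m\<close> rule out continuity from the left in general. It matches the use of right
  derivatives.\<close>

lemma bump_tail_tendsto: "(bump_tail \<longlongrightarrow> bump_tail y) (at_right y)"
  unfolding tendsto_at_iff_sequentially comp_def
proof (intro allI impI)
  fix Y :: "nat \<Rightarrow> real" assume Y: "\<forall>i. Y i \<in> {y<..} - {y}" and lim: "Y \<longlonglongrightarrow> y"
  show "(\<lambda>i. bump_tail (Y i)) \<longlonglongrightarrow> bump_tail y"
    unfolding bump_tail_def
  proof (rule integral_dominated_convergence[where w = "indicator ({p..q} \<inter> UNIV)"])
    show "AE z in m. (\<lambda>i. indicator ({p..q} \<inter> {Y i<..}) z) \<longlonglongrightarrow> (indicator ({p..q} \<inter> {y<..}) z :: real)"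
    proof (intro AE_I2 tendsto_eventually)
      fix z
      show "\<forall>\<^sub>F i in sequentially. indicator ({p..q} \<inter> {Y i<..}) z = (indicator ({p..q} \<inter> {y<..}) z :: real)"
      proof (cases "y < z")
        case True
        then have "\<forall>\<^sub>F i in sequentially. Y i < z" using lim by (intro order_tendstoD) auto
        then show ?thesis by eventually_elim (use True in \<open>simp add: indicator_def\<close>)
      next
        case False
        have "\<not> Y i < z" for i using Y[rule_format, of i] False by auto
        then show ?thesis using False by (simp add: indicator_def)
      qed
    qed
    show "integrable m (indicator ({p..q} \<inter> UNIV) :: real \<Rightarrow> real)" by (rule integrable_Icc) simp
  qed (auto simp: indicator_def)
qed

lemma potential_Lipschitz:
  assumes z: "0 \<le> z" "z \<le> z'" "ereal z' < b"
  shows "\<bar>potential p q z - potential p q z'\<bar> \<le> \<bar>s z - s z'\<bar> * (bump_tail 0 / bump_mass p q)"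
proof -
  have s: "0 \<le> s z' - s z" using s_le[OF z] by simp
  have "0 \<le> (s z' - s z) * bump_tail z'" using s bump_tail_nonneg by simp
  then have "0 \<le> bump_mass p q * (potential p q z - potential p q z')" using potential_diff_bounds(1)[OF z] by simp
  then have 1: "0 \<le> potential p q z - potential p q z'" using bump_mass_pos by (simp add: zero_le_mult_iff)
  have "bump_mass p q * (potential p q z - potential p q z') \<le> (s z' - s z) * bump_tail 0"
    using potential_diff_bounds(2)[OF z] mult_left_mono[OF bump_tail_le_0[OF z(1)] s] by simp
  then have "potential p q z - potential p q z' \<le> (s z' - s z) * (bump_tail 0 / bump_mass p q)"
    using bump_mass_pos by (simp add: pos_le_divide_eq mult.commute)
  then show ?thesis using 1 s by (simp add: abs_minus_commute[of "s z"])
qed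

lemma potential_continuous: "continuous_on {x. 0 \<le> x \<and> ereal x < b} (potential p q)"
  unfolding continuous_on_def
proof
  fix x assume x: "x \<in> {x. 0 \<le> x \<and> ereal x < b}"
  let ?D = "{x. 0 \<le> x \<and> ereal x < b}"
  have lip: "\<bar>potential p q y - potential p q x\<bar> \<le> \<bar>s y - s x\<bar> * (bump_tail 0 / bump_mass p q)" if y: "y \<in> ?D" for y
    using potential_Lipschitz[of x y] potential_Lipschitz[of y x] x y by (cases "x \<le> y") (auto simp: abs_minus_commute)
  have "(s \<longlongrightarrow> s x) (at x within ?D)" using s_cont x by (simp add: continuous_on_def)
  then have "((\<lambda>y. \<bar>s y - s x\<bar> * (bump_tail 0 / bump_mass p q)) \<longlongrightarrow> \<bar>s x - s x\<bar> * (bump_tail 0 / bump_mass p q)) (at x within ?D)"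
    by (intro tendsto_intros)
  then have lim0: "((\<lambda>y. \<bar>s y - s x\<bar> * (bump_tail 0 / bump_mass p q)) \<longlongrightarrow> 0) (at x within ?D)" by simp
  have "((\<lambda>y. potential p q y - potential p q x) \<longlongrightarrow> 0) (at x within ?D)"
    by (rule Lim_null_comparison[OF _ lim0]) (use lip in \<open>simp add: eventually_at_filter\<close>)
  then show "(potential p q \<longlongrightarrow> potential p q x) (at x within ?D)" by (rule LIM_zero_cancel)
qed

text \<open>The value v(0) = 1 is allowed because test pairs leave the value at the absorbing point
  free, and \<open>g 0 = 0\<close> holds because p > 0. The potential thus makes absorption at 0
  visible in Dynkin's formula.\<close>

lemma test_pair_potential: "test_pair b s m (potential p q) (bump p q)"
  unfolding test_pair_def
proof (intro conjI)
  show "\<exists>R\<in>I. \<forall>x\<ge>R. potential p q x = 0" using q_I potential_above by blast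
  show "bump p q \<in> borel_measurable borel" unfolding bump_def by measurable
  show "bounded (range (bump p q))"
    unfolding bounded_iff using bump_mass_pos
    by (intro exI[of _ "1 / bump_mass p q"]) (auto simp: bump_def indicator_def)
  show "bump p q 0 = 0" using pq by (simp add: bump_def)
  show "dmds b s m (potential p q) (bump p q)"
    unfolding dmds_def
  proof (intro conjI exI[of _ "\<lambda>x. - bump_tail x / bump_mass p q"] ballI allI impI)
    show "continuous_on I (potential p q)" by (rule continuous_on_subset[OF potential_continuous]) auto
  next
    fix x assume x: "x \<in> I"
    \<comment> \<open>Convexity traps the difference quotient between the slopes at its endpoints,
      and right-continuity of \<open>bump_tail\<close> closes the gap.\<close>
    have ev: "\<forall>\<^sub>F y in at_right x. - bump_tail x / bump_mass p q \<le> (potential p q y - potential p q x) / (s y - s x) \<and>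
        (potential p q y - potential p q x) / (s y - s x) \<le> - bump_tail y / bump_mass p q"
    proof -
      obtain x' where "x < x'" "ereal x' < b" using x ereal_dense2[of "ereal x" b] by auto
      from eventually_at_right_real[OF this(1)] show ?thesis
      proof eventually_elim
        case (elim y)
        then have y: "0 \<le> x" "x \<le> y" "ereal y < b" using x \<open>ereal x' < b\<close> ereal_less_b[of y x'] by auto
        have "0 < s y - s x" using s_less[of x y] elim y by simp
        then show ?case using potential_diff_bounds[OF y] bump_mass_pos by (simp add: field_simps)
      qed
    qed
    show "has_scale_deriv s (potential p q) (- bump_tail x / bump_mass p q) x"
      unfolding has_scale_deriv_def
    proof (rule tendsto_sandwich)
      show "((\<lambda>_. - bump_tail x / bump_mass p q) \<longlongrightarrow> - bump_tail x / bump_mass p q) (at_right x)" by simp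
      show "((\<lambda>y. - bump_tail y / bump_mass p q) \<longlongrightarrow> - bump_tail x / bump_mass p q) (at_right x)"
        using bump_mass_pos by (intro tendsto_intros bump_tail_tendsto) simp
    qed (use ev in \<open>auto elim: eventually_mono\<close>)
  next
    fix x y assume xy: "0 < x" "x < y" "ereal y < b"
    show "set_integrable m {x<..y} (bump p q)"
    proof -
      have "(\<lambda>z. indicator {x<..y} z *\<^sub>R bump p q z) = (\<lambda>z. indicator ({p..q} \<inter> {x<..y}) z / bump_mass p q)"
        by (auto simp: bump_def indicator_def fun_eq_iff)
      then show ?thesis unfolding set_integrable_def using integrable_Icc[of "{x<..y}"] by simp
    qed
    have "bump_tail x - bump_tail y = (\<integral>z. indicator ({p..q} \<inter> {x<..}) z - indicator ({p..q} \<inter> {y<..}) z \<partial>m)"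
      unfolding bump_tail_def by (intro Bochner_Integration.integral_diff[symmetric] integrable_Icc) auto
    also have "\<dots> = (\<integral>z. indicator ({p..q} \<inter> {x<..y}) z \<partial>m)"
      using xy by (intro Bochner_Integration.integral_cong) (auto simp: indicator_def)
    finally have eq: "bump_tail x - bump_tail y = (\<integral>z. indicator ({p..q} \<inter> {x<..y}) z \<partial>m)" .
    have "(LINT z:{x<..y}|m. bump p q z) = (\<integral>z. indicator ({p..q} \<inter> {x<..y}) z / bump_mass p q \<partial>m)"
      unfolding set_lebesgue_integral_def
      by (intro Bochner_Integration.integral_cong) (auto simp: bump_def indicator_def)
    also have "\<dots> = (bump_tail x - bump_tail y) / bump_mass p q" unfolding eq by (rule integral_divide_zero)
    finally show "- bump_tail y / bump_mass p q - - bump_tail x / bump_mass p q = (LINT z:{x<..y}|m. bump p q z)"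
      by (simp add: diff_divide_distrib)
  qed
qed (rule potential_continuous)

lemma bump_nonneg: "0 \<le> bump p q z"
  using bump_mass_pos by (simp add: bump_def)

lemma bump_L2: "L2_fun m (bump p q)"
  using L2_fun_cmult[OF L2_indicator_m[OF pq(1) q_I], of "1 / bump_mass p q"] by (simp add: bump_def[abs_def])

lemma bump_outside: "z \<notin> {p..q} \<Longrightarrow> bump p q z = 0"
  by (simp add: bump_def)

lemma near0_mass_mono: "0 \<le> y \<Longrightarrow> y \<le> q \<Longrightarrow> near0_mass y \<le> near0_mass q"
proof -
  assume y: "0 \<le> y" "y \<le> q"
  have int: "integrable m (\<lambda>z. indicator {0<..y} z * S z)" if "y \<le> q" for y
  proof -
    have "integrable m (\<lambda>z. indicator {0<..y} z * (indicator {0<..base} z * S z))"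
      using integrable_mult_indicator[OF _ base(2), of "{0<..y}"] by simp
    moreover have "(\<lambda>z. indicator {0<..y} z * (indicator {0<..base} z * S z)) = (\<lambda>z. indicator {0<..y} z * S z)"
      using that pq by (auto simp: indicator_def fun_eq_iff)
    ultimately show ?thesis by (simp only:)
  qed
  show ?thesis unfolding near0_mass_def
    using y S_nonneg by (intro integral_mono int) (auto simp: indicator_def)
qed

lemma bump_weight: "integrable m (\<lambda>z. bump p q z * S z)" "(\<integral>z. bump p q z * S z \<partial>m) = 1"
  using integrable_S bump_mass_pos by (simp_all add: bump_def bump_mass_def[symmetric])

lemma bump_psi_integrable: "integrable m (\<lambda>z. bump p q z * \<psi> l z)"
  by (rule hat_integrable[OF bump_L2 pq(1) q_I bump_outside])

text \<open>Averages \<open>psi_le_exp\<close> against the probability weight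
  \<open>bump p q z * S z\<close>, using monotonicity of \<open>near0_mass\<close> up to
  \<open>q\<close>.\<close>

lemma hat_bump_bound: "\<bar>hat (bump p q) l\<bar> \<le> exp (2 * \<bar>l\<bar> * near0_mass q)"
proof -
  have "\<bar>hat (bump p q) l\<bar> \<le> (\<integral>z. \<bar>bump p q z * \<psi> (- l) z\<bar> \<partial>m)"
    unfolding spectral_transform_def by (rule integral_abs_bound)
  also have "\<dots> \<le> (\<integral>z. exp (2 * \<bar>l\<bar> * near0_mass q) * (bump p q z * S z) \<partial>m)"
  proof (rule integral_mono)
    show "integrable m (\<lambda>z. \<bar>bump p q z * \<psi> (- l) z\<bar>)" by (intro integrable_abs bump_psi_integrable)
    show "integrable m (\<lambda>z. exp (2 * \<bar>l\<bar> * near0_mass q) * (bump p q z * S z))"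
      using bump_weight(1) by simp
    fix z
    show "\<bar>bump p q z * \<psi> (- l) z\<bar> \<le> exp (2 * \<bar>l\<bar> * near0_mass q) * (bump p q z * S z)"
    proof (cases "z \<in> {p..q}")
      case True
      then have "\<bar>\<psi> (- l) z\<bar> \<le> S z * exp (2 * \<bar>- l\<bar> * near0_mass z)" using pq by (intro psi_le_exp[OF psi]) auto
      also have "\<dots> \<le> S z * exp (2 * \<bar>l\<bar> * near0_mass q)"
      proof (rule mult_left_mono[OF _ S_nonneg])
        have "2 * \<bar>l\<bar> * near0_mass z \<le> 2 * \<bar>l\<bar> * near0_mass q" using True pq by (intro mult_left_mono near0_mass_mono) auto
        then show "exp (2 * \<bar>- l\<bar> * near0_mass z) \<le> exp (2 * \<bar>l\<bar> * near0_mass q)" by simp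
      qed
      finally have "bump p q z * \<bar>\<psi> (- l) z\<bar> \<le> bump p q z * (S z * exp (2 * \<bar>l\<bar> * near0_mass q))"
        using bump_nonneg by (rule mult_left_mono)
      then show ?thesis using bump_nonneg[of z] by (simp add: abs_mult ac_simps)
    qed (simp add: bump_outside)
  qed
  also have "\<dots> = exp (2 * \<bar>l\<bar> * near0_mass q)" using bump_weight(2) by simp
  finally show ?thesis .
qed

text \<open>The transform of the bump is the average of the ratio
  \<open>\<psi> (- l) z / S z\<close> under the same probability weight.\<close>

lemma hat_bump_near_1:
  assumes "\<And>z. z \<in> {p..q} \<Longrightarrow> \<bar>\<psi> (- l) z / S z - 1\<bar> \<le> e"
  shows "\<bar>hat (bump p q) l - 1\<bar> \<le> e"
proof -
  have diff: "hat (bump p q) l - 1 = (\<integral>z. bump p q z * \<psi> (- l) z - bump p q z * S z \<partial>m)"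
    unfolding spectral_transform_def
    by (subst Bochner_Integration.integral_diff[OF bump_psi_integrable bump_weight(1)]) (simp only: bump_weight(2))
  have "\<bar>hat (bump p q) l - 1\<bar> \<le> (\<integral>z. \<bar>bump p q z * \<psi> (- l) z - bump p q z * S z\<bar> \<partial>m)"
    unfolding diff by (rule integral_abs_bound)
  also have "\<dots> \<le> (\<integral>z. e * (bump p q z * S z) \<partial>m)"
  proof (rule integral_mono)
    show "integrable m (\<lambda>z. \<bar>bump p q z * \<psi> (- l) z - bump p q z * S z\<bar>)"
      by (intro integrable_abs Bochner_Integration.integrable_diff bump_psi_integrable bump_weight)
    show "integrable m (\<lambda>z. e * (bump p q z * S z))" by (intro integrable_mult_right bump_weight)
    fix z
    show "\<bar>bump p q z * \<psi> (- l) z - bump p q z * S z\<bar> \<le> e * (bump p q z * S z)"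
    proof (cases "z \<in> {p..q}")
      case True
      have Sz: "0 < S z" by (rule S_pos[OF Icc_I[OF True]])
      have "\<bar>bump p q z * \<psi> (- l) z - bump p q z * S z\<bar> = (bump p q z * S z) * \<bar>\<psi> (- l) z / S z - 1\<bar>"
      proof -
        have "S z * (\<psi> (- l) z / S z) = \<psi> (- l) z" using Sz by simp
        then have eq: "bump p q z * \<psi> (- l) z - bump p q z * S z = (bump p q z * S z) * (\<psi> (- l) z / S z - 1)"
          by (simp only: right_diff_distrib mult.assoc mult_1_right)
        show ?thesis unfolding eq abs_mult using bump_nonneg[of z] Sz by simp
      qed
      also have "\<dots> \<le> (bump p q z * S z) * e"
        using assms[OF True] bump_nonneg[of z] Sz by (intro mult_left_mono) auto
      finally show ?thesis by (simp add: mult.commute)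
    qed (simp add: bump_outside)
  qed
  also have "\<dots> = e" using bump_weight(2) by simp
  finally show ?thesis .
qed

end

definition q_seq :: "nat \<Rightarrow> real" where "q_seq n = base / real (Suc n)"

lemma q_seq: "0 < q_seq n" "0 < q_seq n / 2" "q_seq n / 2 < q_seq n" "q_seq n \<le> base" "q_seq \<longlonglongrightarrow> 0"
proof -
  show *: "0 < q_seq n" using base_pos by (simp add: q_seq_def)
  show "0 < q_seq n / 2" "q_seq n / 2 < q_seq n" using * by auto
  show "q_seq n \<le> base" using base_pos by (simp add: q_seq_def field_simps)
  have "(\<lambda>n. base * inverse (real (Suc n))) \<longlonglongrightarrow> base * 0"
    by (intro tendsto_mult tendsto_const LIMSEQ_inverse_real_of_nat)
  then show "q_seq \<longlonglongrightarrow> 0" by (simp add: q_seq_def[abs_def] divide_inverse)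
qed

lemmas q_seq_pq = q_seq(2,3,4)

lemma q_seq_at_right: "filterlim q_seq (at_right 0) sequentially"
  using q_seq(1,5) by (intro tendsto_imp_filterlim_at_right) auto

lemma hat_bump_tendsto: "(\<lambda>n. hat (bump (q_seq n / 2) (q_seq n)) l) \<longlonglongrightarrow> 1"
proof (rule LIMSEQ_I)
  fix e :: real assume e: "0 < e"
  have "\<forall>\<^sub>F y in at_right 0. dist (\<psi> (- l) y / (s y - s 0)) 1 < e / 2"
    using psi_ratio[OF psi[of "- l"]] by (rule tendstoD) (use e in simp)
  then have "\<forall>\<^sub>F y in at_right 0. \<bar>\<psi> (- l) y / (s y - s 0) - 1\<bar> < e / 2"
    by (simp only: dist_real_def)
  then obtain d where d: "0 < d" "\<And>y. 0 < y \<Longrightarrow> y < d \<Longrightarrow> \<bar>\<psi> (- l) y / (s y - s 0) - 1\<bar> < e / 2"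
    unfolding eventually_at_right_field by auto
  have "\<forall>\<^sub>F n in sequentially. q_seq n < d" using q_seq(5) d(1) by (intro order_tendstoD) auto
  then obtain N where N: "\<And>n. N \<le> n \<Longrightarrow> q_seq n < d" by (auto simp: eventually_sequentially)
  have "\<bar>hat (bump (q_seq n / 2) (q_seq n)) l - 1\<bar> \<le> e / 2" if n: "N \<le> n" for n
  proof (rule hat_bump_near_1[OF q_seq_pq])
    fix z assume z: "z \<in> {q_seq n / 2..q_seq n}"
    then have "\<bar>\<psi> (- l) z / (s z - s 0) - 1\<bar> < e / 2" using N[OF n] q_seq(1)[of n] by (intro d(2)) auto
    then show "\<bar>\<psi> (- l) z / S z - 1\<bar> \<le> e / 2" using S_eq[OF Icc_I[OF q_seq_pq z]] by simp
  qed
  moreover have "e / 2 < e" using e by simp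
  ultimately show "\<exists>N. \<forall>n\<ge>N. norm (hat (bump (q_seq n / 2) (q_seq n)) l - 1) < e"
    unfolding real_norm_def by (meson order.strict_trans1)
qed

end

section \<open>The density of the hitting time\<close>

lemma continuous_zero_if_integrals_zero:
  fixes d :: "real \<Rightarrow> real"
  assumes cont: "continuous_on {0<..} d"
    and int: "\<And>u v. 0 < u \<Longrightarrow> u < v \<Longrightarrow> integrable lborel (\<lambda>r. indicator {u<..v} r * d r)"
    and zero: "\<And>u v. 0 < u \<Longrightarrow> u < v \<Longrightarrow> (\<integral>r. indicator {u<..v} r * d r \<partial>lborel) = 0"
    and t: "0 < t"
  shows "d t = 0"
proof -
  have nonpos: "d t \<le> 0"
    if cont: "continuous_on {0<..} d"
      and int: "\<And>u v. 0 < u \<Longrightarrow> u < v \<Longrightarrow> integrable lborel (\<lambda>r. indicator {u<..v} r * d r)"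
      and zero: "\<And>u v. 0 < u \<Longrightarrow> u < v \<Longrightarrow> (\<integral>r. indicator {u<..v} r * d r \<partial>lborel) = 0"
    for d :: "real \<Rightarrow> real"
  proof (rule ccontr)
    assume "\<not> d t \<le> 0"
    then have dt: "0 < d t" by simp
    have "isCont d t" using cont t by (simp add: continuous_on_eq_continuous_at)
    then have "(d \<longlongrightarrow> d t) (at_right t)"
      unfolding isCont_def by (rule tendsto_within_subset) simp
    then have "\<forall>\<^sub>F r in at_right t. d t / 2 < d r" using dt by (intro order_tendstoD) auto
    then obtain v where v: "t < v" "\<And>r. t < r \<Longrightarrow> r < v \<Longrightarrow> d t / 2 < d r"
      unfolding eventually_at_right_field by auto
    \<comment> \<open>The lower bound on \<open>d\<close> is known strictly before \<open>v\<close>,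
      while the half-open interval includes its right endpoint; hence the midpoint.\<close>
    define w where "w = (t + v) / 2"
    have w: "t < w" "w < v" using v by (auto simp: w_def)
    have "0 < (w - t) * (d t / 2)" using w dt by simp
    also have "\<dots> = (\<integral>r. indicator {t<..w} r * (d t / 2) \<partial>lborel)" using w by simp
    also have "\<dots> \<le> (\<integral>r. indicator {t<..w} r * d r \<partial>lborel)"
    proof (rule integral_mono)
      show "integrable lborel (\<lambda>r. indicator {t<..w} r * (d t / 2))" using w by simp
      show "integrable lborel (\<lambda>r. indicator {t<..w} r * d r)" by (rule int[OF t w(1)])
      show "indicator {t<..w} r * (d t / 2) \<le> indicator {t<..w} r * d r" for r
        using v(2)[of r] w by (auto simp: indicator_def)
    qed
    also have "\<dots> = 0" by (rule zero[OF t w(1)])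
    finally show False by simp
  qed
  have "- d t \<le> 0"
  proof (rule nonpos)
    show "continuous_on {0<..} (\<lambda>r. - d r)" by (intro continuous_intros cont)
  qed (use int zero in auto)
  with nonpos[OF cont int zero] show ?thesis by simp
qed

lemma integrable_Ioc_continuous:
  fixes d :: "real \<Rightarrow> real"
  assumes "continuous_on {0<..} d" "0 < u"
  shows "integrable lborel (\<lambda>r. indicator {u<..v} r * d r)"
proof -
  have "set_integrable lborel {u..v} d"
    by (intro borel_integrable_atLeastAtMost' continuous_on_subset[OF assms(1)]) (use assms in auto)
  then have "integrable lborel (\<lambda>r. indicator {u..v} r * d r)" by (simp add: set_integrable_def)
  from integrable_mult_indicator[OF _ this, of "{u<..v}"]
  have "integrable lborel (\<lambda>r. indicator {u<..v} r * (indicator {u..v} r * d r))" by simp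
  moreover have "(\<lambda>r. indicator {u<..v} r * (indicator {u..v} r * d r)) = (\<lambda>r. indicator {u<..v} r * d r)"
    by (auto simp: indicator_def fun_eq_iff)
  ultimately show ?thesis by (simp only:)
qed

locale spectral_diffusion = spectral_scale b s m \<psi> \<sigma>
  for b :: ereal and s :: "real \<Rightarrow> real" and m :: "real measure" and \<psi> \<sigma> +
  fixes M :: "'w measure" and X :: "real \<Rightarrow> 'w \<Rightarrow> ereal" and P :: "ereal \<Rightarrow> 'w measure"
    and f :: "real \<Rightarrow> real \<Rightarrow> real"
  assumes diffusion: "stopped_diffusion b s m M X P"
    and kernel_nonneg: "\<And>t x y. 0 < t \<Longrightarrow> x \<in> interior_pts b \<Longrightarrow> y \<in> interior_pts b \<Longrightarrow>
      0 \<le> spectral_kernel \<psi> \<sigma> t x y"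
    and transition: "\<And>t x B. 0 < t \<Longrightarrow> x \<in> interior_pts b \<Longrightarrow> B \<in> sets borel \<Longrightarrow> B \<subseteq> interior_pts b \<Longrightarrow>
       emeasure (P (ereal x)) {\<omega>\<in>space M. X t \<omega> \<in> ereal ` B} =
       (\<integral>\<^sup>+y\<in>B. ennreal (spectral_kernel \<psi> \<sigma> t x y) \<partial>m)"
    and density: "is_hitting_density b M X P f"
begin

section \<open>Paths and the hitting time\<close>

lemmas diffusion_unfolded = diffusion[unfolded stopped_diffusion_def]

lemmas X_measurable = diffusion_unfolded[THEN conjunct1, rule_format]

lemmas X_paths = diffusion_unfolded[THEN conjunct2, THEN conjunct1, THEN bspec]

lemma X_range: "\<omega> \<in> space M \<Longrightarrow> 0 \<le> t \<Longrightarrow> X t \<omega> \<in> {0..b}"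
  using X_paths[of \<omega>] by blast

lemma X_absorbed: "\<omega> \<in> space M \<Longrightarrow> 0 \<le> t \<Longrightarrow> t \<le> u \<Longrightarrow> X t \<omega> = 0 \<Longrightarrow> X u \<omega> = 0"
proof -
  assume *: "\<omega> \<in> space M" "0 \<le> t" "t \<le> u" "X t \<omega> = 0"
  note diffusion_unfolded[THEN conjunct2, THEN conjunct2, THEN conjunct1]
  from this[rule_format, OF *(1-3)] show "X u \<omega> = 0" using *(4) by simp
qed

lemma X_continuous: "\<omega> \<in> space M \<Longrightarrow> continuous_on {0..} (\<lambda>t. X t \<omega>)"
  using X_paths[of \<omega>] by blast

lemma Dynkin:
  "test_pair b s m v g \<Longrightarrow> x \<in> I \<Longrightarrow> 0 \<le> t \<Longrightarrow>
     (\<integral>\<omega>. extend0 b v (X t \<omega>) \<partial>P (ereal x)) =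
     v x + (LINT r:{0..t}|lborel. (\<integral>\<omega>. extend0 b g (X r \<omega>) \<partial>P (ereal x)))"
proof -
  have "has_generator b s m X P" using diffusion unfolding stopped_diffusion_def by (elim conjE)
  then show "test_pair b s m v g \<Longrightarrow> x \<in> I \<Longrightarrow> 0 \<le> t \<Longrightarrow>
     (\<integral>\<omega>. extend0 b v (X t \<omega>) \<partial>P (ereal x)) =
     v x + (LINT r:{0..t}|lborel. (\<integral>\<omega>. extend0 b g (X r \<omega>) \<partial>P (ereal x)))"
    unfolding has_generator_def by blast
qed

lemma P_space:
  assumes "x \<in> I"
  shows "prob_space (P (ereal x))" and "sets (P (ereal x)) = sets M"
proof -
  have "P \<in> restrict_space borel {0..b} \<rightarrow>\<^sub>M prob_algebra M" using diffusion unfolding stopped_diffusion_def by (elim conjE)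
  moreover have "ereal x \<in> space (restrict_space borel {0..b})"
    using assms by (auto simp: space_restrict_space less_imp_le)
  ultimately have "P (ereal x) \<in> space (prob_algebra M)" by (rule measurable_space)
  then show "prob_space (P (ereal x))" "sets (P (ereal x)) = sets M" by (auto simp: space_prob_algebra)
qed

text \<open>Continuity of paths makes the zero set closed, so the infimum is attained if finite, and
  absorption keeps the path at 0 from then on. The law of the hitting time on intervals can thus be
  read off from the one-dimensional distributions.\<close>

lemma hitting_time_Ioc:
  assumes \<omega>: "\<omega> \<in> space M" and u: "0 \<le> u" "u < v"
  shows "hitting_time0 X \<omega> \<in> ereal ` {u<..v} \<longleftrightarrow> X v \<omega> = 0 \<and> X u \<omega> \<noteq> 0"
proof -
  define Z where "Z = {t. 0 \<le> t \<and> X t \<omega> = 0}"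
  have T: "hitting_time0 X \<omega> = Inf (ereal ` Z)" by (simp add: hitting_time0_def Z_def)
  have attained: "\<exists>r\<in>Z. hitting_time0 X \<omega> = ereal r \<and> (\<forall>z\<in>Z. r \<le> z)" if "Z \<noteq> {}"
  proof -
    have "closed ({0..} \<inter> (\<lambda>t. X t \<omega>) -` {0})"
      by (rule continuous_closed_preimage[OF X_continuous[OF \<omega>]]) auto
    moreover have "{0..} \<inter> (\<lambda>t. X t \<omega>) -` {0} = Z" by (auto simp: Z_def)
    ultimately have cl: "closed Z" by simp
    have bdd: "bdd_below Z" by (rule bdd_belowI[of _ 0]) (simp add: Z_def)
    have r: "Inf Z \<in> Z" by (rule closed_contains_Inf[OF that bdd cl])
    have le: "Inf Z \<le> z" if "z \<in> Z" for z using that by (rule cInf_lower[OF _ bdd])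
    have "Inf (ereal ` Z) = ereal (Inf Z)"
      by (rule cInf_eq_minimum) (use r le in auto)
    with r le show ?thesis unfolding T by blast
  qed
  show ?thesis
  proof
    assume "hitting_time0 X \<omega> \<in> ereal ` {u<..v}"
    then obtain r where r: "hitting_time0 X \<omega> = ereal r" "u < r" "r \<le> v" by auto
    have "Z \<noteq> {}"
    proof
      assume "Z = {}"
      then show False using r(1) by (simp add: T top_ereal_def)
    qed
    from attained[OF this] r have rZ: "r \<in> Z" "\<forall>z\<in>Z. r \<le> z" by auto
    have "X v \<omega> = 0" using rZ(1) r(3) X_absorbed[OF \<omega>, of r v] by (simp add: Z_def)
    moreover have "X u \<omega> \<noteq> 0" using rZ(2) r(2) u by (auto simp: Z_def)
    ultimately show "X v \<omega> = 0 \<and> X u \<omega> \<noteq> 0" by simp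
  next
    assume *: "X v \<omega> = 0 \<and> X u \<omega> \<noteq> 0"
    then have v: "v \<in> Z" using u by (simp add: Z_def)
    then obtain r where r: "r \<in> Z" "hitting_time0 X \<omega> = ereal r" "\<forall>z\<in>Z. r \<le> z" using attained by blast
    have "u < r"
    proof (rule ccontr)
      assume "\<not> u < r"
      then have "X u \<omega> = 0" using r(1) X_absorbed[OF \<omega>, of r u] by (simp add: Z_def)
      then show False using * by simp
    qed
    then show "hitting_time0 X \<omega> \<in> ereal ` {u<..v}" using r v by auto
  qed
qed

lemma extend0_bump:
  assumes pq: "0 < p" "p < q" "q \<le> base"
  shows "extend0 b (bump p q) y = indicator (ereal ` {p..q}) y / bump_mass p q"
proof (cases "0 \<le> y \<and> y < b")
  case True
  then obtain r where r: "y = ereal r" by (cases y) auto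
  then show ?thesis using True by (auto simp: extend0_def bump_def indicator_def)
next
  case False
  have "y \<notin> ereal ` {p..q}"
  proof
    assume "y \<in> ereal ` {p..q}"
    then obtain r where r: "y = ereal r" "r \<in> {p..q}" by blast
    then show False using Icc_I[OF pq r(2)] False by simp
  qed
  then show ?thesis using False by (auto simp: extend0_def)
qed

section \<open>Dynkin's formula under a fixed starting point\<close>

context
  fixes x :: real
  assumes x: "x \<in> I"
begin

interpretation Px: prob_space "P (ereal x)" by (rule P_space(1)[OF x])

lemma sets_Px [simp, measurable_cong]: "sets (P (ereal x)) = sets M"
  by (rule P_space(2)[OF x])

lemma space_Px [simp]: "space (P (ereal x)) = space M"
  by (rule sets_eq_imp_space_eq) simp

lemma hit_sets: "0 \<le> t \<Longrightarrow> {\<omega>\<in>space M. X t \<omega> = 0} \<in> sets M"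
proof -
  assume "0 \<le> t"
  note [measurable] = X_measurable[OF this]
  show ?thesis by measurable
qed

definition phi :: "real \<Rightarrow> real" where "phi t = adj (\<lambda>l. exp (- l * t)) x"

text \<open>The spectral expression for the expectation of \<open>bump p q\<close> at time
  \<open>r\<close>; the two agree for r > 0.\<close>

definition bump_expectation :: "real \<Rightarrow> real \<Rightarrow> real \<Rightarrow> real"
  where "bump_expectation p q r = (\<integral>l. exp (- l * r) * \<psi> (- l) x * hat (bump p q) l \<partial>\<sigma>)"

text \<open>The transition density is the adjoint of \<open>exp (- l * r) * \<psi> (- l) x\<close>,
  so duality moves the bump to the spectral side. The bound holds because the expectation is a
  probability divided by the mass; it controls times near 0, where no spectral estimate is at
  hand.\<close>

lemma expectation_bump:
  assumes pq: "0 < p" "p < q" "q \<le> base" and r: "0 < r"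
  shows "(\<integral>\<omega>. extend0 b (bump p q) (X r \<omega>) \<partial>P (ereal x)) = bump_expectation p q r"
    and "\<bar>bump_expectation p q r\<bar> \<le> 1 / bump_mass p q"
proof -
  define G where "G l = exp (- l * r) * \<psi> (- l) x" for l
  have G: "admissible G" unfolding G_def by (rule admissible_exp_psi[OF r x])
  have ker: "spectral_kernel \<psi> \<sigma> r x y = adj G y" for y
    by (simp add: spectral_kernel_def adj_def G_def)
  have N: "0 < bump_mass p q" by (rule bump_mass_pos[OF pq])
  have inI: "{p..q} \<subseteq> I" using Icc_I[OF pq] by blast
  note [measurable] = X_measurable[OF less_imp_le[OF r]]
  have Bs: "ereal ` {p..q} \<in> sets borel"
  proof -
    have "compact (ereal ` {p..q})" by (intro compact_continuous_image) (auto intro: continuous_intros)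
    then show ?thesis by (intro borel_closed compact_imp_closed)
  qed
  then have Ms: "{\<omega>\<in>space M. X r \<omega> \<in> ereal ` {p..q}} \<in> sets M" by measurable
  have int: "integrable m (\<lambda>y. indicator {p..q} y * adj G y)"
    by (rule L2_fun_mult_integrable[OF L2_indicator_m[OF pq(1) q_I[OF pq]] adj_contraction(1)[OF G]])
  have "emeasure (P (ereal x)) {\<omega>\<in>space M. X r \<omega> \<in> ereal ` {p..q}}
      = (\<integral>\<^sup>+y\<in>{p..q}. ennreal (spectral_kernel \<psi> \<sigma> r x y) \<partial>m)"
    by (rule transition[OF r x _ inI]) simp
  also have "\<dots> = (\<integral>\<^sup>+y. ennreal (indicator {p..q} y * adj G y) \<partial>m)"
    by (intro nn_integral_cong) (auto simp: ker indicator_def)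
  also have "\<dots> = ennreal (\<integral>y. indicator {p..q} y * adj G y \<partial>m)"
  proof (rule nn_integral_eq_integral[OF int])
    show "AE y in m. 0 \<le> indicator {p..q} y * adj G y"
      using kernel_nonneg[OF r x] inI unfolding ker by (intro AE_I2) (auto simp: indicator_def)
  qed
  finally have em: "emeasure (P (ereal x)) {\<omega>\<in>space M. X r \<omega> \<in> ereal ` {p..q}}
    = ennreal (\<integral>y. indicator {p..q} y * adj G y \<partial>m)" .
  have pos: "0 \<le> (\<integral>y. indicator {p..q} y * adj G y \<partial>m)"
    using kernel_nonneg[OF r x] inI unfolding ker
    by (intro Bochner_Integration.integral_nonneg) (auto simp: indicator_def)
  have me: "measure (P (ereal x)) {\<omega>\<in>space M. X r \<omega> \<in> ereal ` {p..q}} = (\<integral>y. indicator {p..q} y * adj G y \<partial>m)"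
    using em pos by (simp add: measure_def)
  have "(\<integral>\<omega>. extend0 b (bump p q) (X r \<omega>) \<partial>P (ereal x))
      = (\<integral>\<omega>. indicator {\<omega>\<in>space M. X r \<omega> \<in> ereal ` {p..q}} \<omega> / bump_mass p q \<partial>P (ereal x))"
    unfolding extend0_bump[OF pq] by (intro Bochner_Integration.integral_cong) (auto simp: indicator_def)
  also have "\<dots> = measure (P (ereal x)) {\<omega>\<in>space M. X r \<omega> \<in> ereal ` {p..q}} / bump_mass p q"
    using Ms by (simp add: Int_absorb1 sets.sets_into_space)
  finally have e1: "(\<integral>\<omega>. extend0 b (bump p q) (X r \<omega>) \<partial>P (ereal x))
    = measure (P (ereal x)) {\<omega>\<in>space M. X r \<omega> \<in> ereal ` {p..q}} / bump_mass p q" .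
  have "measure (P (ereal x)) {\<omega>\<in>space M. X r \<omega> \<in> ereal ` {p..q}} / bump_mass p q = (\<integral>y. bump p q y * adj G y \<partial>m)"
    unfolding me by (simp add: bump_def)
  also have "\<dots> = (\<integral>l. G l * hat (bump p q) l \<partial>\<sigma>)"
    by (rule adj_hat[OF G pq(1) q_I[OF pq] bump_L2[OF pq] bump_outside[OF pq]])
  also have "\<dots> = bump_expectation p q r" by (simp add: bump_expectation_def G_def)
  finally have e2: "measure (P (ereal x)) {\<omega>\<in>space M. X r \<omega> \<in> ereal ` {p..q}} / bump_mass p q = bump_expectation p q r" .
  show "(\<integral>\<omega>. extend0 b (bump p q) (X r \<omega>) \<partial>P (ereal x)) = bump_expectation p q r" using e1 e2 by simp
  show "\<bar>bump_expectation p q r\<bar> \<le> 1 / bump_mass p q"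
    unfolding e2[symmetric] using N by (simp add: divide_right_mono)
qed

lemma bump_expectation_measurable: "(\<lambda>r. bump_expectation p q r) \<in> borel_measurable borel"
proof -
  have "bump p q \<in> borel_measurable borel" unfolding bump_def by measurable
  note [measurable] = hat_measurable[OF this]
  show ?thesis unfolding bump_expectation_def by measurable
qed

lemma bump_expectation_integrable:
  assumes pq: "0 < p" "p < q" "q \<le> base" and u: "0 \<le> u"
  shows "integrable lborel (\<lambda>r. indicator {u<..v} r * bump_expectation p q r)"
proof (rule Bochner_Integration.integrable_bound)
  note [measurable] = bump_expectation_measurable
  show "integrable lborel (\<lambda>r. indicator {u<..v} r * (1 / bump_mass p q))"
    by (cases "u \<le> v") auto
  show "(\<lambda>r. indicator {u<..v} r * bump_expectation p q r) \<in> borel_measurable lborel" by measurable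
  have "\<bar>indicator {u<..v} r * bump_expectation p q r\<bar> \<le> indicator {u<..v} r * (1 / bump_mass p q)" for r
    using expectation_bump(2)[OF pq, of r] u by (auto simp: indicator_def)
  then show "AE r in lborel. norm (indicator {u<..v} r * bump_expectation p q r) \<le> norm (indicator {u<..v} r * (1 / bump_mass p q))"
    by (intro AE_I2) (metis abs_ge_self order_trans real_norm_def)
qed

lemma Dynkin_potential:
  assumes pq: "0 < p" "p < q" "q \<le> base" and t: "0 \<le> t"
  shows "(\<integral>\<omega>. extend0 b (potential p q) (X t \<omega>) \<partial>P (ereal x)) = potential p q x + (\<integral>r. indicator {0<..t} r * bump_expectation p q r \<partial>lborel)"
proof -
  define E where "E r = (\<integral>\<omega>. extend0 b (bump p q) (X r \<omega>) \<partial>P (ereal x))" for r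
  note [measurable] = bump_expectation_measurable
  \<comment> \<open>The spectral expression is identified for positive times only, so r = 0 is split
    off as a Lebesgue null set.\<close>
  have eq: "indicator {0..t} r *\<^sub>R E r = indicator {0<..t} r * bump_expectation p q r + indicator {0} r * E 0" for r
    using expectation_bump(1)[OF pq, of r] t by (cases "r = 0") (auto simp: E_def indicator_def)
  have "(LINT r:{0..t}|lborel. E r) = (\<integral>r. indicator {0<..t} r * bump_expectation p q r + indicator {0} r * E 0 \<partial>lborel)"
    unfolding set_lebesgue_integral_def eq ..
  also have "\<dots> = (\<integral>r. indicator {0<..t} r * bump_expectation p q r \<partial>lborel)"
    by (rule integral_cong_AE) (use AE_lborel_singleton[of "0::real"] in \<open>auto elim: eventually_mono\<close>)
  finally show ?thesis using Dynkin[OF test_pair_potential[OF pq] x t] by (simp add: E_def)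
qed

lemma expectation_potential_diff:
  assumes pq: "0 < p" "p < q" "q \<le> base" and uv: "0 < u" "u < v"
  shows "(\<integral>\<omega>. extend0 b (potential p q) (X v \<omega>) \<partial>P (ereal x)) - (\<integral>\<omega>. extend0 b (potential p q) (X u \<omega>) \<partial>P (ereal x))
    = (\<integral>r. indicator {u<..v} r * bump_expectation p q r \<partial>lborel)"
proof -
  have "(\<integral>r. indicator {0<..v} r * bump_expectation p q r \<partial>lborel)
      = (\<integral>r. indicator {0<..u} r * bump_expectation p q r + indicator {u<..v} r * bump_expectation p q r \<partial>lborel)"
    using uv by (intro Bochner_Integration.integral_cong) (auto simp: indicator_def)
  also have "\<dots> = (\<integral>r. indicator {0<..u} r * bump_expectation p q r \<partial>lborel) + (\<integral>r. indicator {u<..v} r * bump_expectation p q r \<partial>lborel)"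
    using uv by (intro Bochner_Integration.integral_add bump_expectation_integrable[OF pq]) auto
  finally show ?thesis using Dynkin_potential[OF pq, of u] Dynkin_potential[OF pq, of v] uv by simp
qed

text \<open>The potentials equal 1 at 0, and at a fixed positive state they vanish as soon as
  \<open>q_seq n\<close> lies below it; the cemetery contributes 0. So they converge pointwise to
  the indicator of absorption at 0, dominated by 1.\<close>

lemma expectation_potential_tendsto:
  assumes t: "0 \<le> t"
  shows "(\<lambda>n. \<integral>\<omega>. extend0 b (potential (q_seq n / 2) (q_seq n)) (X t \<omega>) \<partial>P (ereal x))
    \<longlonglongrightarrow> measure (P (ereal x)) {\<omega>\<in>space M. X t \<omega> = 0}"
proof -
  note [measurable] = X_measurable[OF t]
  let ?v = "\<lambda>n. potential (q_seq n / 2) (q_seq n)"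
  have meas: "(\<lambda>\<omega>. extend0 b (?v n) (X t \<omega>)) \<in> borel_measurable (P (ereal x))" for n
  proof -
    \<comment> \<open>A conditional instead of an interval that moves with \<open>y\<close> exhibits
      joint measurability in \<open>y\<close> and \<open>z\<close>.\<close>
    have eq: "indicator ({p..q} \<inter> {y<..}) z * (S z - S y) = (if y < z then indicator {p..q} z * (S z - S y) else 0)"
      for p q y z by (simp add: indicator_def)
    have [measurable]: "?v n \<in> borel_measurable borel" unfolding potential_def eq by measurable
    show ?thesis unfolding extend0_def by measurable
  qed
  have "(\<lambda>n. \<integral>\<omega>. extend0 b (?v n) (X t \<omega>) \<partial>P (ereal x))
      \<longlonglongrightarrow> (\<integral>\<omega>. indicator {\<omega>\<in>space M. X t \<omega> = 0} \<omega> \<partial>P (ereal x))"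
  proof (rule integral_dominated_convergence[where w = "\<lambda>_. 1"])
    show "indicator {\<omega>\<in>space M. X t \<omega> = 0} \<in> borel_measurable (P (ereal x))" using hit_sets[OF t] by simp
    show "AE \<omega> in P (ereal x). (\<lambda>n. extend0 b (?v n) (X t \<omega>)) \<longlonglongrightarrow> indicator {\<omega>\<in>space M. X t \<omega> = 0} \<omega>"
    proof (rule AE_I2)
      fix \<omega> assume "\<omega> \<in> space (P (ereal x))"
      then have \<omega>: "\<omega> \<in> space M" by simp
      have "\<forall>\<^sub>F n in sequentially. extend0 b (?v n) (X t \<omega>) = indicator {\<omega>\<in>space M. X t \<omega> = 0} \<omega>"
      proof (cases "X t \<omega> = 0")
        case True
        have "extend0 b (?v n) (X t \<omega>) = 1" for n
          using True b_pos potential_0[OF q_seq_pq, of n] by (simp add: extend0_def)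
        then show ?thesis using True \<omega> by simp
      next
        case False
        show ?thesis
        proof (cases "X t \<omega> < b")
          case True
          then obtain y where y: "X t \<omega> = ereal y" "0 < y"
            using X_range[OF \<omega> t] False by (cases "X t \<omega>") auto
          have "\<forall>\<^sub>F n in sequentially. q_seq n < y" using q_seq(5) y(2) by (intro order_tendstoD) auto
          then show ?thesis
          proof eventually_elim
            case (elim n)
            then have "?v n y = 0" using potential_above[OF q_seq_pq, of n y] by simp
            then show ?case using False y by (simp add: extend0_def)
          qed
        next
          case nb: False
          then show ?thesis using False by (simp add: extend0_def)
        qed
      qed
      then show "(\<lambda>n. extend0 b (?v n) (X t \<omega>)) \<longlonglongrightarrow> indicator {\<omega>\<in>space M. X t \<omega> = 0} \<omega>"
        by (rule tendsto_eventually)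
    qed
    show "AE \<omega> in P (ereal x). norm (extend0 b (?v n) (X t \<omega>)) \<le> 1" for n
    proof (rule AE_I2)
      fix \<omega> assume "\<omega> \<in> space (P (ereal x))"
      then have "0 \<le> X t \<omega>" using X_range[of \<omega> t] t by simp
      show "norm (extend0 b (?v n) (X t \<omega>)) \<le> 1"
      proof (cases "X t \<omega> < b")
        case True
        then obtain y where y: "X t \<omega> = ereal y" "0 \<le> y"
          using \<open>0 \<le> X t \<omega>\<close> by (cases "X t \<omega>") auto
        then show ?thesis
          using True potential_nonneg[OF q_seq_pq, of y n] potential_le_1[OF q_seq_pq, of y n] by (simp add: extend0_def)
      qed (simp add: extend0_def)
    qed
  qed (use meas in auto)
  moreover have "(\<integral>\<omega>. indicator {\<omega>\<in>space M. X t \<omega> = 0} \<omega> \<partial>P (ereal x)) = measure (P (ereal x)) {\<omega>\<in>space M. X t \<omega> = 0}"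
    using hit_sets[OF t] by (simp add: Int_absorb1 sets.sets_into_space)
  ultimately show ?thesis by simp
qed

lemma phi_integrable: "0 < t \<Longrightarrow> integrable \<sigma> (\<lambda>l. exp (- l * t) * \<psi> (- l) x)"
  using admissible_exp[of t] by (simp add: admissible_def)

lemma phi_continuous: "continuous_on {0<..} phi"
proof (rule continuous_at_imp_continuous_on, rule ballI)
  fix t :: real assume "t \<in> {0<..}"
  then have t: "0 < t" by simp
  let ?S = "{t/2<..}"
  have "(phi \<longlongrightarrow> phi t) (at t within ?S)"
    unfolding tendsto_at_iff_sequentially comp_def
  proof (intro allI impI)
    fix Y :: "nat \<Rightarrow> real" assume Y: "\<forall>i. Y i \<in> ?S - {t}" and lim: "Y \<longlonglongrightarrow> t"
    show "(\<lambda>i. phi (Y i)) \<longlonglongrightarrow> phi t"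
      unfolding phi_def adj_def
    proof (rule integral_dominated_convergence[where w = "\<lambda>l. \<bar>exp (- l * (t / 2)) * \<psi> (- l) x\<bar>"])
      show "integrable \<sigma> (\<lambda>l. \<bar>exp (- l * (t / 2)) * \<psi> (- l) x\<bar>)"
        using t by (intro integrable_abs phi_integrable) simp
      show "AE l in \<sigma>. (\<lambda>i. exp (- l * Y i) * \<psi> (- l) x) \<longlonglongrightarrow> exp (- l * t) * \<psi> (- l) x"
        by (intro AE_I2 tendsto_intros lim)
      show "AE l in \<sigma>. norm (exp (- l * Y i) * \<psi> (- l) x) \<le> \<bar>exp (- l * (t / 2)) * \<psi> (- l) x\<bar>" for i
        using AE_\<sigma>_nonneg
      proof eventually_elim
        case (elim l)
        have "t / 2 \<le> Y i" using Y[rule_format, of i] by auto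
        then have "l * (t / 2) \<le> l * Y i" using elim by (rule mult_left_mono)
        then have "exp (- l * Y i) * \<bar>\<psi> (- l) x\<bar> \<le> exp (- l * (t / 2)) * \<bar>\<psi> (- l) x\<bar>"
          by (intro mult_right_mono) auto
        then show ?case by (simp add: abs_mult)
      qed
    qed measurable
  qed
  moreover have "at t within ?S = at t" using t by (intro at_within_open) auto
  ultimately show "isCont phi t" by (simp add: isCont_def)
qed

text \<open>For times r > u > 0 the factor \<open>exp (- l * r)\<close> absorbs the growth allowed
  by \<open>hat_bump_bound\<close> and still leaves \<open>exp (- l * (u / 2))\<close>. Dominated
  convergence then applies twice, first in l and then in r.\<close>

lemma bump_expectation_tendsto:
  assumes uv: "0 < u" "u < v"
  shows "(\<lambda>n. \<integral>r. indicator {u<..v} r * bump_expectation (q_seq n / 2) (q_seq n) r \<partial>lborel)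
    \<longlonglongrightarrow> (\<integral>r. indicator {u<..v} r * phi r \<partial>lborel)"
proof -
  define w where "w l = \<bar>exp (- l * (u / 2)) * \<psi> (- l) x\<bar>" for l
  have w: "integrable \<sigma> w" unfolding w_def using uv by (intro integrable_abs phi_integrable) simp
  \<comment> \<open>The factor 2 in the exponent of the bound turns u/4 into u/2, half of the decay
    available at times beyond u.\<close>
  have "\<forall>\<^sub>F y in at_right 0. near0_mass y < u / 4" using near0_mass_tendsto_0 uv by (intro order_tendstoD) auto
  then have "\<forall>\<^sub>F n in sequentially. near0_mass (q_seq n) < u / 4"
    using filterlim_iff[THEN iffD1, OF q_seq_at_right] by blast
  then obtain N where N: "\<And>n. N \<le> n \<Longrightarrow> near0_mass (q_seq n) < u / 4" by (auto simp: eventually_sequentially)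
  let ?h = "\<lambda>n l. hat (bump (q_seq n / 2) (q_seq n)) l"
  have h_meas: "?h n \<in> borel_measurable borel" for n
  proof -
    have "bump (q_seq n / 2) (q_seq n) \<in> borel_measurable borel" unfolding bump_def by measurable
    then show ?thesis by (rule hat_measurable)
  qed
  have bound: "\<bar>exp (- l * r) * \<psi> (- l) x * ?h n l\<bar> \<le> w l" if l: "0 \<le> l" and n: "N \<le> n" and r: "u < r" for l n r
  proof -
    have "\<bar>?h n l\<bar> \<le> exp (2 * \<bar>l\<bar> * near0_mass (q_seq n))" by (rule hat_bump_bound[OF q_seq_pq])
    also have "\<dots> \<le> exp (l * (u / 2))"
      using mult_left_mono[OF less_imp_le[OF N[OF n]] l] l by simp
    finally have "exp (- l * r) * \<bar>?h n l\<bar> \<le> exp (- l * r) * exp (l * (u / 2))" by simp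
    also have "\<dots> \<le> exp (- l * (u / 2))"
      using mult_left_mono[OF less_imp_le[OF r] l] by (simp add: mult_exp_exp)
    finally have "(exp (- l * r) * \<bar>?h n l\<bar>) * \<bar>\<psi> (- l) x\<bar> \<le> exp (- l * (u / 2)) * \<bar>\<psi> (- l) x\<bar>"
      by (intro mult_right_mono) auto
    then show ?thesis by (simp add: w_def abs_mult ac_simps)
  qed
  have int: "integrable \<sigma> (\<lambda>l. exp (- l * r) * \<psi> (- l) x * ?h n l)" if n: "N \<le> n" and r: "u < r" for n r
  proof (rule Bochner_Integration.integrable_bound[OF w])
    note [measurable] = h_meas
    show "(\<lambda>l. exp (- l * r) * \<psi> (- l) x * ?h n l) \<in> borel_measurable \<sigma>" by measurable
    show "AE l in \<sigma>. norm (exp (- l * r) * \<psi> (- l) x * ?h n l) \<le> norm (w l)"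
      using AE_\<sigma>_nonneg by eventually_elim (use bound[OF _ n r] in \<open>auto intro: order_trans[OF _ abs_ge_self]\<close>)
  qed
  have bump_expectation_bound: "\<bar>bump_expectation (q_seq n / 2) (q_seq n) r\<bar> \<le> integral\<^sup>L \<sigma> w" if n: "N \<le> n" and r: "u < r" for n r
  proof -
    have "\<bar>bump_expectation (q_seq n / 2) (q_seq n) r\<bar> \<le> (\<integral>l. \<bar>exp (- l * r) * \<psi> (- l) x * ?h n l\<bar> \<partial>\<sigma>)"
      unfolding bump_expectation_def by (rule integral_abs_bound)
    also have "\<dots> \<le> integral\<^sup>L \<sigma> w"
    proof (rule integral_mono_AE)
      show "AE l in \<sigma>. \<bar>exp (- l * r) * \<psi> (- l) x * ?h n l\<bar> \<le> w l"
        using AE_\<sigma>_nonneg by eventually_elim (rule bound[OF _ n r])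
    qed (use w int[OF n r] in auto)
    finally show ?thesis .
  qed
  have bump_expectation_lim: "(\<lambda>n. bump_expectation (q_seq n / 2) (q_seq n) r) \<longlonglongrightarrow> phi r" if r: "u < r" for r
  \<comment> \<open>The dominating function is valid from index \<open>N\<close> on, so the sequence
    is shifted.\<close>
  proof (rule LIMSEQ_offset[where k = N])
    show "(\<lambda>n. bump_expectation (q_seq (n + N) / 2) (q_seq (n + N)) r) \<longlonglongrightarrow> phi r"
      unfolding bump_expectation_def phi_def adj_def
    proof (rule integral_dominated_convergence[OF _ _ w])
      note [measurable] = h_meas
      show "(\<lambda>l. exp (- l * r) * \<psi> (- l) x) \<in> borel_measurable \<sigma>" by measurable
      show "(\<lambda>l. exp (- l * r) * \<psi> (- l) x * ?h (n + N) l) \<in> borel_measurable \<sigma>" for n by measurable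
      show "AE l in \<sigma>. (\<lambda>n. exp (- l * r) * \<psi> (- l) x * ?h (n + N) l) \<longlonglongrightarrow> exp (- l * r) * \<psi> (- l) x"
      proof (rule AE_I2)
        fix l
        have "(\<lambda>n. exp (- l * r) * \<psi> (- l) x * ?h (n + N) l) \<longlonglongrightarrow> exp (- l * r) * \<psi> (- l) x * 1"
          by (intro tendsto_mult tendsto_const LIMSEQ_ignore_initial_segment hat_bump_tendsto)
        then show "(\<lambda>n. exp (- l * r) * \<psi> (- l) x * ?h (n + N) l) \<longlonglongrightarrow> exp (- l * r) * \<psi> (- l) x" by simp
      qed
      show "AE l in \<sigma>. norm (exp (- l * r) * \<psi> (- l) x * ?h (n + N) l) \<le> w l" for n
        using AE_\<sigma>_nonneg by eventually_elim (use bound[OF _ _ r] in simp)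
    qed
  qed
  show ?thesis
  proof (rule LIMSEQ_offset[where k = N])
    note [measurable] = bump_expectation_measurable
    have "integrable lborel (\<lambda>r. indicator {u<..v} r * phi r)"
      by (rule integrable_Ioc_continuous[OF phi_continuous uv(1)])
    then have m1: "(\<lambda>r. indicator {u<..v} r * phi r) \<in> borel_measurable lborel" by (rule borel_measurable_integrable)
    show "(\<lambda>n. \<integral>r. indicator {u<..v} r * bump_expectation (q_seq (n + N) / 2) (q_seq (n + N)) r \<partial>lborel)
      \<longlonglongrightarrow> (\<integral>r. indicator {u<..v} r * phi r \<partial>lborel)"
    proof (rule integral_dominated_convergence[where w = "\<lambda>r. indicator {u<..v} r * integral\<^sup>L \<sigma> w", OF m1])
      show "integrable lborel (\<lambda>r. indicator {u<..v} r * integral\<^sup>L \<sigma> w)" using uv by simp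
      show "AE r in lborel. (\<lambda>n. indicator {u<..v} r * bump_expectation (q_seq (n + N) / 2) (q_seq (n + N)) r)
          \<longlonglongrightarrow> indicator {u<..v} r * phi r"
      proof (rule AE_I2)
        fix r :: real
        show "(\<lambda>n. indicator {u<..v} r * bump_expectation (q_seq (n + N) / 2) (q_seq (n + N)) r) \<longlonglongrightarrow> indicator {u<..v} r * phi r"
        proof (cases "r \<in> {u<..v}")
          case True
          then have "(\<lambda>n. bump_expectation (q_seq (n + N) / 2) (q_seq (n + N)) r) \<longlonglongrightarrow> phi r"
            by (intro LIMSEQ_ignore_initial_segment[of "\<lambda>n. bump_expectation (q_seq n / 2) (q_seq n) r"] bump_expectation_lim) simp
          then show ?thesis by (intro tendsto_mult tendsto_const)
        qed simp
      qed
      show "AE r in lborel. norm (indicator {u<..v} r * bump_expectation (q_seq (n + N) / 2) (q_seq (n + N)) r)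
          \<le> indicator {u<..v} r * integral\<^sup>L \<sigma> w" for n
        using bump_expectation_bound[of "n + N"] by (intro AE_I2) (auto simp: indicator_def)
    qed measurable
  qed
qed

lemma hitting_probability:
  assumes uv: "0 < u" "u < v"
  shows "measure (P (ereal x)) {\<omega>\<in>space M. X v \<omega> = 0} - measure (P (ereal x)) {\<omega>\<in>space M. X u \<omega> = 0}
    = (\<integral>r. indicator {u<..v} r * phi r \<partial>lborel)"
proof (rule LIMSEQ_unique)
  let ?E = "\<lambda>n t. \<integral>\<omega>. extend0 b (potential (q_seq n / 2) (q_seq n)) (X t \<omega>) \<partial>P (ereal x)"
  show "(\<lambda>n. ?E n v - ?E n u)
    \<longlonglongrightarrow> measure (P (ereal x)) {\<omega>\<in>space M. X v \<omega> = 0} - measure (P (ereal x)) {\<omega>\<in>space M. X u \<omega> = 0}"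
    using uv by (intro tendsto_diff expectation_potential_tendsto) auto
  show "(\<lambda>n. ?E n v - ?E n u) \<longlonglongrightarrow> (\<integral>r. indicator {u<..v} r * phi r \<partial>lborel)"
    unfolding expectation_potential_diff[OF q_seq_pq uv] by (rule bump_expectation_tendsto[OF uv])
qed

text \<open>Both functions of t have the same integral over every interval (u,v], namely the
  increase of the probability of being at 0; continuity of both makes them equal at every t.\<close>

theorem hitting_density_eq:
  assumes t: "0 < t"
  shows "f x t = adj (\<lambda>l. exp (- l * t)) x"
proof -
  have fc: "continuous_on {0<..} (f x)" and f0: "\<And>t. 0 < t \<Longrightarrow> 0 \<le> f x t"
    and fd: "\<And>B. B \<in> sets borel \<Longrightarrow> B \<subseteq> {0<..} \<Longrightarrow>
          emeasure (P (ereal x)) {\<omega>\<in>space M. hitting_time0 X \<omega> \<in> ereal ` B} =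
          (\<integral>\<^sup>+t\<in>B. ennreal (f x t) \<partial>lborel)"
    using density x unfolding is_hitting_density_def by blast+
  note fi = integrable_Ioc_continuous[OF fc] and pi = integrable_Ioc_continuous[OF phi_continuous]
  have eq: "(\<integral>r. indicator {u<..v} r * f x r \<partial>lborel) = (\<integral>r. indicator {u<..v} r * phi r \<partial>lborel)"
    if uv: "0 < u" "u < v" for u v
  proof -
    have "ennreal (\<integral>r. indicator {u<..v} r * f x r \<partial>lborel) = (\<integral>\<^sup>+r. ennreal (indicator {u<..v} r * f x r) \<partial>lborel)"
      using f0 uv by (intro nn_integral_eq_integral[symmetric] fi) (auto simp: indicator_def)
    also have "\<dots> = (\<integral>\<^sup>+r\<in>{u<..v}. ennreal (f x r) \<partial>lborel)"
      by (intro nn_integral_cong) (auto simp: indicator_def)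
    also have "\<dots> = emeasure (P (ereal x)) {\<omega>\<in>space M. hitting_time0 X \<omega> \<in> ereal ` {u<..v}}"
      using uv by (intro fd[symmetric]) auto
    also have "{\<omega>\<in>space M. hitting_time0 X \<omega> \<in> ereal ` {u<..v}}
        = {\<omega>\<in>space M. X v \<omega> = 0} - {\<omega>\<in>space M. X u \<omega> = 0}"
      using hitting_time_Ioc[of _ u v] uv by auto
    also have "emeasure (P (ereal x)) \<dots> = ennreal (measure (P (ereal x)) ({\<omega>\<in>space M. X v \<omega> = 0} - {\<omega>\<in>space M. X u \<omega> = 0}))"
      by (rule Px.emeasure_eq_measure)
    also have "measure (P (ereal x)) ({\<omega>\<in>space M. X v \<omega> = 0} - {\<omega>\<in>space M. X u \<omega> = 0})
        = measure (P (ereal x)) {\<omega>\<in>space M. X v \<omega> = 0} - measure (P (ereal x)) {\<omega>\<in>space M. X u \<omega> = 0}"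
      using uv hit_sets[of u] hit_sets[of v] X_absorbed[of _ u v] by (intro Px.finite_measure_Diff) auto
    finally have e: "ennreal (\<integral>r. indicator {u<..v} r * f x r \<partial>lborel) = ennreal (\<integral>r. indicator {u<..v} r * phi r \<partial>lborel)"
      unfolding hitting_probability[OF uv] .
    \<comment> \<open>Equality in \<open>ennreal\<close> yields equality of reals only for
      nonnegative values. For \<open>phi\<close> the sign comes from the increasing probability of
      absorption.\<close>
    have "measure (P (ereal x)) {\<omega>\<in>space M. X u \<omega> = 0} \<le> measure (P (ereal x)) {\<omega>\<in>space M. X v \<omega> = 0}"
      using uv hit_sets[of v] X_absorbed[of _ u v] by (intro Px.finite_measure_mono) auto
    then have "0 \<le> (\<integral>r. indicator {u<..v} r * phi r \<partial>lborel)" using hitting_probability[OF uv] by simp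
    moreover have "0 \<le> (\<integral>r. indicator {u<..v} r * f x r \<partial>lborel)"
      using f0 uv by (intro Bochner_Integration.integral_nonneg) (auto simp: indicator_def)
    ultimately show ?thesis using e by simp
  qed
  have "f x t - phi t = 0"
  proof (rule continuous_zero_if_integrals_zero[where d = "\<lambda>t. f x t - phi t", OF _ _ _ t])
    show "continuous_on {0<..} (\<lambda>t. f x t - phi t)" by (intro continuous_intros fc phi_continuous)
    show "integrable lborel (\<lambda>r. indicator {u<..v} r * (f x r - phi r))" if "0 < u" for u v
      unfolding right_diff_distrib using that by (intro Bochner_Integration.integrable_diff fi pi)
    show "(\<integral>r. indicator {u<..v} r * (f x r - phi r) \<partial>lborel) = 0" if "0 < u" "u < v" for u v
      using fi[OF that(1)] pi[OF that(1)] eq[OF that] by (simp add: right_diff_distrib)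
  qed
  then show ?thesis by (simp add: phi_def)
qed

end

end

section \<open>Inversion\<close>

text \<open>The signed measure H d\<sigma>. The parts of \<open>H\<close> live on disjoint sets, so
  the pair is a Jordan decomposition even where the total mass is infinite.\<close>

definition signed_density :: "real measure \<Rightarrow> (real \<Rightarrow> real) \<Rightarrow> signed_meas"
  where "signed_density \<sigma> H =
    (density \<sigma> (\<lambda>l. ennreal (max 0 (H l))), density \<sigma> (\<lambda>l. ennreal (max 0 (- H l))))"

lemma signed_integrable_density:
  assumes [measurable]: "H \<in> borel_measurable \<sigma>" "h \<in> borel_measurable \<sigma>"
  shows "signed_integrable (signed_density \<sigma> H) h \<longleftrightarrow> integrable \<sigma> (\<lambda>l. H l * h l)"
proof -
  have eq: "signed_integrable (signed_density \<sigma> H) h \<longleftrightarrow>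
      integrable \<sigma> (\<lambda>l. max 0 (H l) * h l) \<and> integrable \<sigma> (\<lambda>l. max 0 (- H l) * h l)"
    unfolding signed_integrable_def signed_density_def fst_conv snd_conv
    by (subst (1 2) integrable_density) auto
  show ?thesis unfolding eq
  proof
    assume *: "integrable \<sigma> (\<lambda>l. max 0 (H l) * h l) \<and> integrable \<sigma> (\<lambda>l. max 0 (- H l) * h l)"
    then have "integrable \<sigma> (\<lambda>l. max 0 (H l) * h l - max 0 (- H l) * h l)" by simp
    moreover have "(\<lambda>l. max 0 (H l) * h l - max 0 (- H l) * h l) = (\<lambda>l. H l * h l)"
      by (auto simp: fun_eq_iff max_def)
    ultimately show "integrable \<sigma> (\<lambda>l. H l * h l)" by (simp only:)
  next
    assume *: "integrable \<sigma> (\<lambda>l. H l * h l)"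
    have le: "norm (max 0 u * v) \<le> norm (u * v)" "norm (max 0 (- u) * v) \<le> norm (u * v)" for u v :: real
      unfolding real_norm_def abs_mult by (intro mult_right_mono; simp add: max_def)+
    show "integrable \<sigma> (\<lambda>l. max 0 (H l) * h l) \<and> integrable \<sigma> (\<lambda>l. max 0 (- H l) * h l)"
    proof
      show "integrable \<sigma> (\<lambda>l. max 0 (H l) * h l)"
      proof (rule Bochner_Integration.integrable_bound[OF *])
        show "AE l in \<sigma>. norm (max 0 (H l) * h l) \<le> norm (H l * h l)" by (intro AE_I2 le)
      qed measurable
      show "integrable \<sigma> (\<lambda>l. max 0 (- H l) * h l)"
      proof (rule Bochner_Integration.integrable_bound[OF *])
        show "AE l in \<sigma>. norm (max 0 (- H l) * h l) \<le> norm (H l * h l)" by (intro AE_I2 le)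
      qed measurable
    qed
  qed
qed

lemma signed_integral_density:
  assumes m[measurable]: "H \<in> borel_measurable \<sigma>" "h \<in> borel_measurable \<sigma>"
    and int: "integrable \<sigma> (\<lambda>l. H l * h l)"
  shows "signed_integral (signed_density \<sigma> H) h = (\<integral>l. H l * h l \<partial>\<sigma>)"
proof -
  have i: "integrable \<sigma> (\<lambda>l. max 0 (H l) * h l)" "integrable \<sigma> (\<lambda>l. max 0 (- H l) * h l)"
    using signed_integrable_density[OF m] int
    unfolding signed_integrable_def signed_density_def fst_conv snd_conv
    by (subst (asm) (1 2) integrable_density; simp)+
  have "signed_integral (signed_density \<sigma> H) h
      = (\<integral>l. max 0 (H l) * h l \<partial>\<sigma>) - (\<integral>l. max 0 (- H l) * h l \<partial>\<sigma>)"
    unfolding signed_integral_def signed_density_def fst_conv snd_conv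
    by (subst (1 2) integral_density) auto
  also have "\<dots> = (\<integral>l. max 0 (H l) * h l - max 0 (- H l) * h l \<partial>\<sigma>)"
    by (rule Bochner_Integration.integral_diff[OF i, symmetric])
  also have "\<dots> = (\<integral>l. H l * h l \<partial>\<sigma>)"
    by (intro Bochner_Integration.integral_cong) (auto simp: max_def)
  finally show ?thesis .
qed

text \<open>Two L^2 limits of the same cutoff integrals agree a.e.; this is what makes the initial
  law determined by its hitting density.\<close>

lemma inversion_formula_unique:
  assumes "inversion_formula m \<psi> \<mu> g" and "inversion_formula m \<psi> \<mu> g'"
  shows "AE x in m. g x = g' x"
proof -
  let ?\<gamma> = "\<lambda>R x. signed_integral \<mu> (\<lambda>l. indicator {0..R} l * \<psi> (- l) x)"
  have [measurable]: "g \<in> borel_measurable m" "g' \<in> borel_measurable m" "?\<gamma> R \<in> borel_measurable m" for R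
    using assms by (auto simp: inversion_formula_def L2_fun_def)
  have lim: "((\<lambda>R. \<integral>\<^sup>+x. ennreal ((h x - ?\<gamma> R x)\<^sup>2) \<partial>m) \<longlongrightarrow> 0) at_top" if "h \<in> {g, g'}" for h
    using assms that by (auto simp: inversion_formula_def)
  have "(\<integral>\<^sup>+x. ennreal ((g x - g' x)\<^sup>2) \<partial>m) \<le> 0"
  proof (rule ennreal_le_epsilon)
    fix e :: real assume e: "0 < e"
    \<comment> \<open>A quarter again pays for the factor 2 and for two error terms.\<close>
    then have "\<forall>\<^sub>F R in at_top. (\<integral>\<^sup>+x. ennreal ((h x - ?\<gamma> R x)\<^sup>2) \<partial>m) < ennreal (e / 4)" if "h \<in> {g, g'}" for h
      using lim[OF that] by (intro order_tendstoD(2)) auto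
    then have "\<forall>\<^sub>F R in at_top. (\<integral>\<^sup>+x. ennreal ((g x - ?\<gamma> R x)\<^sup>2) \<partial>m) < ennreal (e / 4) \<and>
        (\<integral>\<^sup>+x. ennreal ((g' x - ?\<gamma> R x)\<^sup>2) \<partial>m) < ennreal (e / 4)"
      by (intro eventually_conj) auto
    then obtain R where R: "(\<integral>\<^sup>+x. ennreal ((g x - ?\<gamma> R x)\<^sup>2) \<partial>m) < ennreal (e / 4)"
        "(\<integral>\<^sup>+x. ennreal ((g' x - ?\<gamma> R x)\<^sup>2) \<partial>m) < ennreal (e / 4)"
      using eventually_happens[of _ "at_top :: real filter"] by auto
    have "(\<integral>\<^sup>+x. ennreal ((g x - g' x)\<^sup>2) \<partial>m)
        \<le> (\<integral>\<^sup>+x. ennreal 2 * ennreal ((g x - ?\<gamma> R x)\<^sup>2) + ennreal 2 * ennreal ((g' x - ?\<gamma> R x)\<^sup>2) \<partial>m)"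
    proof (rule nn_integral_mono)
      fix x
      have "(u - v)\<^sup>2 \<le> 2 * (u - w)\<^sup>2 + 2 * (v - w)\<^sup>2" for u v w :: real
        using zero_le_power2[of "(u - w) + (v - w)"] by (simp add: power2_eq_square algebra_simps)
      then show "ennreal ((g x - g' x)\<^sup>2)
          \<le> ennreal 2 * ennreal ((g x - ?\<gamma> R x)\<^sup>2) + ennreal 2 * ennreal ((g' x - ?\<gamma> R x)\<^sup>2)"
        by (simp add: ennreal_mult[symmetric] ennreal_plus[symmetric] ennreal_leI del: ennreal_plus ennreal_numeral)
    qed
    also have "\<dots> = ennreal 2 * (\<integral>\<^sup>+x. ennreal ((g x - ?\<gamma> R x)\<^sup>2) \<partial>m)
        + ennreal 2 * (\<integral>\<^sup>+x. ennreal ((g' x - ?\<gamma> R x)\<^sup>2) \<partial>m)"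
      by (simp add: nn_integral_add nn_integral_cmult)
    also have "\<dots> \<le> ennreal 2 * ennreal (e / 4) + ennreal 2 * ennreal (e / 4)"
      using R by (intro add_mono mult_left_mono) auto
    also have "\<dots> = 0 + ennreal e"
      using e by (simp add: ennreal_mult[symmetric] ennreal_plus[symmetric] del: ennreal_plus ennreal_numeral)
    finally show "(\<integral>\<^sup>+x. ennreal ((g x - g' x)\<^sup>2) \<partial>m) \<le> 0 + ennreal e" .
  qed
  then have "AE x in m. ennreal ((g x - g' x)\<^sup>2) = 0"
    by (subst nn_integral_0_iff_AE[symmetric]) auto
  then show ?thesis by eventually_elim simp
qed

context spectral_scale
begin

lemma signed_density_laplace:
  assumes H: "L2_fun \<sigma> H"
  shows "signed_density \<sigma> H \<in> laplace_measures"
    and "laplace_pos (fst (signed_density \<sigma> H))" and "laplace_pos (snd (signed_density \<sigma> H))"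
    and "0 < t \<Longrightarrow> laplace (signed_density \<sigma> H) t = (\<integral>l. exp (- l * t) * H l \<partial>\<sigma>)"
proof -
  note [measurable] = L2_\<sigma>_measurable[OF H]
  have int: "integrable \<sigma> (\<lambda>l. H l * exp (- l * t))" if "0 < t" for t
    by (rule L2_fun_mult_integrable[OF H L2_exp[OF that]])
  have pos: "laplace_pos (density \<sigma> (\<lambda>l. ennreal (K l)))"
    if [measurable]: "K \<in> borel_measurable borel" and K: "\<And>l. 0 \<le> K l" "\<And>l. K l \<le> \<bar>H l\<bar>" for K
    unfolding laplace_pos_def
  proof (intro conjI allI impI)
    have "AE l in \<sigma>. l \<notin> {..<0}" using AE_\<sigma>_nonneg by eventually_elim simp
    then have "AE l in \<sigma>. l \<in> {..<0} \<longrightarrow> ennreal (K l) \<le> 0" by eventually_elim simp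
    then have "{..<0} \<in> null_sets (density \<sigma> (\<lambda>l. ennreal (K l)))"
      by (subst null_sets_density_iff) auto
    then show "emeasure (density \<sigma> (\<lambda>l. ennreal (K l))) {..<0} = 0" by auto
  next
    fix t :: real assume t: "0 < t"
    have "(\<integral>\<^sup>+l. ennreal (exp (- l * t)) \<partial>density \<sigma> (\<lambda>l. ennreal (K l)))
        = (\<integral>\<^sup>+l. ennreal (K l) * ennreal (exp (- l * t)) \<partial>\<sigma>)"
      by (rule nn_integral_density) measurable
    also have "\<dots> \<le> (\<integral>\<^sup>+l. ennreal \<bar>H l * exp (- l * t)\<bar> \<partial>\<sigma>)"
      using K by (intro nn_integral_mono) (auto simp: ennreal_mult[symmetric] abs_mult intro!: ennreal_leI mult_right_mono)
    also have "\<dots> < \<infinity>"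
      using int[OF t] by (simp add: integrable_iff_bounded)
    finally show "(\<integral>\<^sup>+l. ennreal (exp (- l * t)) \<partial>density \<sigma> (\<lambda>l. ennreal (K l))) < \<infinity>" .
  qed simp
  have p: "laplace_pos (density \<sigma> (\<lambda>l. ennreal (max 0 (H l))))" by (rule pos) auto
  have n: "laplace_pos (density \<sigma> (\<lambda>l. ennreal (max 0 (- H l))))" by (rule pos) auto
  show "laplace_pos (fst (signed_density \<sigma> H))" "laplace_pos (snd (signed_density \<sigma> H))"
    using p n by (auto simp: signed_density_def)
  have "\<exists>D\<in>sets borel. emeasure (density \<sigma> (\<lambda>l. ennreal (max 0 (H l)))) D = 0 \<and>
      emeasure (density \<sigma> (\<lambda>l. ennreal (max 0 (- H l)))) (- D) = 0"
  proof (intro bexI conjI)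
    \<comment> \<open>This set carries no positive part, and its complement no negative
      part.\<close>
    show D[measurable]: "{l. H l \<le> 0} \<in> sets borel" by measurable
    have "{l. H l \<le> 0} \<in> null_sets (density \<sigma> (\<lambda>l. ennreal (max 0 (H l))))"
      by (subst null_sets_density_iff) (auto simp: max_def)
    then show "emeasure (density \<sigma> (\<lambda>l. ennreal (max 0 (H l)))) {l. H l \<le> 0} = 0" by auto
    have "- {l. H l \<le> 0} \<in> sets borel" using D by auto
    then have "- {l. H l \<le> 0} \<in> null_sets (density \<sigma> (\<lambda>l. ennreal (max 0 (- H l))))"
      by (subst null_sets_density_iff) (auto simp: max_def)
    then show "emeasure (density \<sigma> (\<lambda>l. ennreal (max 0 (- H l)))) (- {l. H l \<le> 0}) = 0" by auto
  qed
  then show "signed_density \<sigma> H \<in> laplace_measures"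
    using p n by (simp add: signed_density_def laplace_measures_def laplace_pos_def)
  show "laplace (signed_density \<sigma> H) t = (\<integral>l. exp (- l * t) * H l \<partial>\<sigma>)" if "0 < t"
    unfolding laplace_def using int[OF that] by (subst signed_integral_density) (auto simp: mult.commute)
qed

text \<open>The L^2 clause is \<open>adj_cutoff_tendsto\<close>. For the pointwise clause, a
  subsequence of the cutoff integrals converges a.e. to \<eta>, while at a point of absolute
  convergence all of them converge to the full integral, so the two limits coincide. A separate
  \<open>g\<close> admits any version of \<eta>.\<close>

lemma inversion_formula_signed_density:
  assumes \<eta>: "L2_fun m \<eta>" and H: "L2_fun \<sigma> H"
    and norm: "(\<integral>x. (\<eta> x)\<^sup>2 \<partial>m) = (\<integral>l. (H l)\<^sup>2 \<partial>\<sigma>)"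
    and inner: "\<And>G. admissible G \<Longrightarrow> (\<integral>x. adj G x * \<eta> x \<partial>m) = (\<integral>l. G l * H l \<partial>\<sigma>)"
    and g: "g \<in> borel_measurable m" "AE x in m. g x = \<eta> x"
  shows "inversion_formula m \<psi> (signed_density \<sigma> H) g"
proof -
  note [measurable] = L2_\<sigma>_measurable[OF H] g(1)
  define \<gamma> where "\<gamma> R = adj (\<lambda>l. indicator {0..R} l * H l)" for R
  have adm: "admissible (\<lambda>l. indicator {0..R} l * H l)" for R by (rule admissible_cutoff[OF H])
  have \<gamma>: "L2_fun m (\<gamma> R)" for R unfolding \<gamma>_def by (rule adj_contraction(1)[OF adm])
  have \<gamma>_eq: "signed_integral (signed_density \<sigma> H) (\<lambda>l. indicator {0..R} l * \<psi> (- l) x) = \<gamma> R x" for R x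
  proof -
    have "integrable \<sigma> (\<lambda>l. H l * (indicator {0..R} l * \<psi> (- l) x))"
      by (rule L2_fun_mult_integrable[OF H L2_indicator_psi])
    then have "signed_integral (signed_density \<sigma> H) (\<lambda>l. indicator {0..R} l * \<psi> (- l) x)
        = (\<integral>l. H l * (indicator {0..R} l * \<psi> (- l) x) \<partial>\<sigma>)"
      by (intro signed_integral_density) measurable
    then show ?thesis by (simp add: \<gamma>_def adj_def ac_simps)
  qed
  have gL2: "L2_fun m g"
  proof (rule L2_fun_bound[OF \<eta> g(1)])
    show "AE x in m. \<bar>g x\<bar> \<le> \<bar>\<eta> x\<bar>" using g(2) by eventually_elim simp
  qed
  have lim: "((\<lambda>R. \<integral>x. (\<eta> x - \<gamma> R x)\<^sup>2 \<partial>m) \<longlongrightarrow> 0) at_top"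
    unfolding \<gamma>_def by (rule adj_cutoff_tendsto[OF \<eta> H norm inner])
  have nn: "(\<integral>\<^sup>+x. ennreal ((g x - \<gamma> R x)\<^sup>2) \<partial>m) = ennreal (\<integral>x. (\<eta> x - \<gamma> R x)\<^sup>2 \<partial>m)" for R
  proof -
    have "(\<integral>\<^sup>+x. ennreal ((g x - \<gamma> R x)\<^sup>2) \<partial>m) = (\<integral>\<^sup>+x. ennreal ((\<eta> x - \<gamma> R x)\<^sup>2) \<partial>m)"
      by (rule nn_integral_cong_AE) (use g(2) in \<open>eventually_elim, simp\<close>)
    also have "\<dots> = ennreal (\<integral>x. (\<eta> x - \<gamma> R x)\<^sup>2 \<partial>m)"
      using L2_fun_diff[OF \<eta> \<gamma>[of R]] by (intro nn_integral_eq_integral) (auto simp: L2_fun_def)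
    finally show ?thesis .
  qed
  have nn_lim: "((\<lambda>R. \<integral>\<^sup>+x. ennreal ((g x - \<gamma> R x)\<^sup>2) \<partial>m) \<longlongrightarrow> 0) at_top"
    unfolding nn using tendsto_ennrealI[OF lim] by simp
  \<comment> \<open>The squares of the errors converge to 0 in L^1, which yields the a.e. convergent
    subsequence.\<close>
  have "(\<lambda>n. \<integral>x. norm ((\<eta> x - \<gamma> (real n) x)\<^sup>2) \<partial>m) \<longlonglongrightarrow> 0"
    using filterlim_compose[OF lim filterlim_real_sequentially] by simp
  moreover have "integrable m (\<lambda>x. (\<eta> x - \<gamma> (real n) x)\<^sup>2)" for n
    using L2_fun_diff[OF \<eta> \<gamma>[of "real n"]] by (simp add: L2_fun_def)
  ultimately obtain r :: "nat \<Rightarrow> nat" where r: "strict_mono r" "AE x in m. (\<lambda>n. (\<eta> x - \<gamma> (real (r n)) x)\<^sup>2) \<longlonglongrightarrow> 0"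
    using tendsto_L1_AE_subseq[of m "\<lambda>n x. (\<eta> x - \<gamma> (real n) x)\<^sup>2"] by blast
  have ae: "AE x in m. signed_integrable (signed_density \<sigma> H) (\<lambda>l. \<psi> (- l) x) \<longrightarrow>
      g x = signed_integral (signed_density \<sigma> H) (\<lambda>l. \<psi> (- l) x)"
    using r(2) g(2)
  proof eventually_elim
    case (elim x)
    show ?case
    proof
      assume "signed_integrable (signed_density \<sigma> H) (\<lambda>l. \<psi> (- l) x)"
      then have int: "integrable \<sigma> (\<lambda>l. H l * \<psi> (- l) x)"
        by (subst (asm) signed_integrable_density) measurable
      have "(\<lambda>n. \<gamma> (real n) x) \<longlonglongrightarrow> (\<integral>l. H l * \<psi> (- l) x \<partial>\<sigma>)"
        unfolding \<gamma>_def adj_def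
      proof (rule integral_dominated_convergence[where w = "\<lambda>l. \<bar>H l * \<psi> (- l) x\<bar>"])
        show "AE l in \<sigma>. (\<lambda>n. indicator {0..real n} l * H l * \<psi> (- l) x) \<longlonglongrightarrow> H l * \<psi> (- l) x"
          using AE_\<sigma>_nonneg
        proof eventually_elim
          case (elim l)
          have "\<forall>\<^sub>F n in sequentially. l \<le> real n"
            using filterlim_real_sequentially by (simp add: filterlim_at_top)
          then have "\<forall>\<^sub>F n in sequentially. indicator {0..real n} l * H l * \<psi> (- l) x = H l * \<psi> (- l) x"
            by eventually_elim (use elim in simp)
          then show ?case by (rule tendsto_eventually)
        qed
        show "integrable \<sigma> (\<lambda>l. \<bar>H l * \<psi> (- l) x\<bar>)" using int by simp
        show "AE l in \<sigma>. norm (indicator {0..real n} l * H l * \<psi> (- l) x) \<le> \<bar>H l * \<psi> (- l) x\<bar>" for n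
          by (auto simp: indicator_def)
      qed measurable
      then have lim1: "(\<lambda>n. \<gamma> (real (r n)) x) \<longlonglongrightarrow> (\<integral>l. H l * \<psi> (- l) x \<partial>\<sigma>)"
        using LIMSEQ_subseq_LIMSEQ[OF _ r(1)] by (simp add: comp_def)
      have "(\<lambda>n. \<eta> x - \<gamma> (real (r n)) x) \<longlonglongrightarrow> 0"
      proof -
        have "(\<lambda>n. sqrt ((\<eta> x - \<gamma> (real (r n)) x)\<^sup>2)) \<longlonglongrightarrow> sqrt 0"
          by (intro tendsto_real_sqrt elim(1))
        then show ?thesis by (simp add: tendsto_rabs_zero_iff)
      qed
      then have "(\<lambda>n. \<eta> x - (\<eta> x - \<gamma> (real (r n)) x)) \<longlonglongrightarrow> \<eta> x - 0" by (intro tendsto_diff tendsto_const)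
      then have "(\<lambda>n. \<gamma> (real (r n)) x) \<longlonglongrightarrow> \<eta> x" by simp
      with lim1 have "\<eta> x = (\<integral>l. H l * \<psi> (- l) x \<partial>\<sigma>)" by (blast intro: LIMSEQ_unique)
      also have "\<dots> = signed_integral (signed_density \<sigma> H) (\<lambda>l. \<psi> (- l) x)"
        using int by (intro signed_integral_density[symmetric]) measurable
      finally show "g x = signed_integral (signed_density \<sigma> H) (\<lambda>l. \<psi> (- l) x)" using elim(2) by simp
    qed
  qed
  show ?thesis
    unfolding inversion_formula_def \<gamma>_eq using gL2 \<gamma> nn_lim ae by blast
qed

end

section \<open>Recovering the initial law\<close>

context spectral_diffusion
begin

lemma mixed_density_eq:
  assumes \<eta>: "L2_fun m \<eta>" "AE x in m. 0 \<le> \<eta> x" and t: "0 < t"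
  shows "mixed_density b f (density m (\<lambda>x. ennreal (\<eta> x))) t
    = (\<integral>x. adj (\<lambda>l. exp (- l * t)) x * \<eta> x \<partial>m)"
proof -
  \<comment> \<open>The hitting density is specified for starting points in (0,b); elsewhere the
    adjoint vanishes with the eigenfunctions, so the restriction of the integral disappears.\<close>
  have eq: "indicator I x *\<^sub>R f x t = adj (\<lambda>l. exp (- l * t)) x" for x
    using hitting_density_eq[of x t] t adj_outside[of x] by (cases "x \<in> I") auto
  have [measurable]: "adj (\<lambda>l. exp (- l * t)) \<in> borel_measurable borel"
    by (rule adj_measurable) measurable
  note [measurable] = L2_m_measurable[OF \<eta>(1)]
  have "mixed_density b f (density m (\<lambda>x. ennreal (\<eta> x))) t
      = (\<integral>x. adj (\<lambda>l. exp (- l * t)) x \<partial>density m (\<lambda>x. ennreal (\<eta> x)))"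
    unfolding mixed_density_def set_lebesgue_integral_def eq ..
  also have "\<dots> = (\<integral>x. \<eta> x *\<^sub>R adj (\<lambda>l. exp (- l * t)) x \<partial>m)"
    by (rule integral_density) (use \<eta>(2) in measurable)
  finally show ?thesis by (simp add: mult.commute)
qed

text \<open>Stated with an existential signed measure so that it applies to two initial laws at
  once; \<open>inv_laplace_eq\<close> identifies the measure afterwards. The last conjunct recovers
  \<nu> from the function that the inversion formula determines a.e.\<close>

theorem mixed_density_inversion:
  assumes \<nu>: "L2_initial_law m \<nu>"
  shows "\<exists>\<mu>\<in>laplace_measures. (\<forall>t>0. laplace \<mu> t = mixed_density b f \<nu> t) \<and>
    mixed_density b f \<nu> \<in> CM \<and> inversion_formula m \<psi> \<mu> (\<lambda>x. enn2real (RN_deriv m \<nu> x)) \<and>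
    \<nu> = density m (\<lambda>x. ennreal (enn2real (RN_deriv m \<nu> x)))"
proof -
  obtain \<eta> where \<eta>: "L2_fun m \<eta>" "AE x in m. 0 \<le> \<eta> x"
    "\<nu> = density m (\<lambda>x. ennreal (\<eta> x))"
    using \<nu> by (auto simp: L2_initial_law_def)
  obtain H where H: "L2_fun \<sigma> H" "(\<integral>x. (\<eta> x)\<^sup>2 \<partial>m) = (\<integral>l. (H l)\<^sup>2 \<partial>\<sigma>)"
    "\<And>G. admissible G \<Longrightarrow> (\<integral>x. adj G x * \<eta> x \<partial>m) = (\<integral>l. G l * H l \<partial>\<sigma>)"
    using generalized_Fourier_transform[OF \<eta>(1)] by blast
  let ?\<mu> = "signed_density \<sigma> H"
  have L: "laplace ?\<mu> t = mixed_density b f \<nu> t" if "0 < t" for t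
    using mixed_density_eq[OF \<eta>(1,2) that] H(3)[OF admissible_exp[OF that]]
      signed_density_laplace(4)[OF H(1) that] by (simp add: \<eta>(3))
  have "mixed_density b f \<nu> \<in> CM"
    unfolding CM_def mem_Collect_eq
  proof (intro exI conjI allI impI)
    show "completely_monotone (\<lambda>t. \<integral>l. exp (- l * t) \<partial>fst ?\<mu>)"
      "completely_monotone (\<lambda>t. \<integral>l. exp (- l * t) \<partial>snd ?\<mu>)"
      by (intro laplace_pos_completely_monotone signed_density_laplace[OF H(1)])+
    show "mixed_density b f \<nu> t = (\<integral>l. exp (- l * t) \<partial>fst ?\<mu>) - (\<integral>l. exp (- l * t) \<partial>snd ?\<mu>)" if "0 < t" for t
      using L[OF that] by (simp add: laplace_def signed_integral_def)
  qed
  \<comment> \<open>The density \<eta> is real-valued and a.e. nonnegative, so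
    \<open>enn2real\<close> loses nothing.\<close>
  moreover have RN: "AE x in m. enn2real (RN_deriv m \<nu> x) = \<eta> x"
  proof -
    have "AE x in m. ennreal (\<eta> x) = RN_deriv m \<nu> x"
      using \<eta> by (intro m.RN_deriv_unique) (auto simp: L2_fun_def)
    then show ?thesis using \<eta>(2) by eventually_elim (metis enn2real_ennreal)
  qed
  then have "inversion_formula m \<psi> ?\<mu> (\<lambda>x. enn2real (RN_deriv m \<nu> x))"
    by (intro inversion_formula_signed_density[OF \<eta>(1) H(1,2,3)]) auto
  moreover have "\<nu> = density m (\<lambda>x. ennreal (enn2real (RN_deriv m \<nu> x)))"
  proof -
    have "density m (\<lambda>x. ennreal (\<eta> x))
        = density m (\<lambda>x. ennreal (enn2real (RN_deriv m \<nu> x)))"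
      using \<eta>(1) RN by (intro density_cong) (auto simp: L2_fun_def elim: eventually_mono)
    then show ?thesis using \<eta>(3) by simp
  qed
  ultimately show ?thesis using signed_density_laplace(1)[OF H(1)] L by blast
qed

end

theorem theoremA3:
  fixes b :: ereal and s :: "real \<Rightarrow> real" and m \<sigma> \<nu> :: "real measure"
    and \<psi> f :: "real \<Rightarrow> real \<Rightarrow> real"
    and M :: "'w measure" and X :: "real \<Rightarrow> 'w \<Rightarrow> ereal" and P :: "ereal \<Rightarrow> 'w measure"
  assumes "0 < b" and "scale_function b s" and "speed_measure b m" and "zero_accessible b s m"
    and "stopped_diffusion b s m M X P"
    and "\<And>l. is_psi b s m l (\<psi> l)"
    and "spectral_measure b m \<psi> M X P \<sigma>"
    and "\<And>t. 0 < t \<Longrightarrow> (\<integral>\<^sup>+l. ennreal (exp (- l * t)) \<partial>\<sigma>) < \<infinity>"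
    and "is_hitting_density b M X P f"
    and "L2_initial_law m \<nu>"
  shows "mixed_density b f \<nu> \<in> CM \<and>
    inversion_formula m \<psi> (inv_laplace (mixed_density b f \<nu>)) (\<lambda>x. enn2real (RN_deriv m \<nu> x)) \<and>
    (\<forall>\<nu>'. L2_initial_law m \<nu>' \<longrightarrow>
       (\<forall>t>0. mixed_density b f \<nu>' t = mixed_density b f \<nu> t) \<longrightarrow> \<nu>' = \<nu>)"
proof -
  interpret spectral_diffusion b s m \<psi> \<sigma> M X P f
    by unfold_locales (use assms in \<open>auto simp: spectral_measure_def\<close>)
  obtain \<mu> where \<mu>: "\<mu> \<in> laplace_measures" "\<And>t. 0 < t \<Longrightarrow> laplace \<mu> t = mixed_density b f \<nu> t"
    "mixed_density b f \<nu> \<in> CM" "inversion_formula m \<psi> \<mu> (\<lambda>x. enn2real (RN_deriv m \<nu> x))"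
    "\<nu> = density m (\<lambda>x. ennreal (enn2real (RN_deriv m \<nu> x)))"
    using mixed_density_inversion[OF assms(10)] by blast
  have "\<nu>' = \<nu>"
    if \<nu>': "L2_initial_law m \<nu>'" and eq: "\<forall>t>0. mixed_density b f \<nu>' t = mixed_density b f \<nu> t" for \<nu>'
  proof -
    obtain \<mu>' where \<mu>': "\<mu>' \<in> laplace_measures" "\<And>t. 0 < t \<Longrightarrow> laplace \<mu>' t = mixed_density b f \<nu>' t"
      "inversion_formula m \<psi> \<mu>' (\<lambda>x. enn2real (RN_deriv m \<nu>' x))"
      "\<nu>' = density m (\<lambda>x. ennreal (enn2real (RN_deriv m \<nu>' x)))"
      using mixed_density_inversion[OF \<nu>'] by blast
    \<comment> \<open>\<open>inv_laplace_eq\<close> compares values at positive times only, where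
      the two mixed densities agree, so both laws have the same signed measure.\<close>
    have "\<mu>' = inv_laplace (mixed_density b f \<nu>')" using \<mu>'(1,2) by (rule inv_laplace_eq[symmetric])
    also have "\<dots> = \<mu>" using \<mu>(2) eq by (intro inv_laplace_eq[OF \<mu>(1)]) simp
    finally have "inversion_formula m \<psi> \<mu> (\<lambda>x. enn2real (RN_deriv m \<nu>' x))" using \<mu>'(3) by simp
    from inversion_formula_unique[OF this \<mu>(4)]
    have "AE x in m. enn2real (RN_deriv m \<nu>' x) = enn2real (RN_deriv m \<nu> x)" .
    then have "density m (\<lambda>x. ennreal (enn2real (RN_deriv m \<nu>' x)))
        = density m (\<lambda>x. ennreal (enn2real (RN_deriv m \<nu> x)))"
      by (intro density_cong) (auto elim: eventually_mono)
    then show "\<nu>' = \<nu>" using \<mu>(5) \<mu>'(4) by simp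
  qed
  moreover have "inv_laplace (mixed_density b f \<nu>) = \<mu>" by (rule inv_laplace_eq[OF \<mu>(1,2)])
  ultimately show ?thesis using \<mu>(3,4) by simp
qed

end
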